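(* Let $\mathbf h$ be a connected Hopf monoid in the category of species. If $\mathbf k$ is a Hopf submonoid of $\mathbf h$, then $\mathbf h$ is a free left $\mathbf k$-module. Moreover, \[ \mathbf h\cong \mathbf k\boldsymbol{\cdot}(\mathbf h/\mathbf k_+\mathbf h) \] as left $\mathbf k$-modules (and as species).
   Context: Vector spaces are over a field $\mathbb{F}$ of characteristic $0$. A species $\mathbf q$ is a functor from finite sets and bijections to finite-dimensional $\mathbb{F}$-vector spaces and linear maps; it is connected if $\mathbf q[\emptyset]=\mathbb{F}$. The Cauchy product is $(\mathbf p\boldsymbol{\cdot}\mathbf q)[I]=\bigoplus_{S\sqcup T=I}\mathbf p[S]\otimes\mathbf q[T]$ (sum over ordered decompositions of $I$); monoids, comonoids and Hopf monoids are taken in the symmetric monoidal category of species with the Cauchy product. For a connected Hopf monoid $\mathbf k$, $\mathbf k_+$ is the species with $\mathbf k_+[I]=\mathbf k[I]$ for $I\neq\emptyset$ and $\mathbf k_+[\emptyset]=0$. If $\mathbf k$ is a submonoid of $\mathbf h$, then $\mathbf k_+\mathbf h$ denotes the right ideal of $\mathbf h$ generated by $\mathbf k_+$, i.e. $(\mathbf k_+\mathbf h)[I]=\sum_{S\sqcup T=I,\ S\neq\emptyset}\mu_{S,T}(\mathbf k[S]\otimes\mathbf h[T])$, where $\mu$ is the product of $\mathbf h$. *)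

theory Defs
  imports "HOL-Algebra.Module" "HOL-Algebra.AbelCoset" "HOL-Library.Infinite_Typeclass"
begin

section \<open>Vector spaces\<close>

locale char_zero_field = field R for R (structure) +
  assumes char_zero: "(n::nat) > 0 \<Longrightarrow> [n] \<cdot> \<one> \<noteq> \<zero>"

text \<open>
  Vector spaces over a field \<open>F\<close> are the modules of \<^theory>\<open>HOL-Algebra.Module\<close>. The record
  fields \<^const>\<open>mult\<close> and \<^const>\<open>one\<close> that a module record inherits from rings carry
  no meaning; they are \<^const>\<open>undefined\<close> in the constructions below.
\<close>

definition linear_maps ::
  "('f, 'r) ring_scheme \<Rightarrow> ('f, 'v, 'm) module_scheme \<Rightarrow> ('f, 'w, 'n) module_scheme \<Rightarrow> ('v \<Rightarrow> 'w) set"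
  where "linear_maps F V W =
    {f \<in> carrier V \<rightarrow> carrier W.
      (\<forall>x\<in>carrier V. \<forall>y\<in>carrier V. f (x \<oplus>\<^bsub>V\<^esub> y) = f x \<oplus>\<^bsub>W\<^esub> f y) \<and>
      (\<forall>c\<in>carrier F. \<forall>x\<in>carrier V. f (c \<odot>\<^bsub>V\<^esub> x) = c \<odot>\<^bsub>W\<^esub> f x)}"

definition bilinear_maps ::
  "('f, 'r) ring_scheme \<Rightarrow> ('f, 'u, 'l) module_scheme \<Rightarrow> ('f, 'v, 'm) module_scheme \<Rightarrow>
    ('f, 'w, 'n) module_scheme \<Rightarrow> ('u \<Rightarrow> 'v \<Rightarrow> 'w) set"
  where "bilinear_maps F U V W =
    {b. (\<forall>x\<in>carrier U. b x \<in> linear_maps F V W) \<and>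
        (\<forall>y\<in>carrier V. (\<lambda>x. b x y) \<in> linear_maps F U W)}"

definition mod_span ::
  "('f, 'r) ring_scheme \<Rightarrow> ('f, 'v, 'm) module_scheme \<Rightarrow> 'v set \<Rightarrow> 'v set"
  where "mod_span F V A = \<Inter>{N. submodule N F V \<and> A \<subseteq> N}"

definition finite_dimensional ::
  "('f, 'r) ring_scheme \<Rightarrow> ('f, 'v, 'm) module_scheme \<Rightarrow> bool"
  where "finite_dimensional F V \<longleftrightarrow>
    (\<exists>B. finite B \<and> B \<subseteq> carrier V \<and> mod_span F V B = carrier V)"

definition ground_module :: "('f, 'r) ring_scheme \<Rightarrow> ('f, 'f) module"
  where "ground_module F =
    \<lparr>carrier = carrier F, mult = undefined, one = undefined,
     zero = \<zero>\<^bsub>F\<^esub>, add = add F, smult = (\<otimes>\<^bsub>F\<^esub>)\<rparr>"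

definition quot_module ::
  "('f, 'v, 'm) module_scheme \<Rightarrow> 'v set \<Rightarrow> ('f, 'v set) module"
  where "quot_module V N =
    \<lparr>carrier = a_rcosets\<^bsub>V\<^esub> N, mult = undefined, one = undefined,
     zero = N, add = (\<lambda>X Y. X <+>\<^bsub>V\<^esub> Y), smult = (\<lambda>c X. N <+>\<^bsub>V\<^esub> (\<lambda>x. c \<odot>\<^bsub>V\<^esub> x) ` X)\<rparr>"

definition free_module :: "('f, 'r) ring_scheme \<Rightarrow> 'x set \<Rightarrow> ('f, 'x \<Rightarrow> 'f) module"
  where "free_module F B =
    \<lparr>carrier = {p. (\<forall>x. p x \<in> carrier F) \<and> (\<forall>x. x \<notin> B \<longrightarrow> p x = \<zero>\<^bsub>F\<^esub>) \<and> finite {x. p x \<noteq> \<zero>\<^bsub>F\<^esub>}},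
     mult = undefined, one = undefined,
     zero = (\<lambda>_. \<zero>\<^bsub>F\<^esub>), add = (\<lambda>p q x. p x \<oplus>\<^bsub>F\<^esub> q x), smult = (\<lambda>c p x. c \<otimes>\<^bsub>F\<^esub> p x)\<rparr>"

definition free_gen :: "('f, 'r) ring_scheme \<Rightarrow> 'x \<Rightarrow> 'x \<Rightarrow> 'f"
  where "free_gen F x = (\<lambda>y. if y = x then \<one>\<^bsub>F\<^esub> else \<zero>\<^bsub>F\<^esub>)"

text \<open>For a finite index set \<open>D\<close> the direct sum is the set of all (extensional) families.\<close>

definition direct_sum :: "'d set \<Rightarrow> ('d \<Rightarrow> ('f, 'v, 'm) module_scheme) \<Rightarrow> ('f, 'd \<Rightarrow> 'v) module"
  where "direct_sum D M =
    \<lparr>carrier = (\<Pi>\<^sub>E d\<in>D. carrier (M d)), mult = undefined, one = undefined,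
     zero = (\<lambda>d\<in>D. \<zero>\<^bsub>M d\<^esub>), add = (\<lambda>x y. \<lambda>d\<in>D. x d \<oplus>\<^bsub>M d\<^esub> y d),
     smult = (\<lambda>c x. \<lambda>d\<in>D. c \<odot>\<^bsub>M d\<^esub> x d)\<rparr>"


subsection \<open>Tensor products\<close>

text \<open>
  \<open>V \<otimes> W\<close> is the free vector space on \<open>V \<times> W\<close> modulo the bilinearity relations.
\<close>

definition tensor_rel ::
  "('f, 'r) ring_scheme \<Rightarrow> ('f, 'v, 'm) module_scheme \<Rightarrow> ('f, 'w, 'n) module_scheme \<Rightarrow>
    ('v \<times> 'w \<Rightarrow> 'f) set"
  where "tensor_rel F V W =
    (let M = free_module F (carrier V \<times> carrier W); e = (\<lambda>v w. free_gen F (v, w)) in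
     mod_span F M
       ({e (v \<oplus>\<^bsub>V\<^esub> v') w \<ominus>\<^bsub>M\<^esub> (e v w \<oplus>\<^bsub>M\<^esub> e v' w) | v v' w.
           v \<in> carrier V \<and> v' \<in> carrier V \<and> w \<in> carrier W} \<union>
        {e v (w \<oplus>\<^bsub>W\<^esub> w') \<ominus>\<^bsub>M\<^esub> (e v w \<oplus>\<^bsub>M\<^esub> e v w') | v w w'.
           v \<in> carrier V \<and> w \<in> carrier W \<and> w' \<in> carrier W} \<union>
        {e (c \<odot>\<^bsub>V\<^esub> v) w \<ominus>\<^bsub>M\<^esub> (c \<odot>\<^bsub>M\<^esub> e v w) | c v w.
           c \<in> carrier F \<and> v \<in> carrier V \<and> w \<in> carrier W} \<union>
        {e v (c \<odot>\<^bsub>W\<^esub> w) \<ominus>\<^bsub>M\<^esub> (c \<odot>\<^bsub>M\<^esub> e v w) | c v w.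
           c \<in> carrier F \<and> v \<in> carrier V \<and> w \<in> carrier W}))"

type_synonym ('f, 'v, 'w) tensor = "('v \<times> 'w \<Rightarrow> 'f) set"

definition tensor_module ::
  "('f, 'r) ring_scheme \<Rightarrow> ('f, 'v, 'm) module_scheme \<Rightarrow> ('f, 'w, 'n) module_scheme \<Rightarrow>
    ('f, ('f, 'v, 'w) tensor) module"
  where "tensor_module F V W =
    quot_module (free_module F (carrier V \<times> carrier W)) (tensor_rel F V W)"

definition pure_tensor ::
  "('f, 'r) ring_scheme \<Rightarrow> ('f, 'v, 'm) module_scheme \<Rightarrow> ('f, 'w, 'n) module_scheme \<Rightarrow>
    'v \<Rightarrow> 'w \<Rightarrow> ('f, 'v, 'w) tensor"
  where "pure_tensor F V W v w =
    tensor_rel F V W +>\<^bsub>free_module F (carrier V \<times> carrier W)\<^esub> free_gen F (v, w)"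

text \<open>
  The linear map \<open>V \<otimes> W \<rightarrow> U\<close> induced by a bilinear map \<open>b : V \<times> W \<rightarrow> U\<close>, evaluated on an
  arbitrary representative \<open>\<Sum> p(v,w) (v,w)\<close> of a class \<open>t\<close>.
\<close>

definition tensor_lift ::
  "('f, 'r) ring_scheme \<Rightarrow> ('f, 'u, 'l) module_scheme \<Rightarrow> ('v \<Rightarrow> 'w \<Rightarrow> 'u) \<Rightarrow>
    ('f, 'v, 'w) tensor \<Rightarrow> 'u"
  where "tensor_lift F U b t =
    (let p = (SOME p. p \<in> t) in
     \<Oplus>\<^bsub>U\<^esub>z\<in>{z. p z \<noteq> \<zero>\<^bsub>F\<^esub>}. p z \<odot>\<^bsub>U\<^esub> b (fst z) (snd z))"

text \<open>\<open>f \<otimes> g : V \<otimes> W \<rightarrow> V' \<otimes> W'\<close>\<close>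

definition tensor_map ::
  "('f, 'r) ring_scheme \<Rightarrow> ('f, 'v2, 'm) module_scheme \<Rightarrow> ('f, 'w2, 'n) module_scheme \<Rightarrow>
    ('v \<Rightarrow> 'v2) \<Rightarrow> ('w \<Rightarrow> 'w2) \<Rightarrow> ('f, 'v, 'w) tensor \<Rightarrow> ('f, 'v2, 'w2) tensor"
  where "tensor_map F V' W' f g =
    tensor_lift F (tensor_module F V' W') (\<lambda>v w. pure_tensor F V' W' (f v) (g w))"

text \<open>The associativity isomorphism \<open>(U \<otimes> V) \<otimes> W \<rightarrow> U \<otimes> (V \<otimes> W)\<close>\<close>

definition tensor_assoc ::
  "('f, 'r) ring_scheme \<Rightarrow> ('f, 'u, 'l) module_scheme \<Rightarrow> ('f, 'v, 'm) module_scheme \<Rightarrow>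
    ('f, 'w, 'n) module_scheme \<Rightarrow>
    ('f, ('f, 'u, 'v) tensor, 'w) tensor \<Rightarrow> ('f, 'u, ('f, 'v, 'w) tensor) tensor"
  where "tensor_assoc F U V W =
    (let VW = tensor_module F V W; UVW = tensor_module F U VW in
     tensor_lift F UVW
       (\<lambda>t w. tensor_lift F UVW (\<lambda>u v. pure_tensor F U VW u (pure_tensor F V W v w)) t))"

text \<open>
  For bilinear \<open>b\<^sub>i : U\<^sub>i \<times> V\<^sub>i \<rightarrow> W\<^sub>i\<close>, the composite
  \<open>(U\<^sub>1 \<otimes> U\<^sub>2) \<otimes> (V\<^sub>1 \<otimes> V\<^sub>2) \<rightarrow> (U\<^sub>1 \<otimes> V\<^sub>1) \<otimes> (U\<^sub>2 \<otimes> V\<^sub>2) \<rightarrow> W\<^sub>1 \<otimes> W\<^sub>2\<close>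
  of the interchange of the two middle factors with \<open>b\<^sub>1 \<otimes> b\<^sub>2\<close>,
  as a bilinear map in \<open>s \<in> U\<^sub>1 \<otimes> U\<^sub>2\<close> and \<open>t \<in> V\<^sub>1 \<otimes> V\<^sub>2\<close>.
\<close>

definition tensor_interchange ::
  "('f, 'r) ring_scheme \<Rightarrow> ('f, 'w1, 'm) module_scheme \<Rightarrow> ('f, 'w2, 'n) module_scheme \<Rightarrow>
    ('u1 \<Rightarrow> 'v1 \<Rightarrow> 'w1) \<Rightarrow> ('u2 \<Rightarrow> 'v2 \<Rightarrow> 'w2) \<Rightarrow>
    ('f, 'u1, 'u2) tensor \<Rightarrow> ('f, 'v1, 'v2) tensor \<Rightarrow> ('f, 'w1, 'w2) tensor"
  where "tensor_interchange F W1 W2 b1 b2 s t =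
    (let W = tensor_module F W1 W2 in
     tensor_lift F W
       (\<lambda>u1 u2. tensor_lift F W (\<lambda>v1 v2. pure_tensor F W1 W2 (b1 u1 v1) (b2 u2 v2)) t) s)"


section \<open>Species\<close>

text \<open>
  The finite sets are the finite subsets of an arbitrary infinite type. A bijection out of \<open>I\<close> is
  given by a function \<open>\<sigma>\<close> injective on \<open>I\<close>, with codomain \<open>\<sigma> ` I\<close>; \<open>spmap q I \<sigma>\<close> is the
  map \<open>q[I] \<rightarrow> q[\<sigma> ` I]\<close>.
\<close>

record ('a, 'f, 'v) species =
  obj :: "'a set \<Rightarrow> ('f, 'v) module"
  spmap :: "'a set \<Rightarrow> ('a \<Rightarrow> 'a) \<Rightarrow> 'v \<Rightarrow> 'v"

locale species = field F for F :: "('f, 'r) ring_scheme" (structure) +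
  fixes q :: "('a::infinite, 'f, 'v, 'm) species_scheme"
  assumes obj_module: "finite I \<Longrightarrow> Module.module F (obj q I)"
    and obj_finite_dimensional: "finite I \<Longrightarrow> finite_dimensional F (obj q I)"
    and spmap_linear: "\<lbrakk>finite I; inj_on \<sigma> I\<rbrakk> \<Longrightarrow>
      spmap q I \<sigma> \<in> linear_maps F (obj q I) (obj q (\<sigma> ` I))"
    and spmap_cong: "\<lbrakk>finite I; inj_on \<sigma> I; \<And>i. i \<in> I \<Longrightarrow> \<sigma> i = \<tau> i; x \<in> carrier (obj q I)\<rbrakk> \<Longrightarrow>
      spmap q I \<sigma> x = spmap q I \<tau> x"
    and spmap_id: "\<lbrakk>finite I; x \<in> carrier (obj q I)\<rbrakk> \<Longrightarrow> spmap q I id x = x"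
    and spmap_comp: "\<lbrakk>finite I; inj_on \<sigma> I; inj_on \<tau> (\<sigma> ` I); x \<in> carrier (obj q I)\<rbrakk> \<Longrightarrow>
      spmap q I (\<tau> \<circ> \<sigma>) x = spmap q (\<sigma> ` I) \<tau> (spmap q I \<sigma> x)"

text \<open>\<open>q[\<emptyset>] = F\<close>, up to isomorphism of vector spaces.\<close>

definition connected_species ::
  "('f, 'r) ring_scheme \<Rightarrow> ('a, 'f, 'v, 'm) species_scheme \<Rightarrow> bool"
  where "connected_species F q \<longleftrightarrow>
    (\<exists>f \<in> linear_maps F (ground_module F) (obj q {}). bij_betw f (carrier F) (carrier (obj q {})))"

definition species_iso ::
  "('f, 'r) ring_scheme \<Rightarrow> ('a, 'f, 'v, 'm) species_scheme \<Rightarrow> ('a, 'f, 'w, 'n) species_scheme \<Rightarrow>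
    ('a set \<Rightarrow> 'v \<Rightarrow> 'w) \<Rightarrow> bool"
  where "species_iso F p q f \<longleftrightarrow>
    (\<forall>I. finite I \<longrightarrow>
      f I \<in> linear_maps F (obj p I) (obj q I) \<and>
      bij_betw (f I) (carrier (obj p I)) (carrier (obj q I))) \<and>
    (\<forall>I \<sigma>. finite I \<and> inj_on \<sigma> I \<longrightarrow>
      (\<forall>x\<in>carrier (obj p I). f (\<sigma> ` I) (spmap p I \<sigma> x) = spmap q I \<sigma> (f I x)))"

definition subspecies ::
  "('f, 'r) ring_scheme \<Rightarrow> ('a, 'f, 'v, 'm) species_scheme \<Rightarrow> ('a set \<Rightarrow> 'v set) \<Rightarrow> bool"
  where "subspecies F q k \<longleftrightarrow>
    (\<forall>I. finite I \<longrightarrow> submodule (k I) F (obj q I)) \<and>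
    (\<forall>I \<sigma>. finite I \<and> inj_on \<sigma> I \<longrightarrow> spmap q I \<sigma> ` k I \<subseteq> k (\<sigma> ` I))"

text \<open>
  For a subspecies \<open>N\<close> of \<open>q\<close> and a bijection \<open>\<sigma>\<close>, the map \<open>spmap q I \<sigma>\<close> sends cosets of \<open>N I\<close>
  onto cosets of \<open>N (\<sigma> ` I)\<close>.
\<close>

definition quot_species ::
  "('a, 'f, 'v, 'm) species_scheme \<Rightarrow> ('a set \<Rightarrow> 'v set) \<Rightarrow> ('a, 'f, 'v set) species"
  where "quot_species q N =
    \<lparr>obj = (\<lambda>I. quot_module (obj q I) (N I)), spmap = (\<lambda>I \<sigma> X. spmap q I \<sigma> ` X)\<rparr>"

definition decomps :: "'a set \<Rightarrow> ('a set \<times> 'a set) set"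
  where "decomps I = {(S, T). S \<union> T = I \<and> S \<inter> T = {}}"

definition cauchy ::
  "('f, 'r) ring_scheme \<Rightarrow> ('a, 'f, 'v, 'm) species_scheme \<Rightarrow> ('a, 'f, 'w, 'n) species_scheme \<Rightarrow>
    ('a, 'f, 'a set \<times> 'a set \<Rightarrow> ('f, 'v, 'w) tensor) species"
  where "cauchy F p q =
    \<lparr>obj = (\<lambda>I. direct_sum (decomps I) (\<lambda>(S, T). tensor_module F (obj p S) (obj q T))),
     spmap = (\<lambda>I \<sigma> x. \<lambda>(S', T')\<in>decomps (\<sigma> ` I).
       let S = I \<inter> \<sigma> -` S'; T = I \<inter> \<sigma> -` T' in
       tensor_map F (obj p S') (obj q T') (spmap p S \<sigma>) (spmap q T \<sigma>) (x (S, T)))\<rparr>"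


section \<open>Monoids, comonoids and Hopf monoids in species\<close>

text \<open>
  Structure morphisms are given by their components: a product \<open>p \<cdot> p \<rightarrow> p\<close> by bilinear maps
  \<open>\<mu>\<^sub>S\<^sub>,\<^sub>T : p[S] \<times> p[T] \<rightarrow> p[S \<union> T]\<close>, a coproduct \<open>p \<rightarrow> p \<cdot> p\<close> by linear maps
  \<open>\<Delta>\<^sub>S\<^sub>,\<^sub>T : p[S \<union> T] \<rightarrow> p[S] \<otimes> p[T]\<close>, for disjoint \<open>S\<close> and \<open>T\<close>. The unit object is
  concentrated on the empty set, so that a unit is an element of \<open>p[\<emptyset>]\<close> and a counit
  a linear form on \<open>p[\<emptyset>]\<close>.
\<close>

record ('a, 'f, 'v) monoid_species = "('a, 'f, 'v) species" +
  mu :: "'a set \<Rightarrow> 'a set \<Rightarrow> 'v \<Rightarrow> 'v \<Rightarrow> 'v"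
  unit_elt :: 'v

record ('a, 'f, 'v) hopf_species = "('a, 'f, 'v) monoid_species" +
  Delta :: "'a set \<Rightarrow> 'a set \<Rightarrow> 'v \<Rightarrow> ('f, 'v, 'v) tensor"
  counit :: "'v \<Rightarrow> 'f"
  antipode :: "'a set \<Rightarrow> 'v \<Rightarrow> 'v"

locale species_monoid = species F p
  for F :: "('f, 'r) ring_scheme" (structure)
    and p :: "('a::infinite, 'f, 'v, 'm) monoid_species_scheme" +
  assumes mu_bilinear: "\<lbrakk>finite S; finite T; S \<inter> T = {}\<rbrakk> \<Longrightarrow>
      mu p S T \<in> bilinear_maps F (obj p S) (obj p T) (obj p (S \<union> T))"
    and mu_natural: "\<lbrakk>finite S; finite T; S \<inter> T = {}; inj_on \<sigma> (S \<union> T);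
        x \<in> carrier (obj p S); y \<in> carrier (obj p T)\<rbrakk> \<Longrightarrow>
      spmap p (S \<union> T) \<sigma> (mu p S T x y) = mu p (\<sigma> ` S) (\<sigma> ` T) (spmap p S \<sigma> x) (spmap p T \<sigma> y)"
    and mu_assoc: "\<lbrakk>finite R; finite S; finite T; R \<inter> S = {}; R \<inter> T = {}; S \<inter> T = {};
        x \<in> carrier (obj p R); y \<in> carrier (obj p S); z \<in> carrier (obj p T)\<rbrakk> \<Longrightarrow>
      mu p (R \<union> S) T (mu p R S x y) z = mu p R (S \<union> T) x (mu p S T y z)"
    and unit_closed: "unit_elt p \<in> carrier (obj p {})"
    and mu_unit_left: "\<lbrakk>finite I; x \<in> carrier (obj p I)\<rbrakk> \<Longrightarrow> mu p {} I (unit_elt p) x = x"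
    and mu_unit_right: "\<lbrakk>finite I; x \<in> carrier (obj p I)\<rbrakk> \<Longrightarrow> mu p I {} x (unit_elt p) = x"

locale species_comonoid = species F p
  for F :: "('f, 'r) ring_scheme" (structure)
    and p :: "('a::infinite, 'f, 'v, 'm) hopf_species_scheme" +
  assumes Delta_linear: "\<lbrakk>finite S; finite T; S \<inter> T = {}\<rbrakk> \<Longrightarrow>
      Delta p S T \<in> linear_maps F (obj p (S \<union> T)) (tensor_module F (obj p S) (obj p T))"
    and Delta_natural: "\<lbrakk>finite S; finite T; S \<inter> T = {}; inj_on \<sigma> (S \<union> T);
        x \<in> carrier (obj p (S \<union> T))\<rbrakk> \<Longrightarrow>
      Delta p (\<sigma> ` S) (\<sigma> ` T) (spmap p (S \<union> T) \<sigma> x) =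
      tensor_map F (obj p (\<sigma> ` S)) (obj p (\<sigma> ` T)) (spmap p S \<sigma>) (spmap p T \<sigma>) (Delta p S T x)"
    and Delta_coassoc: "\<lbrakk>finite R; finite S; finite T; R \<inter> S = {}; R \<inter> T = {}; S \<inter> T = {};
        x \<in> carrier (obj p (R \<union> S \<union> T))\<rbrakk> \<Longrightarrow>
      tensor_assoc F (obj p R) (obj p S) (obj p T)
        (tensor_map F (tensor_module F (obj p R) (obj p S)) (obj p T)
          (Delta p R S) id (Delta p (R \<union> S) T x)) =
      tensor_map F (obj p R) (tensor_module F (obj p S) (obj p T))
        id (Delta p S T) (Delta p R (S \<union> T) x)"
    and counit_linear: "counit p \<in> linear_maps F (obj p {}) (ground_module F)"
    and Delta_counit_left: "\<lbrakk>finite I; x \<in> carrier (obj p I)\<rbrakk> \<Longrightarrow>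
      tensor_lift F (obj p I) (\<lambda>u y. counit p u \<odot>\<^bsub>obj p I\<^esub> y) (Delta p {} I x) = x"
    and Delta_counit_right: "\<lbrakk>finite I; x \<in> carrier (obj p I)\<rbrakk> \<Longrightarrow>
      tensor_lift F (obj p I) (\<lambda>y u. counit p u \<odot>\<^bsub>obj p I\<^esub> y) (Delta p I {} x) = x"

text \<open>The braiding of the Cauchy product is the one without signs.\<close>

locale species_bimonoid = species_monoid F p + species_comonoid F p
  for F :: "('f, 'r) ring_scheme" (structure)
    and p :: "('a::infinite, 'f, 'v, 'm) hopf_species_scheme" +
  assumes Delta_mu: "\<lbrakk>finite S; finite T; S \<inter> T = {}; A \<inter> B = {}; A \<union> B = S \<union> T;
        x \<in> carrier (obj p S); y \<in> carrier (obj p T)\<rbrakk> \<Longrightarrow>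
      Delta p A B (mu p S T x y) =
      tensor_interchange F (obj p A) (obj p B) (mu p (S \<inter> A) (T \<inter> A)) (mu p (S \<inter> B) (T \<inter> B))
        (Delta p (S \<inter> A) (S \<inter> B) x) (Delta p (T \<inter> A) (T \<inter> B) y)"
    and Delta_unit: "Delta p {} {} (unit_elt p) =
      pure_tensor F (obj p {}) (obj p {}) (unit_elt p) (unit_elt p)"
    and counit_mu: "\<lbrakk>x \<in> carrier (obj p {}); y \<in> carrier (obj p {})\<rbrakk> \<Longrightarrow>
      counit p (mu p {} {} x y) = counit p x \<otimes> counit p y"
    and counit_unit: "counit p (unit_elt p) = \<one>"

locale hopf_monoid = species_bimonoid F p
  for F :: "('f, 'r) ring_scheme" (structure)
    and p :: "('a::infinite, 'f, 'v, 'm) hopf_species_scheme" +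
  assumes antipode_linear: "finite I \<Longrightarrow> antipode p I \<in> linear_maps F (obj p I) (obj p I)"
    and antipode_natural: "\<lbrakk>finite I; inj_on \<sigma> I; x \<in> carrier (obj p I)\<rbrakk> \<Longrightarrow>
      antipode p (\<sigma> ` I) (spmap p I \<sigma> x) = spmap p I \<sigma> (antipode p I x)"
    and antipode_left: "\<lbrakk>finite I; x \<in> carrier (obj p I)\<rbrakk> \<Longrightarrow>
      (\<Oplus>\<^bsub>obj p I\<^esub>S\<in>Pow I.
        tensor_lift F (obj p I) (\<lambda>y z. mu p S (I - S) (antipode p S y) z) (Delta p S (I - S) x)) =
      (if I = {} then counit p x \<odot>\<^bsub>obj p I\<^esub> unit_elt p else \<zero>\<^bsub>obj p I\<^esub>)"
    and antipode_right: "\<lbrakk>finite I; x \<in> carrier (obj p I)\<rbrakk> \<Longrightarrow>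
      (\<Oplus>\<^bsub>obj p I\<^esub>S\<in>Pow I.
        tensor_lift F (obj p I) (\<lambda>y z. mu p S (I - S) y (antipode p (I - S) z))
          (Delta p S (I - S) x)) =
      (if I = {} then counit p x \<odot>\<^bsub>obj p I\<^esub> unit_elt p else \<zero>\<^bsub>obj p I\<^esub>)"

text \<open>
  Over a field \<open>k[S] \<otimes> k[T] \<rightarrow> h[S] \<otimes> h[T]\<close> is injective, and \<open>k[S] \<otimes> k[T]\<close> is identified with
  its image, the span of the pure tensors with factors in \<open>k\<close>.
\<close>

definition hopf_submonoid ::
  "('f, 'r) ring_scheme \<Rightarrow> ('a, 'f, 'v, 'm) hopf_species_scheme \<Rightarrow> ('a set \<Rightarrow> 'v set) \<Rightarrow> bool"
  where "hopf_submonoid F h k \<longleftrightarrow>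
    subspecies F h k \<and>
    unit_elt h \<in> k {} \<and>
    (\<forall>S T. finite S \<and> finite T \<and> S \<inter> T = {} \<longrightarrow>
      (\<forall>x\<in>k S. \<forall>y\<in>k T. mu h S T x y \<in> k (S \<union> T)) \<and>
      (\<forall>x\<in>k (S \<union> T). Delta h S T x \<in>
        mod_span F (tensor_module F (obj h S) (obj h T))
          {pure_tensor F (obj h S) (obj h T) y z | y z. y \<in> k S \<and> z \<in> k T})) \<and>
    (\<forall>I. finite I \<longrightarrow> antipode h I ` k I \<subseteq> k I)"

definition sub_monoid ::
  "('a, 'f, 'v, 'm) monoid_species_scheme \<Rightarrow> ('a set \<Rightarrow> 'v set) \<Rightarrow> ('a, 'f, 'v) monoid_species"
  where "sub_monoid h k =
    \<lparr>obj = (\<lambda>I. (obj h I)\<lparr>carrier := k I\<rparr>), spmap = spmap h, mu = mu h, unit_elt = unit_elt h\<rparr>"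

text \<open>The right ideal \<open>k\<^sub>+h\<close> of \<open>h\<close>\<close>

definition plus_ideal ::
  "('f, 'r) ring_scheme \<Rightarrow> ('a, 'f, 'v, 'm) monoid_species_scheme \<Rightarrow> ('a set \<Rightarrow> 'v set) \<Rightarrow>
    'a set \<Rightarrow> 'v set"
  where "plus_ideal F h k I =
    mod_span F (obj h I)
      {mu h S T x y | S T x y. (S, T) \<in> decomps I \<and> S \<noteq> {} \<and> x \<in> k S \<and> y \<in> carrier (obj h T)}"


subsection \<open>Left modules\<close>

locale left_module = K: species_monoid F k + M: species F m
  for F :: "('f, 'r) ring_scheme" (structure)
    and k :: "('a::infinite, 'f, 'v, 'k) monoid_species_scheme"
    and m :: "('a, 'f, 'w, 'm) species_scheme" +
  fixes act :: "'a set \<Rightarrow> 'a set \<Rightarrow> 'v \<Rightarrow> 'w \<Rightarrow> 'w"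
  assumes act_bilinear: "\<lbrakk>finite S; finite T; S \<inter> T = {}\<rbrakk> \<Longrightarrow>
      act S T \<in> bilinear_maps F (obj k S) (obj m T) (obj m (S \<union> T))"
    and act_natural: "\<lbrakk>finite S; finite T; S \<inter> T = {}; inj_on \<sigma> (S \<union> T);
        x \<in> carrier (obj k S); u \<in> carrier (obj m T)\<rbrakk> \<Longrightarrow>
      spmap m (S \<union> T) \<sigma> (act S T x u) = act (\<sigma> ` S) (\<sigma> ` T) (spmap k S \<sigma> x) (spmap m T \<sigma> u)"
    and act_assoc: "\<lbrakk>finite R; finite S; finite T; R \<inter> S = {}; R \<inter> T = {}; S \<inter> T = {};
        x \<in> carrier (obj k R); y \<in> carrier (obj k S); u \<in> carrier (obj m T)\<rbrakk> \<Longrightarrow>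
      act (R \<union> S) T (mu k R S x y) u = act R (S \<union> T) x (act S T y u)"
    and act_unit: "\<lbrakk>finite I; u \<in> carrier (obj m I)\<rbrakk> \<Longrightarrow> act {} I (unit_elt k) u = u"

text \<open>
  The action \<open>\<mu> \<cdot> id : k \<cdot> (k \<cdot> q) \<cong> (k \<cdot> k) \<cdot> q \<rightarrow> k \<cdot> q\<close>. Acting with \<open>x \<in> k[A]\<close>, the
  component at \<open>(S, T)\<close> comes from the component of \<open>z\<close> at \<open>(S - A, T)\<close> if \<open>A \<subseteq> S\<close>,
  and vanishes otherwise.
\<close>

definition cauchy_act ::
  "('f, 'r) ring_scheme \<Rightarrow> ('a, 'f, 'v, 'k) monoid_species_scheme \<Rightarrow> ('a, 'f, 'w, 'm) species_scheme \<Rightarrow>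
    'a set \<Rightarrow> 'a set \<Rightarrow> 'v \<Rightarrow> ('a set \<times> 'a set \<Rightarrow> ('f, 'v, 'w) tensor) \<Rightarrow>
    ('a set \<times> 'a set \<Rightarrow> ('f, 'v, 'w) tensor)"
  where "cauchy_act F k q A B x z =
    (\<lambda>(S, T)\<in>decomps (A \<union> B).
      if A \<subseteq> S
      then tensor_map F (obj k S) (obj q T) (mu k A (S - A) x) id (z (S - A, T))
      else \<zero>\<^bsub>tensor_module F (obj k S) (obj q T)\<^esub>)"

definition left_modules_isomorphic ::
  "('f, 'r) ring_scheme \<Rightarrow> ('a::infinite, 'f, 'v, 'k) monoid_species_scheme \<Rightarrow>
    ('a, 'f, 'w, 'm) species_scheme \<Rightarrow> ('a set \<Rightarrow> 'a set \<Rightarrow> 'v \<Rightarrow> 'w \<Rightarrow> 'w) \<Rightarrow>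
    ('a, 'f, 'u, 'n) species_scheme \<Rightarrow> ('a set \<Rightarrow> 'a set \<Rightarrow> 'v \<Rightarrow> 'u \<Rightarrow> 'u) \<Rightarrow> bool"
  where "left_modules_isomorphic F k m a n b \<longleftrightarrow>
    left_module F k m a \<and> left_module F k n b \<and>
    (\<exists>f. species_iso F m n f \<and>
      (\<forall>S T. finite S \<and> finite T \<and> S \<inter> T = {} \<longrightarrow>
        (\<forall>x\<in>carrier (obj k S). \<forall>y\<in>carrier (obj m T).
          f (S \<union> T) (a S T x y) = b S T x (f T y))))"

text \<open>
  A left module is free if it is isomorphic to \<open>k \<cdot> q\<close> for some species \<open>q\<close>. It is no restriction
  to take \<open>q\<close> with elements in the type of the module: for connected \<open>k\<close> the species \<open>q\<close> is
  recovered in the module as the image of \<open>k[\<emptyset>] \<otimes> q\<close>.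
\<close>

definition free_left_module ::
  "('f, 'r) ring_scheme \<Rightarrow> ('a::infinite, 'f, 'v, 'k) monoid_species_scheme \<Rightarrow>
    ('a, 'f, 'w, 'm) species_scheme \<Rightarrow> ('a set \<Rightarrow> 'a set \<Rightarrow> 'v \<Rightarrow> 'w \<Rightarrow> 'w) \<Rightarrow> bool"
  where "free_left_module F k m a \<longleftrightarrow>
    (\<exists>q :: ('a, 'f, 'w) species. species F q \<and>
      left_modules_isomorphic F k m a (cauchy F k q) (cauchy_act F k q))"

end

theory Submission
  imports Defs
begin

text \<open>
  Let \<open>q = h/k\<^sub>+h\<close> with projection \<open>\<pi> : h \<rightarrow> q\<close>. Averaging over bijections (characteristic \<open>0\<close>)
  gives a natural section \<open>s\<close> of \<open>\<pi>\<close>, and \<open>x \<otimes> y \<mapsto> x s(y)\<close> defines a map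
  \<open>\<phi> : k \<cdot> q \<rightarrow> h\<close> of left \<open>k\<close>-modules. It is surjective by induction on the cardinality
  of the finite set, since \<open>u - s(\<pi> u) \<in> k\<^sub>+h\<close>. For injectivity consider
  \<open>\<psi> = (id \<otimes> \<pi>) \<Delta> : h \<rightarrow> h \<cdot> q\<close>. As \<open>k\<close> is closed under the coproduct, the \<open>(A, B)\<close> component
  of \<open>\<psi>(x s(y))\<close>, for \<open>x \<in> k[S]\<close> and \<open>y \<in> q[T]\<close>, vanishes unless \<open>S \<subseteq> A\<close>, and it is \<open>x \<otimes> y\<close>
  if \<open>S = A\<close>. Thus \<open>\<psi> \<phi>\<close> is triangular, with the inclusions \<open>k[A] \<otimes> q[B] \<subseteq> h[A] \<otimes> q[B]\<close> on the diagonal.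
\<close>

section \<open>Linear algebra\<close>

text \<open>A section of \<open>\<pi>\<close> chosen separately on each finite set would give
  bijections \<open>k \<cdot> q \<rightarrow> h\<close> that need not commute with relabelling.
  Characteristic 0 enters to make one choice natural: the average is over bijections out of a
  standard set of each cardinality. Connectedness enters because \<open>h[\<emptyset>]\<close> is
  spanned by the unit; this forces the coproduct at \<open>(I, \<emptyset>)\<close> to be
  \<open>x \<otimes> 1\<close>, and so the diagonal of \<open>\<psi> \<phi>\<close> consists of
  exact inclusions. These stay injective after tensoring since \<open>k[A]\<close> is a direct
  summand of \<open>h[A]\<close>.

  In the definition of freeness the elements of \<open>q\<close> have the type of the module,
  whereas those of \<open>h/k\<^sub>+h\<close> are cosets. The argument is therefore run for any
  \<open>q\<close> with a natural surjection from \<open>h\<close> whose kernel is the ideal, and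
  applied both to the cosets and to a complement inside \<open>h\<close>. Verifying the species and
  module axioms for \<open>k \<cdot> q\<close> directly would mean manipulating families of tensors;
  instead they are pulled back from \<open>h\<close> along the bijection
  \<open>\<phi>\<close>.\<close>

lemma linear_mapsI:
  assumes "\<And>x. x \<in> carrier V \<Longrightarrow> f x \<in> carrier W"
    and "\<And>x y. \<lbrakk>x \<in> carrier V; y \<in> carrier V\<rbrakk> \<Longrightarrow> f (x \<oplus>\<^bsub>V\<^esub> y) = f x \<oplus>\<^bsub>W\<^esub> f y"
    and "\<And>c x. \<lbrakk>c \<in> carrier F; x \<in> carrier V\<rbrakk> \<Longrightarrow> f (c \<odot>\<^bsub>V\<^esub> x) = c \<odot>\<^bsub>W\<^esub> f x"
  shows "f \<in> linear_maps F V W"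
  using assms by (auto simp: linear_maps_def)

lemma linear_mapsD:
  assumes "f \<in> linear_maps F V W"
  shows linear_maps_closed: "x \<in> carrier V \<Longrightarrow> f x \<in> carrier W"
    and linear_maps_add: "\<lbrakk>x \<in> carrier V; y \<in> carrier V\<rbrakk> \<Longrightarrow> f (x \<oplus>\<^bsub>V\<^esub> y) = f x \<oplus>\<^bsub>W\<^esub> f y"
    and linear_maps_smult: "\<lbrakk>c \<in> carrier F; x \<in> carrier V\<rbrakk> \<Longrightarrow> f (c \<odot>\<^bsub>V\<^esub> x) = c \<odot>\<^bsub>W\<^esub> f x"
  using assms by (auto simp: linear_maps_def)

lemma (in abelian_group) minus_eq_zero_iff:
  "\<lbrakk>x \<in> carrier G; y \<in> carrier G\<rbrakk> \<Longrightarrow> x \<ominus> y = \<zero> \<longleftrightarrow> x = y"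
  using add.inv_solve_right'[of \<zero> x y] by (auto simp: a_minus_def)

lemma (in abelian_group) minus_zero_right: "x \<in> carrier G \<Longrightarrow> x \<ominus> \<zero> = x"
  by (metis a_assoc a_inv_closed l_neg minus_eq r_zero zero_closed)

lemma linear_maps_zero:
  assumes "f \<in> linear_maps F V W" and "Module.module F V" and "Module.module F W"
  shows "f \<zero>\<^bsub>V\<^esub> = \<zero>\<^bsub>W\<^esub>"
proof -
  interpret V: Module.module F V by fact
  interpret W: Module.module F W by fact
  show ?thesis
    using linear_maps_smult[OF assms(1), of "\<zero>\<^bsub>F\<^esub>" "\<zero>\<^bsub>V\<^esub>"]
      linear_maps_closed[OF assms(1), of "\<zero>\<^bsub>V\<^esub>"] by simp
qed

lemma linear_maps_neg:
  assumes "f \<in> linear_maps F V W" and "Module.module F V" and "Module.module F W"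
    and "x \<in> carrier V"
  shows "f (\<ominus>\<^bsub>V\<^esub> x) = \<ominus>\<^bsub>W\<^esub> f x"
proof -
  interpret V: Module.module F V by fact
  interpret W: Module.module F W by fact
  show ?thesis
    using linear_maps_smult[OF assms(1), of "\<ominus>\<^bsub>F\<^esub> \<one>\<^bsub>F\<^esub>" x]
      linear_maps_closed[OF assms(1), of x] assms(4)
    by (simp add: V.smult_l_minus W.smult_l_minus)
qed

lemma linear_maps_minus:
  assumes "f \<in> linear_maps F V W" and "Module.module F V" and "Module.module F W"
    and "x \<in> carrier V" and "y \<in> carrier V"
  shows "f (x \<ominus>\<^bsub>V\<^esub> y) = f x \<ominus>\<^bsub>W\<^esub> f y"
proof -
  interpret V: Module.module F V by fact
  interpret W: Module.module F W by fact
  show ?thesis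
    using assms by (simp add: a_minus_def linear_maps_add[OF assms(1)] linear_maps_neg)
qed

lemma linear_maps_finsum:
  assumes "f \<in> linear_maps F V W" and "Module.module F V" and "Module.module F W"
    and "g \<in> A \<rightarrow> carrier V"
  shows "f (\<Oplus>\<^bsub>V\<^esub>i\<in>A. g i) = (\<Oplus>\<^bsub>W\<^esub>i\<in>A. f (g i))"
proof -
  interpret V: Module.module F V by fact
  interpret W: Module.module F W by fact
  show ?thesis using assms(4)
  proof (induction A rule: infinite_finite_induct)
    case (insert a A)
    then have "(\<lambda>i. f (g i)) \<in> A \<rightarrow> carrier W" "f (g a) \<in> carrier W" "g a \<in> carrier V"
      "g \<in> A \<rightarrow> carrier V"
      using linear_maps_closed[OF assms(1)] by auto
    with insert show ?case by (simp add: linear_maps_add[OF assms(1)])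
  qed (use linear_maps_zero[OF assms(1-3)] in auto)
qed

lemma linear_maps_id: "(\<lambda>x. x) \<in> linear_maps F V V"
  by (auto simp: linear_maps_def)

lemma linear_maps_compose:
  assumes "f \<in> linear_maps F U V" and "g \<in> linear_maps F V W"
  shows "(\<lambda>x. g (f x)) \<in> linear_maps F U W"
  using assms by (auto simp: linear_maps_def Pi_iff)

lemma linear_maps_subspace:
  assumes "f \<in> linear_maps F V W" and "N \<subseteq> carrier V"
  shows "f \<in> linear_maps F (V\<lparr>carrier := N\<rparr>) W"
  using assms by (auto simp: linear_maps_def Pi_iff subset_eq)

lemma linear_maps_into_subspace:
  assumes "f \<in> linear_maps F V W" and "\<And>x. x \<in> carrier V \<Longrightarrow> f x \<in> N"
  shows "f \<in> linear_maps F V (W\<lparr>carrier := N\<rparr>)"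
  using assms by (auto simp: linear_maps_def Pi_iff subset_eq)

lemma linear_maps_sum:
  assumes "Module.module F V" and "Module.module F W"
    and "\<And>i. i \<in> A \<Longrightarrow> f i \<in> linear_maps F V W"
  shows "(\<lambda>x. \<Oplus>\<^bsub>W\<^esub>i\<in>A. f i x) \<in> linear_maps F V W"
proof (cases "finite A")
  case True
  interpret V: Module.module F V by fact
  interpret W: Module.module F W by fact
  show ?thesis
  proof (rule linear_mapsI)
    fix x y assume x: "x \<in> carrier V" and y: "y \<in> carrier V"
    have c: "(\<lambda>i. f i z) \<in> A \<rightarrow> carrier W" if "z \<in> carrier V" for z
      using linear_maps_closed[OF assms(3)] that by auto
    show "(\<Oplus>\<^bsub>W\<^esub>i\<in>A. f i x) \<in> carrier W" using c[OF x] by simp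
    have "(\<Oplus>\<^bsub>W\<^esub>i\<in>A. f i (x \<oplus>\<^bsub>V\<^esub> y)) = (\<Oplus>\<^bsub>W\<^esub>i\<in>A. f i x \<oplus>\<^bsub>W\<^esub> f i y)"
      using c[OF x] c[OF y] x y by (intro W.finsum_cong') (auto simp: linear_maps_add[OF assms(3)])
    then show "(\<Oplus>\<^bsub>W\<^esub>i\<in>A. f i (x \<oplus>\<^bsub>V\<^esub> y)) = (\<Oplus>\<^bsub>W\<^esub>i\<in>A. f i x) \<oplus>\<^bsub>W\<^esub> (\<Oplus>\<^bsub>W\<^esub>i\<in>A. f i y)"
      using c[OF x] c[OF y] by (simp add: W.finsum_addf)
    fix d assume d: "d \<in> carrier F"
    have "(\<Oplus>\<^bsub>W\<^esub>i\<in>A. f i (d \<odot>\<^bsub>V\<^esub> x)) = (\<Oplus>\<^bsub>W\<^esub>i\<in>A. d \<odot>\<^bsub>W\<^esub> f i x)"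
      using c[OF x] x d by (intro W.finsum_cong') (auto simp: linear_maps_smult[OF assms(3)])
    then show "(\<Oplus>\<^bsub>W\<^esub>i\<in>A. f i (d \<odot>\<^bsub>V\<^esub> x)) = d \<odot>\<^bsub>W\<^esub> (\<Oplus>\<^bsub>W\<^esub>i\<in>A. f i x)"
      using W.finsum_smult_ldistr[OF True d c[OF x]] by simp
  qed
next
  case False
  interpret V: Module.module F V by fact
  interpret W: Module.module F W by fact
  show ?thesis by (rule linear_mapsI) (simp_all add: False)
qed

lemma linear_maps_scaled:
  assumes "Module.module F V" and "Module.module F W"
    and "f \<in> linear_maps F V W" and "c \<in> carrier F"
  shows "(\<lambda>x. c \<odot>\<^bsub>W\<^esub> f x) \<in> linear_maps F V W"
proof -
  interpret V: Module.module F V by fact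
  interpret W: Module.module F W by fact
  show ?thesis
    using assms(4) linear_mapsD[OF assms(3)]
    by (intro linear_mapsI)
      (auto simp: W.smult_r_distr W.smult_assoc1[symmetric] V.m_comm)
qed

lemma linear_maps_diff:
  assumes "Module.module F V" and "Module.module F W"
    and "f \<in> linear_maps F V W" and "g \<in> linear_maps F V W"
  shows "(\<lambda>x. f x \<ominus>\<^bsub>W\<^esub> g x) \<in> linear_maps F V W"
proof -
  interpret V: Module.module F V by fact
  interpret W: Module.module F W by fact
  show ?thesis
    using linear_mapsD[OF assms(3)] linear_mapsD[OF assms(4)]
    by (intro linear_mapsI)
      (auto simp: a_minus_def W.smult_r_distr W.smult_r_minus W.minus_add W.a_ac)
qed

lemma linear_maps_zero_map:
  assumes "Module.module F W"
  shows "(\<lambda>x. \<zero>\<^bsub>W\<^esub>) \<in> linear_maps F V W"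
proof -
  interpret W: Module.module F W by fact
  show ?thesis by (rule linear_mapsI) auto
qed

lemma bilinear_mapsD:
  assumes "b \<in> bilinear_maps F U V W"
  shows bilinear_maps_right: "x \<in> carrier U \<Longrightarrow> b x \<in> linear_maps F V W"
    and bilinear_maps_left: "y \<in> carrier V \<Longrightarrow> (\<lambda>x. b x y) \<in> linear_maps F U W"
    and bilinear_maps_closed: "\<lbrakk>x \<in> carrier U; y \<in> carrier V\<rbrakk> \<Longrightarrow> b x y \<in> carrier W"
  using assms by (auto simp: bilinear_maps_def linear_maps_def)

lemma bilinear_mapsI:
  assumes "\<And>x. x \<in> carrier U \<Longrightarrow> b x \<in> linear_maps F V W"
    and "\<And>y. y \<in> carrier V \<Longrightarrow> (\<lambda>x. b x y) \<in> linear_maps F U W"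
  shows "b \<in> bilinear_maps F U V W"
  using assms by (simp add: bilinear_maps_def)

lemma linear_bilinear_compose:
  assumes "b \<in> bilinear_maps F U V W" and "f \<in> linear_maps F U' U"
    and "g \<in> linear_maps F V' V" and "l \<in> linear_maps F W W'"
  shows "(\<lambda>x y. l (b (f x) (g y))) \<in> bilinear_maps F U' V' W'"
proof (rule bilinear_mapsI)
  fix x assume "x \<in> carrier U'"
  then have "b (f x) \<in> linear_maps F V W"
    using assms by (auto intro: bilinear_maps_right linear_maps_closed)
  from linear_maps_compose[OF linear_maps_compose[OF assms(3) this] assms(4)]
  show "(\<lambda>y. l (b (f x) (g y))) \<in> linear_maps F V' W'" .
next
  fix y assume "y \<in> carrier V'"
  then have "(\<lambda>u. b u (g y)) \<in> linear_maps F U W"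
    using assms by (auto intro: bilinear_maps_left linear_maps_closed)
  from linear_maps_compose[OF linear_maps_compose[OF assms(2) this] assms(4)]
  show "(\<lambda>x. l (b (f x) (g y))) \<in> linear_maps F U' W'" .
qed

section \<open>Submodules, spans and finite dimension\<close>

lemma submoduleD:
  assumes "submodule N F V" and "Module.module F V"
  shows submodule_subset: "N \<subseteq> carrier V"
    and submodule_zero: "\<zero>\<^bsub>V\<^esub> \<in> N"
    and submodule_add: "\<lbrakk>x \<in> N; y \<in> N\<rbrakk> \<Longrightarrow> x \<oplus>\<^bsub>V\<^esub> y \<in> N"
    and submodule_neg: "x \<in> N \<Longrightarrow> \<ominus>\<^bsub>V\<^esub> x \<in> N"
    and submodule_minus: "\<lbrakk>x \<in> N; y \<in> N\<rbrakk> \<Longrightarrow> x \<ominus>\<^bsub>V\<^esub> y \<in> N"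
    and submodule_smult: "\<lbrakk>c \<in> carrier F; x \<in> N\<rbrakk> \<Longrightarrow> c \<odot>\<^bsub>V\<^esub> x \<in> N"
proof -
  interpret V: Module.module F V by fact
  interpret N: submodule N F V by fact
  show "\<zero>\<^bsub>V\<^esub> \<in> N" using N.one_closed by simp
qed (use Module.module.submoduleE[OF assms(2,1)] in \<open>auto simp: a_minus_def\<close>)

lemma submoduleI':
  assumes "Module.module F V" and "N \<subseteq> carrier V" and "\<zero>\<^bsub>V\<^esub> \<in> N"
    and "\<And>x y. \<lbrakk>x \<in> N; y \<in> N\<rbrakk> \<Longrightarrow> x \<oplus>\<^bsub>V\<^esub> y \<in> N"
    and "\<And>c x. \<lbrakk>c \<in> carrier F; x \<in> N\<rbrakk> \<Longrightarrow> c \<odot>\<^bsub>V\<^esub> x \<in> N"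
  shows "submodule N F V"
proof -
  interpret V: Module.module F V by fact
  have "\<ominus>\<^bsub>V\<^esub> x \<in> N" if "x \<in> N" for x
    using assms(5)[of "\<ominus>\<^bsub>F\<^esub> \<one>\<^bsub>F\<^esub>" x] that assms(2) by (auto simp: V.smult_l_minus subset_eq)
  then show ?thesis using assms by (intro V.submoduleI) auto
qed

text \<open>Kernels, equalizers and preimages are collected because the later extensions from
  generators share one shape: the set where a linear condition holds is a submodule, so it contains
  a span as soon as it contains the generators.\<close>

lemma submodule_kernel:
  assumes "f \<in> linear_maps F V W" and "Module.module F V" and "Module.module F W"
  shows "submodule {x \<in> carrier V. f x = \<zero>\<^bsub>W\<^esub>} F V"
proof -
  interpret V: Module.module F V by fact
  interpret W: Module.module F W by fact
  show ?thesis
    by (rule submoduleI') (use assms linear_mapsD[OF assms(1)] linear_maps_zero[OF assms] in auto)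
qed

lemma submodule_equalizer:
  assumes "f \<in> linear_maps F V W" and "g \<in> linear_maps F V W"
    and "Module.module F V" and "Module.module F W"
  shows "submodule {x \<in> carrier V. f x = g x} F V"
proof -
  interpret V: Module.module F V by fact
  interpret W: Module.module F W by fact
  show ?thesis
    by (rule submoduleI') (use assms linear_mapsD[OF assms(1)] linear_mapsD[OF assms(2)]
      linear_maps_zero[OF assms(1,3,4)] linear_maps_zero[OF assms(2,3,4)] in auto)
qed

lemma submodule_vimage:
  assumes "f \<in> linear_maps F V W" and "Module.module F V" and "Module.module F W"
    and "submodule N F W"
  shows "submodule {x \<in> carrier V. f x \<in> N} F V"
proof -
  interpret V: Module.module F V by fact
  interpret W: Module.module F W by fact
  note N = submoduleD[OF assms(4,3)]
  show ?thesis
    by (rule submoduleI') (use assms linear_mapsD[OF assms(1)] linear_maps_zero[OF assms(1-3)] N in auto)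
qed

lemma submodule_image:
  assumes "f \<in> linear_maps F V W" and "Module.module F V" and "Module.module F W"
  shows "submodule (f ` carrier V) F W"
proof -
  interpret V: Module.module F V by fact
  interpret W: Module.module F W by fact
  note f = linear_mapsD[OF assms(1)]
  show ?thesis
  proof (rule submoduleI')
    show "\<zero>\<^bsub>W\<^esub> \<in> f ` carrier V"
      using linear_maps_zero[OF assms] by (metis V.zero_closed image_eqI)
    show "x \<oplus>\<^bsub>W\<^esub> y \<in> f ` carrier V" if "x \<in> f ` carrier V" "y \<in> f ` carrier V" for x y
      using that by (auto simp: f(2)[symmetric])
    show "c \<odot>\<^bsub>W\<^esub> x \<in> f ` carrier V" if "c \<in> carrier F" "x \<in> f ` carrier V" for c x
      using that by (auto simp: f(3)[symmetric])
  qed (use assms f in auto)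
qed

lemma mod_span_incl: "A \<subseteq> mod_span F V A"
  by (auto simp: mod_span_def)

lemma mod_span_minimal: "\<lbrakk>submodule N F V; A \<subseteq> N\<rbrakk> \<Longrightarrow> mod_span F V A \<subseteq> N"
  by (auto simp: mod_span_def)

lemma submodule_mod_span:
  assumes "Module.module F V" and "A \<subseteq> carrier V"
  shows "submodule (mod_span F V A) F V"
proof -
  interpret V: Module.module F V by fact
  have "submodule (carrier V) F V" by (rule V.carrier_is_submodule)
  with assms(2) show ?thesis
    by (intro submoduleI'[OF assms(1)])
      (auto simp: mod_span_def intro: submoduleD[OF _ assms(1)])
qed

text \<open>The span of the images of \<open>B\<close> has as its preimage a submodule of
  \<open>V\<close> containing \<open>B\<close>, hence all of \<open>V\<close>; surjectivity does the
  rest.\<close>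

lemma finite_dimensional_image:
  assumes "f \<in> linear_maps F V W" and "Module.module F V" and "Module.module F W"
    and "f ` carrier V = carrier W" and "finite_dimensional F V"
  shows "finite_dimensional F W"
proof -
  interpret W: Module.module F W by fact
  from assms(5) obtain B where B: "finite B" "B \<subseteq> carrier V" "mod_span F V B = carrier V"
    by (auto simp: finite_dimensional_def)
  have fB: "f ` B \<subseteq> carrier W" using B(2) assms(4) by auto
  note s = submodule_mod_span[OF assms(3) fB]
  have "mod_span F V B \<subseteq> {x \<in> carrier V. f x \<in> mod_span F W (f ` B)}"
    using B(2) mod_span_incl[of "f ` B" F W]
    by (intro mod_span_minimal submodule_vimage[OF assms(1-3) s]) auto
  then have "f ` carrier V \<subseteq> mod_span F W (f ` B)" using B(3) by auto
  then have "carrier W \<subseteq> mod_span F W (f ` B)" using assms(4) by simp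
  moreover have "mod_span F W (f ` B) \<subseteq> carrier W" using submodule_subset[OF s assms(3)] .
  ultimately show ?thesis using B(1) fB unfolding finite_dimensional_def by blast
qed

text \<open>The module axioms are mostly identities, which pass along a surjection respecting the
  operations; for the existence of negatives the image of a negative serves. \<open>W\<close> is
  merely a record at the outset, which is the situation of \<open>quot_module\<close>.\<close>

lemma module_homomorphic_image:
  assumes "Module.module F V" and "carrier W = f ` carrier V" and "\<zero>\<^bsub>W\<^esub> = f \<zero>\<^bsub>V\<^esub>"
    and add: "\<And>x y. \<lbrakk>x \<in> carrier V; y \<in> carrier V\<rbrakk> \<Longrightarrow> f x \<oplus>\<^bsub>W\<^esub> f y = f (x \<oplus>\<^bsub>V\<^esub> y)"
    and smult: "\<And>c x. \<lbrakk>c \<in> carrier F; x \<in> carrier V\<rbrakk> \<Longrightarrow> c \<odot>\<^bsub>W\<^esub> f x = f (c \<odot>\<^bsub>V\<^esub> x)"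
  shows "Module.module F W" and "f \<in> linear_maps F V W"
proof -
  interpret V: Module.module F V by fact
  show "Module.module F W"
  proof (rule moduleI)
    show "cring F" by (rule V.R.cring_axioms)
    show "abelian_group W"
    proof (rule abelian_groupI)
      fix x assume "x \<in> carrier W"
      then obtain u where u: "u \<in> carrier V" "x = f u" using assms(2) by auto
      then show "\<exists>y\<in>carrier W. y \<oplus>\<^bsub>W\<^esub> x = \<zero>\<^bsub>W\<^esub>"
        using assms(2,3) add[of "\<ominus>\<^bsub>V\<^esub> u" u] by (auto simp: V.l_neg)
    qed (auto simp: assms(2,3) add V.a_ac)
  qed (auto simp: assms(2) add smult V.smult_l_distr V.smult_r_distr V.smult_assoc1)
  show "f \<in> linear_maps F V W"
    by (rule linear_mapsI) (auto simp: assms(2) add smult)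
qed

section \<open>Quotients, direct sums and free modules\<close>

lemma quot_module:
  assumes "Module.module F V" and "submodule N F V"
  shows module_quot_module: "Module.module F (quot_module V N)"
    and coset_linear: "(\<lambda>x. N +>\<^bsub>V\<^esub> x) \<in> linear_maps F V (quot_module V N)"
    and coset_surj: "(\<lambda>x. N +>\<^bsub>V\<^esub> x) ` carrier V = carrier (quot_module V N)"
    and coset_eq_iff: "\<lbrakk>x \<in> carrier V; y \<in> carrier V\<rbrakk> \<Longrightarrow>
      N +>\<^bsub>V\<^esub> x = N +>\<^bsub>V\<^esub> y \<longleftrightarrow> x \<ominus>\<^bsub>V\<^esub> y \<in> N"
    and mem_coset_iff: "\<lbrakk>x \<in> carrier V; y \<in> carrier V\<rbrakk> \<Longrightarrow>
      y \<in> N +>\<^bsub>V\<^esub> x \<longleftrightarrow> y \<ominus>\<^bsub>V\<^esub> x \<in> N"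
    and coset_subset: "x \<in> carrier V \<Longrightarrow> N +>\<^bsub>V\<^esub> x \<subseteq> carrier V"
proof -
  interpret V: Module.module F V by fact
  note N = submoduleD[OF assms(2,1)]
  interpret N: abelian_subgroup N V
    using assms(2) V.abelian_group_axioms by (intro abelian_subgroupI3 additive_subgroup.intro)
      (auto simp: submodule_def)
  show coset: "y \<in> N +>\<^bsub>V\<^esub> x \<longleftrightarrow> y \<ominus>\<^bsub>V\<^esub> x \<in> N" if "x \<in> carrier V" "y \<in> carrier V" for x y
    using N.a_rcos_module[OF that] by (simp add: a_minus_def)
  show sub: "N +>\<^bsub>V\<^esub> x \<subseteq> carrier V" if "x \<in> carrier V" for x
    using V.a_r_coset_subset_G[OF N(1) that] .
  show "N +>\<^bsub>V\<^esub> x = N +>\<^bsub>V\<^esub> y \<longleftrightarrow> x \<ominus>\<^bsub>V\<^esub> y \<in> N" if "x \<in> carrier V" "y \<in> carrier V" for x y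
    using that coset[of y x] N.a_repr_independence'[of x y] N.a_repr_independenceD[of y x]
      N.a_rcos_self[of x] by metis
  \<comment> \<open>The scalar action on cosets adds \<open>N\<close> back after scaling: for
    \<open>c = \<zero>\<close> the scaled coset is only the zero vector, which in general is not a
    coset.\<close>
  have sm: "N <+>\<^bsub>V\<^esub> (\<lambda>u. c \<odot>\<^bsub>V\<^esub> u) ` (N +>\<^bsub>V\<^esub> x) = N +>\<^bsub>V\<^esub> (c \<odot>\<^bsub>V\<^esub> x)"
    if c: "c \<in> carrier F" and x: "x \<in> carrier V" for c x
  proof (intro equalityI subsetI)
    fix z assume "z \<in> N <+>\<^bsub>V\<^esub> (\<lambda>u. c \<odot>\<^bsub>V\<^esub> u) ` (N +>\<^bsub>V\<^esub> x)"
    then obtain n m where nm: "n \<in> N" "m \<in> N" "z = n \<oplus>\<^bsub>V\<^esub> c \<odot>\<^bsub>V\<^esub> (m \<oplus>\<^bsub>V\<^esub> x)"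
      by (auto simp: set_add_def' a_r_coset_def')
    then have car: "n \<in> carrier V" "m \<in> carrier V" using N(1) by auto
    then have "z = (n \<oplus>\<^bsub>V\<^esub> c \<odot>\<^bsub>V\<^esub> m) \<oplus>\<^bsub>V\<^esub> c \<odot>\<^bsub>V\<^esub> x"
      using nm c x by (simp add: V.smult_r_distr V.a_assoc)
    moreover have "n \<oplus>\<^bsub>V\<^esub> c \<odot>\<^bsub>V\<^esub> m \<in> N" using nm c by (simp add: N)
    ultimately show "z \<in> N +>\<^bsub>V\<^esub> (c \<odot>\<^bsub>V\<^esub> x)" by (auto simp: a_r_coset_def')
  next
    fix z assume "z \<in> N +>\<^bsub>V\<^esub> (c \<odot>\<^bsub>V\<^esub> x)"
    then obtain n where n: "n \<in> N" "z = n \<oplus>\<^bsub>V\<^esub> c \<odot>\<^bsub>V\<^esub> x" by (auto simp: a_r_coset_def')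
    moreover have "x \<in> N +>\<^bsub>V\<^esub> x" using x by (rule N.a_rcos_self)
    ultimately show "z \<in> N <+>\<^bsub>V\<^esub> (\<lambda>u. c \<odot>\<^bsub>V\<^esub> u) ` (N +>\<^bsub>V\<^esub> x)"
      by (auto simp: set_add_def')
  qed
  show surj: "(\<lambda>x. N +>\<^bsub>V\<^esub> x) ` carrier V = carrier (quot_module V N)"
    by (auto simp: quot_module_def A_RCOSETS_def')
  have "N +>\<^bsub>V\<^esub> \<zero>\<^bsub>V\<^esub> = N" using N(1) by (rule V.a_coset_add_zero)
  then show "Module.module F (quot_module V N)" "(\<lambda>x. N +>\<^bsub>V\<^esub> x) \<in> linear_maps F V (quot_module V N)"
    using module_homomorphic_image[OF assms(1) surj[symmetric]]
    by (auto simp: quot_module_def N.a_rcos_sum sm)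
qed

lemma module_direct_sum:
  assumes "cring F" and "\<And>d. d \<in> D \<Longrightarrow> Module.module F (M d)"
  shows "Module.module F (direct_sum D M)"
proof -
  have M: "abelian_group (M d)" "abelian_monoid (M d)" if "d \<in> D" for d
    using assms(2)[OF that] by (auto simp: Module.module_def abelian_group_def)
  note add = abelian_monoid.a_closed[OF M(2)] abelian_monoid.zero_closed[OF M(2)]
    abelian_monoid.a_assoc[OF M(2)] abelian_monoid.l_zero[OF M(2)]
    abelian_group.a_inv_closed[OF M(1)] abelian_group.l_neg[OF M(1)]
    abelian_group.r_neg[OF M(1)]
  note smult = Module.module.smult_closed[OF assms(2)] Module.module.smult_l_distr[OF assms(2)]
    Module.module.smult_r_distr[OF assms(2)] Module.module.smult_assoc1[OF assms(2)]
    Module.module.smult_one[OF assms(2)]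
  note defs = direct_sum_def PiE_iff extensional_def
  show ?thesis
  proof (rule moduleI)
    show "cring F" by fact
    show "abelian_group (direct_sum D M)"
    proof (rule abelian_groupI)
      fix x assume x: "x \<in> carrier (direct_sum D M)"
      then have "(\<lambda>d\<in>D. \<ominus>\<^bsub>M d\<^esub> x d) \<in> carrier (direct_sum D M)"
        "(\<lambda>d\<in>D. \<ominus>\<^bsub>M d\<^esub> x d) \<oplus>\<^bsub>direct_sum D M\<^esub> x = \<zero>\<^bsub>direct_sum D M\<^esub>"
        by (auto simp: defs add fun_eq_iff)
      then show "\<exists>y\<in>carrier (direct_sum D M). y \<oplus>\<^bsub>direct_sum D M\<^esub> x = \<zero>\<^bsub>direct_sum D M\<^esub>" by blast
    next
      fix x y assume "x \<in> carrier (direct_sum D M)" "y \<in> carrier (direct_sum D M)"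
      then show "x \<oplus>\<^bsub>direct_sum D M\<^esub> y = y \<oplus>\<^bsub>direct_sum D M\<^esub> x"
        by (auto simp: defs abelian_monoid.a_comm[OF M(2)] fun_eq_iff)
    qed (auto simp: defs add fun_eq_iff)
  qed (auto simp: defs smult fun_eq_iff)
qed

lemma direct_sum_component_linear:
  assumes "d \<in> D"
  shows "(\<lambda>x. x d) \<in> linear_maps F (direct_sum D M) (M d)"
  using assms by (intro linear_mapsI) (auto simp: direct_sum_def)

lemma module_free_module:
  fixes F :: "('f, 'r) ring_scheme" and B :: "'x set"
  assumes "cring F"
  shows "Module.module F (free_module F B)"
proof -
  interpret F: cring F by fact
  have fin: "finite {x. p x \<oplus>\<^bsub>F\<^esub> q x \<noteq> \<zero>\<^bsub>F\<^esub>}"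
    if "finite {x. p x \<noteq> \<zero>\<^bsub>F\<^esub>}" "finite {x. q x \<noteq> \<zero>\<^bsub>F\<^esub>}" for p q :: "'x \<Rightarrow> 'f"
    by (rule finite_subset[OF _ finite_UnI[OF that]]) auto
  have fin': "finite {x. c \<otimes>\<^bsub>F\<^esub> p x \<noteq> \<zero>\<^bsub>F\<^esub>}"
    if "finite {x. p x \<noteq> \<zero>\<^bsub>F\<^esub>}" "c \<in> carrier F" for p :: "'x \<Rightarrow> 'f" and c
    using that(2) by (intro finite_subset[OF _ that(1)]) auto
  show ?thesis
  proof (rule moduleI)
    show "cring F" by fact
    show "abelian_group (free_module F B)"
    proof (rule abelian_groupI)
      fix x assume x: "x \<in> carrier (free_module F B)"
      then have "(\<lambda>d. \<ominus>\<^bsub>F\<^esub> x d) \<in> carrier (free_module F B)"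
        by (auto simp: free_module_def elim!: finite_subset[rotated])
      moreover have "(\<lambda>d. \<ominus>\<^bsub>F\<^esub> x d) \<oplus>\<^bsub>free_module F B\<^esub> x = \<zero>\<^bsub>free_module F B\<^esub>"
        using x by (auto simp: free_module_def F.l_neg)
      ultimately show "\<exists>y\<in>carrier (free_module F B). y \<oplus>\<^bsub>free_module F B\<^esub> x = \<zero>\<^bsub>free_module F B\<^esub>"
        by blast
    qed (auto simp: free_module_def fin F.a_ac)
  qed (auto simp: free_module_def fin' F.l_distr F.r_distr F.m_assoc)
qed

lemma free_gen_closed:
  assumes "cring F" and "x \<in> B"
  shows "free_gen F x \<in> carrier (free_module F B)"
proof -
  interpret F: cring F by fact
  show ?thesis using assms(2) by (auto simp: free_module_def free_gen_def)
qed

text \<open>Induction on the finite support: clearing the coefficient at one point leaves a vector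
  with smaller support, and the difference is a multiple of a generator.\<close>

lemma free_module_induct:
  assumes "cring F" and "submodule N F (free_module F B)"
    and "\<And>x. x \<in> B \<Longrightarrow> free_gen F x \<in> N"
  shows "N = carrier (free_module F B)"
proof -
  interpret F: cring F by fact
  note N = submoduleD[OF assms(2) module_free_module[OF assms(1)]]
  have "p \<in> N" if "finite A" "p \<in> carrier (free_module F B)" "{x. p x \<noteq> \<zero>\<^bsub>F\<^esub>} = A" for p A
    using that
  proof (induction A arbitrary: p)
    case empty
    then have "p = \<zero>\<^bsub>free_module F B\<^esub>" by (auto simp: free_module_def)
    then show ?case by (simp add: N)
  next
    case (insert a A)
    let ?q = "p(a := \<zero>\<^bsub>F\<^esub>)"
    have q: "?q \<in> carrier (free_module F B)"
      using insert.prems by (auto simp: free_module_def elim!: finite_subset[rotated])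
    have "?q \<in> N"
      using insert.prems(2) insert.hyps by (intro insert.IH q) auto
    moreover have "a \<in> B" using insert.prems by (force simp: free_module_def)
    moreover have "p a \<in> carrier F" using insert.prems by (auto simp: free_module_def)
    moreover have "p = ?q \<oplus>\<^bsub>free_module F B\<^esub> (p a \<odot>\<^bsub>free_module F B\<^esub> free_gen F a)"
      using insert.prems by (auto simp: free_module_def free_gen_def fun_eq_iff)
    ultimately show ?case using N assms(3) by metis
  qed
  then have "carrier (free_module F B) \<subseteq> N" by (auto simp: free_module_def)
  with N(1) show ?thesis by auto
qed

section \<open>Complements and retractions\<close>

lemma complement_exists:
  assumes "field F" and "Module.module F V" and "submodule N F V"
    and "finite B" and "B \<subseteq> carrier V"
  shows "\<exists>C. submodule C F V \<and> C \<inter> N = {\<zero>\<^bsub>V\<^esub>} \<and> (\<forall>b\<in>B. \<exists>n\<in>N. \<exists>c\<in>C. b = n \<oplus>\<^bsub>V\<^esub> c)"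
  using assms(4,5)
proof (induction B)
  case empty
  interpret V: Module.module F V by fact
  have "submodule {\<zero>\<^bsub>V\<^esub>} F V" by (rule submoduleI') (use assms in auto)
  then show ?case using submodule_zero[OF assms(3,2)] by (intro exI[of _ "{\<zero>\<^bsub>V\<^esub>}"]) auto
next
  case (insert b B)
  interpret F: field F by fact
  interpret V: Module.module F V by fact
  from insert obtain C where C: "submodule C F V" "C \<inter> N = {\<zero>\<^bsub>V\<^esub>}"
    "\<forall>b\<in>B. \<exists>n\<in>N. \<exists>c\<in>C. b = n \<oplus>\<^bsub>V\<^esub> c" by auto
  have b: "b \<in> carrier V" using insert.prems by simp
  note N = submoduleD[OF assms(3,2)] and Cs = submoduleD[OF C(1) assms(2)]
  \<comment> \<open>Only the vectors of \<open>B\<close> have to lie in \<open>N + C\<close>, so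
    \<open>C\<close> can grow one vector at a time: it stays as it is if \<open>b\<close> already
    lies in \<open>N + C\<close>, and otherwise becomes \<open>D = C + F b\<close>. Enlarging
    \<open>C\<close> does not spoil the decompositions found earlier.\<close>
  show ?case
  proof (cases "\<exists>n\<in>N. \<exists>c\<in>C. b = n \<oplus>\<^bsub>V\<^esub> c")
    case True
    then show ?thesis using C by (intro exI[of _ C]) blast
  next
    case False
    define D where "D = {c \<oplus>\<^bsub>V\<^esub> a \<odot>\<^bsub>V\<^esub> b | c a. c \<in> C \<and> a \<in> carrier F}"
    have D: "c \<oplus>\<^bsub>V\<^esub> a \<odot>\<^bsub>V\<^esub> b \<in> D" if "c \<in> C" "a \<in> carrier F" for c a
      using that by (auto simp: D_def)
    have CV: "c \<in> carrier V" if "c \<in> C" for c using that Cs(1) by auto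
    have CD: "C \<subseteq> D"
      using D[of _ "\<zero>\<^bsub>F\<^esub>"] b CV by auto
    have "submodule D F V"
    proof (rule submoduleI')
      show "D \<subseteq> carrier V" using Cs(1) b by (auto simp: D_def)
      show "\<zero>\<^bsub>V\<^esub> \<in> D" using CD Cs(2) by auto
    next
      fix x y assume "x \<in> D" "y \<in> D"
      then obtain c a c' a' where ca: "c \<in> C" "a \<in> carrier F" "x = c \<oplus>\<^bsub>V\<^esub> a \<odot>\<^bsub>V\<^esub> b"
        "c' \<in> C" "a' \<in> carrier F" "y = c' \<oplus>\<^bsub>V\<^esub> a' \<odot>\<^bsub>V\<^esub> b" by (auto simp: D_def)
      have "x \<oplus>\<^bsub>V\<^esub> y = (c \<oplus>\<^bsub>V\<^esub> c') \<oplus>\<^bsub>V\<^esub> (a \<oplus>\<^bsub>F\<^esub> a') \<odot>\<^bsub>V\<^esub> b"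
        using ca b CV by (simp add: V.smult_l_distr V.a_ac)
      then show "x \<oplus>\<^bsub>V\<^esub> y \<in> D" using ca by (simp add: D Cs)
    next
      fix e x assume e: "e \<in> carrier F" and "x \<in> D"
      then obtain c a where ca: "c \<in> C" "a \<in> carrier F" "x = c \<oplus>\<^bsub>V\<^esub> a \<odot>\<^bsub>V\<^esub> b" by (auto simp: D_def)
      have "e \<odot>\<^bsub>V\<^esub> x = e \<odot>\<^bsub>V\<^esub> c \<oplus>\<^bsub>V\<^esub> (e \<otimes>\<^bsub>F\<^esub> a) \<odot>\<^bsub>V\<^esub> b"
        using ca b e CV by (simp add: V.smult_r_distr V.smult_assoc1)
      then show "e \<odot>\<^bsub>V\<^esub> x \<in> D" using ca e by (simp add: D Cs)
    qed fact
    moreover have "D \<inter> N = {\<zero>\<^bsub>V\<^esub>}"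
    proof -
      have "x = \<zero>\<^bsub>V\<^esub>" if "x \<in> D" "x \<in> N" for x
      proof -
        from that(1) obtain c a where ca: "c \<in> C" "a \<in> carrier F" "x = c \<oplus>\<^bsub>V\<^esub> a \<odot>\<^bsub>V\<^esub> b"
          by (auto simp: D_def)
        \<comment> \<open>If \<open>a\<close> were nonzero, dividing \<open>x = c + a b\<close> by
          \<open>a\<close> would put \<open>b\<close> into \<open>N + C\<close>, which the case
          assumption excludes.\<close>
        have "a = \<zero>\<^bsub>F\<^esub>"
        proof (rule ccontr)
          assume "a \<noteq> \<zero>\<^bsub>F\<^esub>"
          with ca(2) have a: "a \<in> Units F" by (simp add: F.field_Units)
          let ?i = "inv\<^bsub>F\<^esub> a"
          have xV: "x \<in> carrier V" using that N(1) by auto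
          have i: "?i \<in> carrier F" "?i \<otimes>\<^bsub>F\<^esub> a = \<one>\<^bsub>F\<^esub>" using a by auto
          have cV: "c \<in> carrier V" "\<ominus>\<^bsub>V\<^esub> c \<in> carrier V" using CV ca(1) by auto
          have "a \<odot>\<^bsub>V\<^esub> b = x \<oplus>\<^bsub>V\<^esub> \<ominus>\<^bsub>V\<^esub> c"
            unfolding ca(3) using V.add.inv_solve_right[of "a \<odot>\<^bsub>V\<^esub> b" "c \<oplus>\<^bsub>V\<^esub> a \<odot>\<^bsub>V\<^esub> b" c]
              ca(2) b cV by (simp add: V.a_comm)
          then have "b = ?i \<odot>\<^bsub>V\<^esub> (x \<oplus>\<^bsub>V\<^esub> \<ominus>\<^bsub>V\<^esub> c)"
            using V.smult_assoc1[OF i(1) ca(2) b] V.smult_one[OF b] unfolding i(2) by simp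
          then have "b = ?i \<odot>\<^bsub>V\<^esub> x \<oplus>\<^bsub>V\<^esub> ?i \<odot>\<^bsub>V\<^esub> (\<ominus>\<^bsub>V\<^esub> c)"
            unfolding V.smult_r_distr[OF i(1) xV cV(2)] .
          moreover have "?i \<odot>\<^bsub>V\<^esub> x \<in> N" "?i \<odot>\<^bsub>V\<^esub> (\<ominus>\<^bsub>V\<^esub> c) \<in> C"
            using N(6)[OF i(1) that(2)] Cs(6)[OF i(1) Cs(4)[OF ca(1)]] by auto
          ultimately show False using False by blast
        qed
        then have "x = c" using ca CV b by simp
        then show ?thesis using that(2) ca(1) C(2) by auto
      qed
      moreover have "\<zero>\<^bsub>V\<^esub> \<in> D" using CD Cs(2) by auto
      ultimately show ?thesis using N(2) by blast
    qed
    moreover have "\<exists>n\<in>N. \<exists>c\<in>D. b = n \<oplus>\<^bsub>V\<^esub> c"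
      using D[OF Cs(2), of "\<one>\<^bsub>F\<^esub>"] N(2) b by (intro bexI[of _ "\<zero>\<^bsub>V\<^esub>"] bexI[of _ b]) auto
    moreover have "\<forall>b\<in>B. \<exists>n\<in>N. \<exists>c\<in>D. b = n \<oplus>\<^bsub>V\<^esub> c" using C(3) CD by blast
    ultimately show ?thesis by (intro exI[of _ D]) blast
  qed
qed

text \<open>The projection onto \<open>N\<close> along a complement \<open>C\<close>. Every vector
  splits because \<open>N + C\<close> is a submodule containing a spanning set; the splitting is
  unique because the \<open>N\<close>-parts of two of them differ by a vector of
  \<open>N \<inter> C\<close>. Both \<open>k[I]\<close> and \<open>k\<^sub>+h\<close> will be split
  off in \<open>h[I]\<close> this way.\<close>

lemma retraction_exists:
  assumes "field F" and "Module.module F V" and "submodule N F V" and "finite_dimensional F V"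
  shows "\<exists>r \<in> linear_maps F V V. (\<forall>x\<in>carrier V. r x \<in> N) \<and> (\<forall>x\<in>N. r x = x)"
proof -
  interpret V: Module.module F V by fact
  from assms(4) obtain B where B: "finite B" "B \<subseteq> carrier V" "mod_span F V B = carrier V"
    by (auto simp: finite_dimensional_def)
  from complement_exists[OF assms(1-3) B(1,2)] obtain C where C: "submodule C F V"
    "C \<inter> N = {\<zero>\<^bsub>V\<^esub>}" "\<forall>b\<in>B. \<exists>n\<in>N. \<exists>c\<in>C. b = n \<oplus>\<^bsub>V\<^esub> c" by blast
  note N = submoduleD[OF assms(3,2)] and Cs = submoduleD[OF C(1) assms(2)]
  have NV: "n \<in> carrier V" if "n \<in> N" for n using that N(1) by auto
  have CV: "n \<in> carrier V" if "n \<in> C" for n using that Cs(1) by auto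
  define E where "E = {n \<oplus>\<^bsub>V\<^esub> c | n c. n \<in> N \<and> c \<in> C}"
  have addE: "(n \<oplus>\<^bsub>V\<^esub> c) \<oplus>\<^bsub>V\<^esub> (n' \<oplus>\<^bsub>V\<^esub> c') = (n \<oplus>\<^bsub>V\<^esub> n') \<oplus>\<^bsub>V\<^esub> (c \<oplus>\<^bsub>V\<^esub> c')"
    if "n \<in> N" "c \<in> C" "n' \<in> N" "c' \<in> C" for n c n' c'
    using NV that CV by (simp add: V.a_ac)
  have smE: "e \<odot>\<^bsub>V\<^esub> (n \<oplus>\<^bsub>V\<^esub> c) = e \<odot>\<^bsub>V\<^esub> n \<oplus>\<^bsub>V\<^esub> e \<odot>\<^bsub>V\<^esub> c"
    if "n \<in> N" "c \<in> C" "e \<in> carrier F" for e n c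
    using NV that CV by (simp add: V.smult_r_distr)
  have "submodule E F V"
  proof (rule submoduleI')
    show "E \<subseteq> carrier V" using NV CV by (auto simp: E_def)
    show "\<zero>\<^bsub>V\<^esub> \<in> E" unfolding E_def using N(2) Cs(2) V.l_zero[OF V.zero_closed, symmetric] by blast
    show "x \<oplus>\<^bsub>V\<^esub> y \<in> E" if "x \<in> E" "y \<in> E" for x y
      using that unfolding E_def by clarify (use addE N(3) Cs(3) in blast)
    show "e \<odot>\<^bsub>V\<^esub> x \<in> E" if "e \<in> carrier F" "x \<in> E" for e x
      using that unfolding E_def by clarify (use smE N(6) Cs(6) in blast)
  qed fact
  then have "mod_span F V B \<subseteq> E"
    by (rule mod_span_minimal) (use C(3) in \<open>unfold E_def, blast\<close>)
  then have VE: "\<exists>n c. n \<in> N \<and> c \<in> C \<and> x = n \<oplus>\<^bsub>V\<^esub> c" if "x \<in> carrier V" for x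
    using B(3) that unfolding E_def by blast
  have uniq: "n = n'" if "n \<oplus>\<^bsub>V\<^esub> c = n' \<oplus>\<^bsub>V\<^esub> c'" "n \<in> N" "c \<in> C" "n' \<in> N" "c' \<in> C" for n c n' c'
  proof -
    have car: "n \<in> carrier V" "c \<in> carrier V" "n' \<in> carrier V" "c' \<in> carrier V"
      using that NV CV by auto
    have "n = (n' \<oplus>\<^bsub>V\<^esub> c') \<oplus>\<^bsub>V\<^esub> \<ominus>\<^bsub>V\<^esub> c"
      using V.add.inv_solve_right[of n "n' \<oplus>\<^bsub>V\<^esub> c'" c] car that(1) by simp
    then have n: "n = n' \<oplus>\<^bsub>V\<^esub> (c' \<ominus>\<^bsub>V\<^esub> c)"
      using car by (simp only: a_minus_def V.a_assoc V.a_inv_closed)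
    then have "\<ominus>\<^bsub>V\<^esub> n' \<oplus>\<^bsub>V\<^esub> n = c' \<ominus>\<^bsub>V\<^esub> c"
      using car V.r_neg1[of n' "c' \<ominus>\<^bsub>V\<^esub> c"] by simp
    moreover have "\<ominus>\<^bsub>V\<^esub> n' \<oplus>\<^bsub>V\<^esub> n \<in> N" "c' \<ominus>\<^bsub>V\<^esub> c \<in> C" using that by (simp_all add: N Cs)
    ultimately have "c' \<ominus>\<^bsub>V\<^esub> c = \<zero>\<^bsub>V\<^esub>" using C(2) by auto
    then show ?thesis using n car by simp
  qed
  define r where "r x = (THE n. n \<in> N \<and> (\<exists>c\<in>C. x = n \<oplus>\<^bsub>V\<^esub> c))" for x
  have r: "r (n \<oplus>\<^bsub>V\<^esub> c) = n" if "n \<in> N" "c \<in> C" for n c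
    unfolding r_def by (rule the_equality) (use that uniq in blast)+
  have "r \<in> linear_maps F V V"
  proof (rule linear_mapsI)
    fix x assume x: "x \<in> carrier V"
    then obtain n c where nc: "n \<in> N" "c \<in> C" "x = n \<oplus>\<^bsub>V\<^esub> c" using VE by blast
    then show "r x \<in> carrier V" using r NV by simp
    { fix y assume "y \<in> carrier V"
      then obtain n' c' where nc': "n' \<in> N" "c' \<in> C" "y = n' \<oplus>\<^bsub>V\<^esub> c'" using VE by blast
      then show "r (x \<oplus>\<^bsub>V\<^esub> y) = r x \<oplus>\<^bsub>V\<^esub> r y" 
        unfolding nc(3) nc'(3) addE[OF nc(1,2) nc'(1,2)] using nc nc' by (simp add: r N(3) Cs(3)) }
    { fix e assume "e \<in> carrier F"
      then show "r (e \<odot>\<^bsub>V\<^esub> x) = e \<odot>\<^bsub>V\<^esub> r x" using nc by (simp only: smE r N(6) Cs(6)) }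
  qed
  moreover have "r x \<in> N" if "x \<in> carrier V" for x using VE[OF that] r by auto
  moreover have "r x = x" if "x \<in> N" for x using r[OF that Cs(2)] NV[OF that] by simp
  ultimately show ?thesis by blast
qed

subsection \<open>Tensor products\<close>

lemma free_module_lift:
  assumes "cring F" and "Module.module F U" and b: "b \<in> B \<rightarrow> carrier U"
  shows free_module_lift_linear:
      "(\<lambda>p. \<Oplus>\<^bsub>U\<^esub>z\<in>{z. p z \<noteq> \<zero>\<^bsub>F\<^esub>}. p z \<odot>\<^bsub>U\<^esub> b z) \<in> linear_maps F (free_module F B) U"
    and free_module_lift_gen: "x \<in> B \<Longrightarrow>
      (\<Oplus>\<^bsub>U\<^esub>z\<in>{z. free_gen F x z \<noteq> \<zero>\<^bsub>F\<^esub>}. free_gen F x z \<odot>\<^bsub>U\<^esub> b z) = b x"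
proof -
  interpret F: cring F by fact
  interpret U: Module.module F U by fact
  let ?M = "free_module F B"
  define L where "L p = (\<Oplus>\<^bsub>U\<^esub>z\<in>{z. p z \<noteq> \<zero>\<^bsub>F\<^esub>}. p z \<odot>\<^bsub>U\<^esub> b z)" for p
  have MD: "p z \<in> carrier F" "z \<notin> B \<Longrightarrow> p z = \<zero>\<^bsub>F\<^esub>" "finite {z. p z \<noteq> \<zero>\<^bsub>F\<^esub>}"
    if "p \<in> carrier ?M" for p z
    using that by (auto simp: free_module_def)
  \<comment> \<open>The sum in \<open>L p\<close> runs over the support of \<open>p\<close>, which
    changes under addition and scaling. It may be taken over any finite
    \<open>A \<subseteq> B\<close> containing the support, so that sums for several vectors get a
    common index set.\<close>
  have sub: "L p = (\<Oplus>\<^bsub>U\<^esub>z\<in>A. p z \<odot>\<^bsub>U\<^esub> b z)"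
    if p: "p \<in> carrier ?M" and A: "finite A" "A \<subseteq> B" "{z. p z \<noteq> \<zero>\<^bsub>F\<^esub>} \<subseteq> A" for p A
    unfolding L_def
  proof (rule U.add.finprod_mono_neutral_cong_left[OF A(1,3)])
    fix z assume "z \<in> A - {z. p z \<noteq> \<zero>\<^bsub>F\<^esub>}"
    then have "b z \<in> carrier U" "p z = \<zero>\<^bsub>F\<^esub>" using b A(2) by auto
    then show "p z \<odot>\<^bsub>U\<^esub> b z = \<zero>\<^bsub>U\<^esub>" by simp
  qed (use MD(1)[OF p] b A(2) in \<open>auto simp: Pi_iff subset_eq\<close>)
  have c: "(\<lambda>z. p z \<odot>\<^bsub>U\<^esub> b z) \<in> A \<rightarrow> carrier U" if "p \<in> carrier ?M" "A \<subseteq> B" for p A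
    using MD(1)[OF that(1)] that(2) b by auto
  have sB: "{z. p z \<noteq> \<zero>\<^bsub>F\<^esub>} \<subseteq> B" if "p \<in> carrier ?M" for p
    using MD(2)[OF that] by auto
  interpret M: Module.module F ?M by (rule module_free_module[OF assms(1)])
  have "L \<in> linear_maps F ?M U"
  proof (rule linear_mapsI)
    fix p assume p: "p \<in> carrier ?M"
    show "L p \<in> carrier U" unfolding L_def using c[OF p sB[OF p]] by simp
    { fix q assume q: "q \<in> carrier ?M"
      define A where "A = {z. p z \<noteq> \<zero>\<^bsub>F\<^esub>} \<union> {z. q z \<noteq> \<zero>\<^bsub>F\<^esub>}"
      have A: "finite A" "A \<subseteq> B" "{z. p z \<noteq> \<zero>\<^bsub>F\<^esub>} \<subseteq> A" "{z. q z \<noteq> \<zero>\<^bsub>F\<^esub>} \<subseteq> A"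
        using MD(3)[OF p] MD(3)[OF q] sB[OF p] sB[OF q] by (auto simp: A_def)
      have pq: "(p \<oplus>\<^bsub>?M\<^esub> q) z = p z \<oplus>\<^bsub>F\<^esub> q z" for z by (simp add: free_module_def)
      have "L (p \<oplus>\<^bsub>?M\<^esub> q) = (\<Oplus>\<^bsub>U\<^esub>z\<in>A. (p \<oplus>\<^bsub>?M\<^esub> q) z \<odot>\<^bsub>U\<^esub> b z)"
        by (rule sub) (use p q A in \<open>auto simp: pq A_def\<close>)
      also have "\<dots> = (\<Oplus>\<^bsub>U\<^esub>z\<in>A. p z \<odot>\<^bsub>U\<^esub> b z \<oplus>\<^bsub>U\<^esub> q z \<odot>\<^bsub>U\<^esub> b z)"
        using c[OF p A(2)] c[OF q A(2)] MD(1)[OF p] MD(1)[OF q] b A(2)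
        by (intro U.finsum_cong') (auto simp: pq U.smult_l_distr Pi_iff subset_eq)
      also have "\<dots> = L p \<oplus>\<^bsub>U\<^esub> L q"
        using c[OF p A(2)] c[OF q A(2)] sub[OF p A(1-3)] sub[OF q A(1,2,4)] by (simp add: U.finsum_addf)
      finally show "L (p \<oplus>\<^bsub>?M\<^esub> q) = L p \<oplus>\<^bsub>U\<^esub> L q" . }
    { fix e assume e: "e \<in> carrier F"
      define A where "A = {z. p z \<noteq> \<zero>\<^bsub>F\<^esub>}"
      have A: "finite A" "A \<subseteq> B" using MD(3)[OF p] sB[OF p] by (auto simp: A_def)
      have ep: "(e \<odot>\<^bsub>?M\<^esub> p) z = e \<otimes>\<^bsub>F\<^esub> p z" for z by (simp add: free_module_def)
      have "L (e \<odot>\<^bsub>?M\<^esub> p) = (\<Oplus>\<^bsub>U\<^esub>z\<in>A. (e \<odot>\<^bsub>?M\<^esub> p) z \<odot>\<^bsub>U\<^esub> b z)"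
        by (rule sub) (use p e A in \<open>auto simp: ep A_def\<close>)
      also have "\<dots> = (\<Oplus>\<^bsub>U\<^esub>z\<in>A. e \<odot>\<^bsub>U\<^esub> (p z \<odot>\<^bsub>U\<^esub> b z))"
        using c[OF p A(2)] MD(1)[OF p] e b A(2)
        by (intro U.finsum_cong') (auto simp: ep U.smult_assoc1 Pi_iff subset_eq)
      also have "\<dots> = e \<odot>\<^bsub>U\<^esub> L p"
        using U.finsum_smult_ldistr[OF A(1) e c[OF p A(2)]] by (simp add: L_def A_def)
      finally show "L (e \<odot>\<^bsub>?M\<^esub> p) = e \<odot>\<^bsub>U\<^esub> L p" . }
  qed
  then show "(\<lambda>p. \<Oplus>\<^bsub>U\<^esub>z\<in>{z. p z \<noteq> \<zero>\<^bsub>F\<^esub>}. p z \<odot>\<^bsub>U\<^esub> b z) \<in> linear_maps F (free_module F B) U"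
    by (simp add: L_def[abs_def])
  show "(\<Oplus>\<^bsub>U\<^esub>z\<in>{z. free_gen F x z \<noteq> \<zero>\<^bsub>F\<^esub>}. free_gen F x z \<odot>\<^bsub>U\<^esub> b z) = b x" if "x \<in> B"
  proof -
    have "b x \<in> carrier U" using that b by auto
    moreover have "L (free_gen F x) = (\<Oplus>\<^bsub>U\<^esub>z\<in>{x}. free_gen F x z \<odot>\<^bsub>U\<^esub> b z)"
      using that free_gen_closed[OF assms(1) that] by (intro sub) (auto simp: free_gen_def)
    ultimately show ?thesis by (simp add: L_def free_gen_def)
  qed
qed

lemma module_cring: "Module.module F V \<Longrightarrow> cring F"
  by (simp add: Module.module_def)

lemma submodule_tensor_rel:
  assumes "Module.module F V" and "Module.module F W"
  shows "submodule (tensor_rel F V W) F (free_module F (carrier V \<times> carrier W))"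
proof -
  interpret V: Module.module F V by fact
  interpret W: Module.module F W by fact
  let ?M = "free_module F (carrier V \<times> carrier W)"
  interpret M: Module.module F ?M by (rule module_free_module) (rule V.R.cring_axioms)
  have "free_gen F (v, w) \<in> carrier ?M" if "v \<in> carrier V" "w \<in> carrier W" for v w
    using that by (intro free_gen_closed V.R.cring_axioms) auto
  then show ?thesis
    unfolding tensor_rel_def Let_def
    by (intro submodule_mod_span M.module_axioms) auto
qed

lemma module_tensor_module:
  assumes "Module.module F V" and "Module.module F W"
  shows "Module.module F (tensor_module F V W)"
  unfolding tensor_module_def
  by (intro module_quot_module module_free_module submodule_tensor_rel assms module_cring[OF assms(1)])

lemma pure_tensor_bilinear:
  assumes "Module.module F V" and "Module.module F W"
  shows "pure_tensor F V W \<in> bilinear_maps F V W (tensor_module F V W)"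
proof -
  interpret V: Module.module F V by fact
  interpret W: Module.module F W by fact
  let ?M = "free_module F (carrier V \<times> carrier W)" and ?R = "tensor_rel F V W"
  note mM = module_free_module[OF V.R.cring_axioms, of "carrier V \<times> carrier W"]
  note R = submodule_tensor_rel[OF assms]
  interpret M: Module.module F ?M by (rule mM)
  note q = quot_module[OF mM R, folded tensor_module_def]
  have gen: "free_gen F (v, w) \<in> carrier ?M" if "v \<in> carrier V" "w \<in> carrier W" for v w
    using that by (intro free_gen_closed V.R.cring_axioms) auto
  note l = linear_mapsD[OF q(2)]
  have closed: "pure_tensor F V W v w \<in> carrier (tensor_module F V W)"
    if "v \<in> carrier V" "w \<in> carrier W" for v w
    unfolding pure_tensor_def by (rule l(1)[OF gen[OF that]])
  have rel: "x \<in> ?R" if "x \<in> ({free_gen F (v \<oplus>\<^bsub>V\<^esub> v', w) \<ominus>\<^bsub>?M\<^esub> (free_gen F (v, w) \<oplus>\<^bsub>?M\<^esub> free_gen F (v', w)) | v v' w.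
           v \<in> carrier V \<and> v' \<in> carrier V \<and> w \<in> carrier W} \<union>
        {free_gen F (v, w \<oplus>\<^bsub>W\<^esub> w') \<ominus>\<^bsub>?M\<^esub> (free_gen F (v, w) \<oplus>\<^bsub>?M\<^esub> free_gen F (v, w')) | v w w'.
           v \<in> carrier V \<and> w \<in> carrier W \<and> w' \<in> carrier W} \<union>
        {free_gen F (c \<odot>\<^bsub>V\<^esub> v, w) \<ominus>\<^bsub>?M\<^esub> (c \<odot>\<^bsub>?M\<^esub> free_gen F (v, w)) | c v w.
           c \<in> carrier F \<and> v \<in> carrier V \<and> w \<in> carrier W} \<union>
        {free_gen F (v, c \<odot>\<^bsub>W\<^esub> w) \<ominus>\<^bsub>?M\<^esub> (c \<odot>\<^bsub>?M\<^esub> free_gen F (v, w)) | c v w.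
           c \<in> carrier F \<and> v \<in> carrier V \<and> w \<in> carrier W})" for x
    unfolding tensor_rel_def Let_def by (rule subsetD[OF mod_span_incl that])
  show ?thesis
  proof (intro bilinear_mapsI linear_mapsI)
    fix v w w' assume c: "v \<in> carrier V" "w \<in> carrier W" "w' \<in> carrier W"
    have "free_gen F (v, w \<oplus>\<^bsub>W\<^esub> w') \<ominus>\<^bsub>?M\<^esub> (free_gen F (v, w) \<oplus>\<^bsub>?M\<^esub> free_gen F (v, w')) \<in> ?R"
      by (rule rel) (use c in blast)
    then show "pure_tensor F V W v (w \<oplus>\<^bsub>W\<^esub> w') =
        pure_tensor F V W v w \<oplus>\<^bsub>tensor_module F V W\<^esub> pure_tensor F V W v w'"
      unfolding pure_tensor_def using c gen by (simp add: l(2)[symmetric] q(4))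
  next
    fix v v' w assume c: "v \<in> carrier V" "w \<in> carrier W" "v' \<in> carrier V"
    have "free_gen F (v \<oplus>\<^bsub>V\<^esub> v', w) \<ominus>\<^bsub>?M\<^esub> (free_gen F (v, w) \<oplus>\<^bsub>?M\<^esub> free_gen F (v', w)) \<in> ?R"
      by (rule rel) (use c in blast)
    then show "pure_tensor F V W (v \<oplus>\<^bsub>V\<^esub> v') w =
        pure_tensor F V W v w \<oplus>\<^bsub>tensor_module F V W\<^esub> pure_tensor F V W v' w"
      unfolding pure_tensor_def using c gen by (simp add: l(2)[symmetric] q(4))
  next
    fix v w a assume c: "a \<in> carrier F" "v \<in> carrier V" "w \<in> carrier W"
    have "free_gen F (v, a \<odot>\<^bsub>W\<^esub> w) \<ominus>\<^bsub>?M\<^esub> (a \<odot>\<^bsub>?M\<^esub> free_gen F (v, w)) \<in> ?R"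
      by (rule rel) (use c in blast)
    then show "pure_tensor F V W v (a \<odot>\<^bsub>W\<^esub> w) = a \<odot>\<^bsub>tensor_module F V W\<^esub> pure_tensor F V W v w"
      unfolding pure_tensor_def using c gen by (simp add: l(3)[symmetric] q(4))
    have "free_gen F (a \<odot>\<^bsub>V\<^esub> v, w) \<ominus>\<^bsub>?M\<^esub> (a \<odot>\<^bsub>?M\<^esub> free_gen F (v, w)) \<in> ?R"
      by (rule rel) (use c in blast)
    then show "pure_tensor F V W (a \<odot>\<^bsub>V\<^esub> v) w = a \<odot>\<^bsub>tensor_module F V W\<^esub> pure_tensor F V W v w"
      unfolding pure_tensor_def using c gen by (simp add: l(3)[symmetric] q(4))
  qed (auto intro: closed)
qed

lemmas pure_tensor_closed = bilinear_maps_closed[OF pure_tensor_bilinear]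

text \<open>The preimage of \<open>N\<close> under the coset map is a submodule of the free module
  containing all generators, hence everything.\<close>

lemma tensor_induct:
  assumes "Module.module F V" and "Module.module F W"
    and "submodule N F (tensor_module F V W)"
    and "\<And>v w. \<lbrakk>v \<in> carrier V; w \<in> carrier W\<rbrakk> \<Longrightarrow> pure_tensor F V W v w \<in> N"
  shows "N = carrier (tensor_module F V W)"
proof -
  let ?M = "free_module F (carrier V \<times> carrier W)" and ?R = "tensor_rel F V W"
  note mM = module_free_module[OF module_cring[OF assms(1)], of "carrier V \<times> carrier W"]
  note q = quot_module[OF mM submodule_tensor_rel[OF assms(1,2)], folded tensor_module_def]
  have "{p \<in> carrier ?M. ?R +>\<^bsub>?M\<^esub> p \<in> N} = carrier ?M"
    by (rule free_module_induct[OF module_cring[OF assms(1)] submodule_vimage[OF q(2) mM q(1) assms(3)]])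
      (use assms(4) in \<open>auto simp: pure_tensor_def intro!: free_gen_closed[OF module_cring[OF assms(1)]]\<close>)
  then have "carrier (tensor_module F V W) \<subseteq> N" unfolding q(3)[symmetric] by blast
  then show ?thesis using submodule_subset[OF assms(3) q(1)] by auto
qed

text \<open>The uniqueness half of the universal property, in working form: later identities between
  maps out of a tensor product are checked on pure tensors, with linearity of both sides as the
  price.\<close>

lemma tensor_ext:
  assumes "Module.module F V" and "Module.module F W" and "Module.module F U"
    and "f \<in> linear_maps F (tensor_module F V W) U" and "g \<in> linear_maps F (tensor_module F V W) U"
    and "\<And>v w. \<lbrakk>v \<in> carrier V; w \<in> carrier W\<rbrakk> \<Longrightarrow> f (pure_tensor F V W v w) = g (pure_tensor F V W v w)"
    and "t \<in> carrier (tensor_module F V W)"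
  shows "f t = g t"
proof -
  note m = module_tensor_module[OF assms(1,2)]
  have "{x \<in> carrier (tensor_module F V W). f x = g x} = carrier (tensor_module F V W)"
    by (rule tensor_induct[OF assms(1,2) submodule_equalizer[OF assms(4,5) m assms(3)]])
      (use assms(6) pure_tensor_closed[OF assms(1,2)] in auto)
  then show ?thesis using assms(7) by blast
qed

text \<open>\<open>tensor_lift\<close> evaluates a sum on a representative picked by
  \<open>SOME\<close>, so it is linear only because the pick does not affect the value: bilinearity
  of \<open>b\<close> makes the sum vanish on the generating relations, hence on
  \<open>tensor_rel\<close>.\<close>

lemma tensor_lift:
  assumes "Module.module F V" and "Module.module F W" and "Module.module F U"
    and b: "b \<in> bilinear_maps F V W U"
  shows tensor_lift_linear: "tensor_lift F U b \<in> linear_maps F (tensor_module F V W) U"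
    and tensor_lift_pure: "\<lbrakk>v \<in> carrier V; w \<in> carrier W\<rbrakk> \<Longrightarrow>
      tensor_lift F U b (pure_tensor F V W v w) = b v w"
proof -
  interpret V: Module.module F V by fact
  interpret W: Module.module F W by fact
  interpret U: Module.module F U by fact
  let ?B = "carrier V \<times> carrier W"
  let ?M = "free_module F ?B" and ?R = "tensor_rel F V W"
  note cr = V.R.cring_axioms
  note mM = module_free_module[OF cr, of ?B]
  interpret M: Module.module F ?M by (rule mM)
  note R = submodule_tensor_rel[OF assms(1,2)]
  note q = quot_module[OF mM R, folded tensor_module_def]
  note bD = linear_mapsD[OF bilinear_maps_right[OF b]] linear_mapsD[OF bilinear_maps_left[OF b]]
  define L where "L p = (\<Oplus>\<^bsub>U\<^esub>z\<in>{z. p z \<noteq> \<zero>\<^bsub>F\<^esub>}. p z \<odot>\<^bsub>U\<^esub> b (fst z) (snd z))" for p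
  have bB: "(\<lambda>z. b (fst z) (snd z)) \<in> ?B \<rightarrow> carrier U" using bD by auto
  have L: "L \<in> linear_maps F ?M U"
    using free_module_lift_linear[OF cr assms(3) bB] by (simp add: L_def[abs_def])
  have Lg: "L (free_gen F (v, w)) = b v w" if "v \<in> carrier V" "w \<in> carrier W" for v w
    using free_module_lift_gen[OF cr assms(3) bB, of "(v, w)"] that by (simp add: L_def)
  have gen: "free_gen F (v, w) \<in> carrier ?M" if "v \<in> carrier V" "w \<in> carrier W" for v w
    using that by (intro free_gen_closed cr) auto
  note lD = linear_mapsD[OF L] linear_maps_minus[OF L mM assms(3)]
  have "?R \<subseteq> {p \<in> carrier ?M. L p = \<zero>\<^bsub>U\<^esub>}"
    unfolding tensor_rel_def Let_def
    by (rule mod_span_minimal[OF submodule_kernel[OF L mM assms(3)]])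
      (auto simp: gen lD Lg bD U.minus_eq U.r_neg)
  then have LR: "L r = \<zero>\<^bsub>U\<^esub>" if "r \<in> ?R" for r using that by auto
  \<comment> \<open>The coset contains \<open>p\<close>, so the choice succeeds; the chosen
    \<open>p'\<close> differs from \<open>p\<close> by an element of \<open>?R\<close>, on which
    \<open>L\<close> is zero.\<close>
  have lift: "tensor_lift F U b (?R +>\<^bsub>?M\<^esub> p) = L p" if p: "p \<in> carrier ?M" for p
  proof -
    define p' where "p' = (SOME p'. p' \<in> ?R +>\<^bsub>?M\<^esub> p)"
    have "p \<in> ?R +>\<^bsub>?M\<^esub> p"
      using q(5)[OF p p] p submodule_zero[OF R mM] by (simp add: a_minus_def M.r_neg)
    then have p': "p' \<in> ?R +>\<^bsub>?M\<^esub> p" unfolding p'_def some_in_eq by blast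
    then have c: "p' \<in> carrier ?M" using q(6)[OF p] by auto
    have "L (p' \<ominus>\<^bsub>?M\<^esub> p) = \<zero>\<^bsub>U\<^esub>" using p' q(5)[OF p c] LR by simp
    then have "L p' = L p" using lD(4)[OF c p] lD(1)[OF p] lD(1)[OF c] U.minus_eq_zero_iff by simp
    then show ?thesis by (simp add: tensor_lift_def L_def p'_def Let_def)
  qed
  have qc: "\<exists>p\<in>carrier ?M. t = ?R +>\<^bsub>?M\<^esub> p" if "t \<in> carrier (tensor_module F V W)" for t
    using that q(3) by auto
  note qD = linear_maps_add[OF q(2), symmetric] linear_maps_smult[OF q(2), symmetric]
  show "tensor_lift F U b \<in> linear_maps F (tensor_module F V W) U"
  proof (rule linear_mapsI)
    fix t assume "t \<in> carrier (tensor_module F V W)"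
    then obtain p where p: "p \<in> carrier ?M" "t = ?R +>\<^bsub>?M\<^esub> p" using qc by blast
    then show "tensor_lift F U b t \<in> carrier U" by (simp add: lift lD)
    { fix s assume "s \<in> carrier (tensor_module F V W)"
      then obtain p' where "p' \<in> carrier ?M" "s = ?R +>\<^bsub>?M\<^esub> p'" using qc by blast
      with p show "tensor_lift F U b (t \<oplus>\<^bsub>tensor_module F V W\<^esub> s) = tensor_lift F U b t \<oplus>\<^bsub>U\<^esub> tensor_lift F U b s"
        by (simp add: lift lD qD) }
    { fix c assume "c \<in> carrier F"
      with p show "tensor_lift F U b (c \<odot>\<^bsub>tensor_module F V W\<^esub> t) = c \<odot>\<^bsub>U\<^esub> tensor_lift F U b t"
        by (simp add: lift lD qD) }
  qed
  show "tensor_lift F U b (pure_tensor F V W v w) = b v w" if "v \<in> carrier V" "w \<in> carrier W"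
    using that by (simp add: pure_tensor_def lift gen Lg)
qed

lemma tensor_map:
  assumes "Module.module F V" and "Module.module F W" and "Module.module F V'" and "Module.module F W'"
    and "f \<in> linear_maps F V V'" and "g \<in> linear_maps F W W'"
  shows tensor_map_linear: "tensor_map F V' W' f g \<in> linear_maps F (tensor_module F V W) (tensor_module F V' W')"
    and tensor_map_pure: "\<lbrakk>v \<in> carrier V; w \<in> carrier W\<rbrakk> \<Longrightarrow>
      tensor_map F V' W' f g (pure_tensor F V W v w) = pure_tensor F V' W' (f v) (g w)"
  using tensor_lift[OF assms(1,2) module_tensor_module[OF assms(3,4)]
      linear_bilinear_compose[OF pure_tensor_bilinear[OF assms(3,4)] assms(5,6) linear_maps_id]]
  by (auto simp: tensor_map_def)

text \<open>The retraction \<open>r\<close> splits \<open>f\<close>, so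
  \<open>r \<otimes> id\<close> is a left inverse of \<open>f \<otimes> id\<close>. This is what
  makes \<open>k[A] \<otimes> q[B] \<rightarrow> h[A] \<otimes> q[B]\<close> injective.\<close>

lemma tensor_map_inj_left:
  assumes "Module.module F V" and "Module.module F W" and "Module.module F V'"
    and "f \<in> linear_maps F V V'" and "r \<in> linear_maps F V' V" and "\<And>v. v \<in> carrier V \<Longrightarrow> r (f v) = v"
    and "t \<in> carrier (tensor_module F V W)"
    and "tensor_map F V' W f (\<lambda>w. w) t = \<zero>\<^bsub>tensor_module F V' W\<^esub>"
  shows "t = \<zero>\<^bsub>tensor_module F V W\<^esub>"
proof -
  note m = module_tensor_module[OF assms(1,2)] module_tensor_module[OF assms(3,2)]
  note tf = tensor_map[OF assms(1,2,3,2,4) linear_maps_id]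
  note tr = tensor_map[OF assms(3,2,1,2,5) linear_maps_id]
  have "tensor_map F V W r (\<lambda>w. w) (tensor_map F V' W f (\<lambda>w. w) t) = t"
    by (rule tensor_ext[OF assms(1,2) m(1) linear_maps_compose[OF tf(1) tr(1)] linear_maps_id _ assms(7)])
      (use linear_maps_closed[OF assms(4)] in \<open>simp add: tf tr assms(6)\<close>)
  then show ?thesis using assms(8) linear_maps_zero[OF tr(1) m(2,1)] by simp
qed

text \<open>A lift nested in a lift. The outer one makes sense only if the inner value is bilinear
  in \<open>u1\<close> and \<open>u2\<close> for an arbitrary \<open>t\<close>, and this is checked
  on pure \<open>t\<close>; afterwards linearity in \<open>t\<close> for an arbitrary
  \<open>s\<close> is checked on pure \<open>s\<close>.\<close>

lemma tensor_interchange: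
  assumes "Module.module F U1" and "Module.module F U2" and "Module.module F V1" and "Module.module F V2"
    and "Module.module F W1" and "Module.module F W2"
    and "b1 \<in> bilinear_maps F U1 V1 W1" and "b2 \<in> bilinear_maps F U2 V2 W2"
  shows tensor_interchange_bilinear: "tensor_interchange F W1 W2 b1 b2 \<in>
      bilinear_maps F (tensor_module F U1 U2) (tensor_module F V1 V2) (tensor_module F W1 W2)"
    and tensor_interchange_pure: "\<lbrakk>u1 \<in> carrier U1; u2 \<in> carrier U2; v1 \<in> carrier V1; v2 \<in> carrier V2\<rbrakk> \<Longrightarrow>
      tensor_interchange F W1 W2 b1 b2 (pure_tensor F U1 U2 u1 u2) (pure_tensor F V1 V2 v1 v2) =
      pure_tensor F W1 W2 (b1 u1 v1) (b2 u2 v2)"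
proof -
  let ?U = "tensor_module F U1 U2" and ?V = "tensor_module F V1 V2" and ?W = "tensor_module F W1 W2"
  note mU = module_tensor_module[OF assms(1,2)] and mV = module_tensor_module[OF assms(3,4)]
    and mW = module_tensor_module[OF assms(5,6)]
  \<comment> \<open>The inner lift, with the two arguments of the outer one frozen.\<close>
  define c where "c u1 u2 = tensor_lift F ?W (\<lambda>v1 v2. pure_tensor F W1 W2 (b1 u1 v1) (b2 u2 v2))" for u1 u2
  have c: "c u1 u2 \<in> linear_maps F ?V ?W"
    "\<And>v1 v2. \<lbrakk>v1 \<in> carrier V1; v2 \<in> carrier V2\<rbrakk> \<Longrightarrow>
      c u1 u2 (pure_tensor F V1 V2 v1 v2) = pure_tensor F W1 W2 (b1 u1 v1) (b2 u2 v2)"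
    if "u1 \<in> carrier U1" "u2 \<in> carrier U2" for u1 u2
    using tensor_lift[OF assms(3,4) mW linear_bilinear_compose[OF pure_tensor_bilinear[OF assms(5,6)]
          bilinear_maps_right[OF assms(7) that(1)] bilinear_maps_right[OF assms(8) that(2)] linear_maps_id]]
    by (auto simp: c_def)
  note p = linear_mapsD[OF bilinear_maps_right[OF pure_tensor_bilinear[OF assms(5,6)]]]
    linear_mapsD[OF bilinear_maps_left[OF pure_tensor_bilinear[OF assms(5,6)]]]
  note B = linear_mapsD[OF bilinear_maps_right[OF assms(7)]] linear_mapsD[OF bilinear_maps_left[OF assms(7)]]
    linear_mapsD[OF bilinear_maps_right[OF assms(8)]] linear_mapsD[OF bilinear_maps_left[OF assms(8)]]
  interpret U1: Module.module F U1 by fact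
  interpret U2: Module.module F U2 by fact
  interpret W: Module.module F ?W by fact
  have cb: "(\<lambda>u1 u2. c u1 u2 t) \<in> bilinear_maps F U1 U2 ?W" if t: "t \<in> carrier ?V" for t
  proof (intro bilinear_mapsI linear_mapsI)
    fix x y z assume xyz: "x \<in> carrier U1" "y \<in> carrier U2" "z \<in> carrier U2"
    have lin: "(\<lambda>t. c x y t \<oplus>\<^bsub>?W\<^esub> c x z t) \<in> linear_maps F ?V ?W"
      using linear_mapsD[OF c(1)] xyz by (intro linear_mapsI) (auto simp: W.a_ac W.smult_r_distr)
    show "c x (y \<oplus>\<^bsub>U2\<^esub> z) t = c x y t \<oplus>\<^bsub>?W\<^esub> c x z t"
      by (rule tensor_ext[OF assms(3,4) mW c(1) lin _ t]) (use xyz in \<open>simp_all add: c(2) p B\<close>)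
  next
    fix x y z assume xyz: "x \<in> carrier U2" "y \<in> carrier U1" "z \<in> carrier U1"
    have lin: "(\<lambda>t. c y x t \<oplus>\<^bsub>?W\<^esub> c z x t) \<in> linear_maps F ?V ?W"
      using linear_mapsD[OF c(1)] xyz by (intro linear_mapsI) (auto simp: W.a_ac W.smult_r_distr)
    show "c (y \<oplus>\<^bsub>U1\<^esub> z) x t = c y x t \<oplus>\<^bsub>?W\<^esub> c z x t"
      by (rule tensor_ext[OF assms(3,4) mW c(1) lin _ t]) (use xyz in \<open>simp_all add: c(2) p B\<close>)
  next
    fix x y a assume xy: "a \<in> carrier F" "x \<in> carrier U1" "y \<in> carrier U2"
    note lin = linear_maps_scaled[OF mV mW c(1)[OF xy(2,3)] xy(1)]
    show "c x (a \<odot>\<^bsub>U2\<^esub> y) t = a \<odot>\<^bsub>?W\<^esub> c x y t"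
      by (rule tensor_ext[OF assms(3,4) mW c(1) lin _ t]) (use xy in \<open>simp_all add: c(2) p B\<close>)
    show "c (a \<odot>\<^bsub>U1\<^esub> x) y t = a \<odot>\<^bsub>?W\<^esub> c x y t"
      by (rule tensor_ext[OF assms(3,4) mW c(1) lin _ t]) (use xy in \<open>simp_all add: c(2) p B\<close>)
  qed (use linear_mapsD[OF c(1)] t in auto)
  have ti: "tensor_interchange F W1 W2 b1 b2 s t = tensor_lift F ?W (\<lambda>u1 u2. c u1 u2 t) s" for s t
    by (simp add: tensor_interchange_def c_def Let_def)
  note ll = tensor_lift[OF assms(1,2) mW cb, folded ti]
  show "tensor_interchange F W1 W2 b1 b2 (pure_tensor F U1 U2 u1 u2) (pure_tensor F V1 V2 v1 v2) =
      pure_tensor F W1 W2 (b1 u1 v1) (b2 u2 v2)"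
    if "u1 \<in> carrier U1" "u2 \<in> carrier U2" "v1 \<in> carrier V1" "v2 \<in> carrier V2" for u1 u2 v1 v2
    using that by (simp add: ll(2) pure_tensor_closed[OF assms(3,4)] c(2))
  have l: "(\<lambda>s. tensor_interchange F W1 W2 b1 b2 s t) \<in> linear_maps F ?U ?W" if "t \<in> carrier ?V" for t
    using ll(1)[OF that] by (simp add: ti)
  note cD = linear_mapsD[OF c(1)]
  interpret V: Module.module F ?V by fact
  show "tensor_interchange F W1 W2 b1 b2 \<in> bilinear_maps F ?U ?V ?W"
  proof (intro bilinear_mapsI l linear_mapsI)
    fix s t t' assume st: "s \<in> carrier ?U" "t \<in> carrier ?V" "t' \<in> carrier ?V"
    have lin: "(\<lambda>s. tensor_interchange F W1 W2 b1 b2 s t \<oplus>\<^bsub>?W\<^esub> tensor_interchange F W1 W2 b1 b2 s t')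
        \<in> linear_maps F ?U ?W"
      using linear_mapsD[OF l] st by (intro linear_mapsI) (auto simp: W.a_ac W.smult_r_distr)
    show "tensor_interchange F W1 W2 b1 b2 s (t \<oplus>\<^bsub>?V\<^esub> t') =
        tensor_interchange F W1 W2 b1 b2 s t \<oplus>\<^bsub>?W\<^esub> tensor_interchange F W1 W2 b1 b2 s t'"
      by (rule tensor_ext[OF assms(1,2) mW l lin _ st(1)]) (use st in \<open>simp_all add: ll(2) cD\<close>)
  next
    fix s t a assume st: "s \<in> carrier ?U" "a \<in> carrier F" "t \<in> carrier ?V"
    note lin = linear_maps_scaled[OF mU mW l[OF st(3)] st(2)]
    show "tensor_interchange F W1 W2 b1 b2 s (a \<odot>\<^bsub>?V\<^esub> t) = a \<odot>\<^bsub>?W\<^esub> tensor_interchange F W1 W2 b1 b2 s t"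
      by (rule tensor_ext[OF assms(1,2) mW l lin _ st(1)]) (use st in \<open>simp_all add: ll(2) cD\<close>)
  qed (use linear_mapsD[OF l] in auto)
qed

section \<open>Transport of left modules along isomorphisms\<close>

lemma linear_maps_inv_into:
  assumes "f \<in> linear_maps F V W" and "Module.module F V" and "bij_betw f (carrier V) (carrier W)"
  shows "inv_into (carrier V) f \<in> linear_maps F W V"
proof -
  interpret V: Module.module F V by fact
  let ?g = "inv_into (carrier V) f"
  have fg: "f (?g y) = y" "?g y \<in> carrier V" if "y \<in> carrier W" for y
    using that assms(3) by (auto simp: bij_betw_def f_inv_into_f intro: inv_into_into)
  have gf: "?g (f x) = x" if "x \<in> carrier V" for x
    using that assms(3) by (simp add: bij_betw_def)
  note f = linear_mapsD[OF assms(1)]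
  show ?thesis
  proof (rule linear_mapsI)
    fix x assume x: "x \<in> carrier W"
    then show "?g x \<in> carrier V" by (rule fg)
    { fix y assume y: "y \<in> carrier W"
      have "?g (f (?g x \<oplus>\<^bsub>V\<^esub> ?g y)) = ?g x \<oplus>\<^bsub>V\<^esub> ?g y" using x y by (intro gf) (simp add: fg)
      then show "?g (x \<oplus>\<^bsub>W\<^esub> y) = ?g x \<oplus>\<^bsub>V\<^esub> ?g y" using x y by (simp add: f fg) }
    { fix c assume c: "c \<in> carrier F"
      have "?g (f (c \<odot>\<^bsub>V\<^esub> ?g x)) = c \<odot>\<^bsub>V\<^esub> ?g x" using x c by (intro gf) (simp add: fg)
      then show "?g (c \<odot>\<^bsub>W\<^esub> x) = c \<odot>\<^bsub>V\<^esub> ?g x" using x c by (simp add: f fg) }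
  qed
qed

text \<open>Apart from closure and finite dimension, the axioms for \<open>n\<close> and
  \<open>b\<close> are equations, and injectivity of \<open>f\<close> reduces them to the axioms for
  \<open>m\<close> and \<open>a\<close>. Finite dimension is carried over by the inverse of
  \<open>f\<close>. The given map runs from \<open>n\<close> to \<open>m\<close> because
  \<open>\<phi>\<close> runs from \<open>k \<cdot> q\<close> to \<open>h\<close>; the isomorphism
  claimed is its inverse.\<close>

lemma left_modules_isomorphic_transport:
  fixes F :: "('f, 'r) ring_scheme"
    and k :: "('a::infinite, 'f, 'v, 'k) monoid_species_scheme"
    and m :: "('a, 'f, 'w, 'm) species_scheme" and n :: "('a, 'f, 'u, 'n) species_scheme"
  assumes "left_module F k m a"
    and mod_n: "\<And>I. finite I \<Longrightarrow> Module.module F (obj n I)"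
    and lin: "\<And>I. finite I \<Longrightarrow> f I \<in> linear_maps F (obj n I) (obj m I)"
    and bij: "\<And>I. finite I \<Longrightarrow> bij_betw (f I) (carrier (obj n I)) (carrier (obj m I))"
    and sp_closed: "\<And>I \<sigma> x. \<lbrakk>finite I; inj_on \<sigma> I; x \<in> carrier (obj n I)\<rbrakk> \<Longrightarrow>
      spmap n I \<sigma> x \<in> carrier (obj n (\<sigma> ` I))"
    and sp: "\<And>I \<sigma> x. \<lbrakk>finite I; inj_on \<sigma> I; x \<in> carrier (obj n I)\<rbrakk> \<Longrightarrow>
      f (\<sigma> ` I) (spmap n I \<sigma> x) = spmap m I \<sigma> (f I x)"
    and b_closed: "\<And>S T x y. \<lbrakk>finite S; finite T; S \<inter> T = {}; x \<in> carrier (obj k S); y \<in> carrier (obj n T)\<rbrakk> \<Longrightarrow>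
      b S T x y \<in> carrier (obj n (S \<union> T))"
    and ab: "\<And>S T x y. \<lbrakk>finite S; finite T; S \<inter> T = {}; x \<in> carrier (obj k S); y \<in> carrier (obj n T)\<rbrakk> \<Longrightarrow>
      f (S \<union> T) (b S T x y) = a S T x (f T y)"
  shows "left_modules_isomorphic F k m a n b"
proof -
  interpret L: left_module F k m a by fact
  note mm = L.M.obj_module and mk = L.K.obj_module
  note fD = linear_mapsD[OF lin]
  \<comment> \<open>Injectivity of \<open>f\<close>, in the form in which the equations below are
    moved from \<open>n\<close> to \<open>m\<close>.\<close>
  have eqI: "x = y" if "finite I" "x \<in> carrier (obj n I)" "y \<in> carrier (obj n I)" "f I x = f I y" for I x y
    using bij[OF that(1)] that by (auto simp: bij_betw_def dest: inj_onD)
  note nadd = abelian_monoid.a_closed[OF abelian_group.axioms(1)[OF module.axioms(2)[OF mod_n]]]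
  note nsm = Module.module.smult_closed[OF mod_n]
  note kadd = abelian_monoid.a_closed[OF abelian_group.axioms(1)[OF module.axioms(2)[OF mk]]]
  note ksm = Module.module.smult_closed[OF mk]
  let ?g = "\<lambda>I. inv_into (carrier (obj n I)) (f I)"
  have g: "?g I \<in> linear_maps F (obj m I) (obj n I)" "bij_betw (?g I) (carrier (obj m I)) (carrier (obj n I))"
    if "finite I" for I
    using linear_maps_inv_into[OF lin mod_n bij] bij_betw_inv_into[OF bij] that by auto
  have fg: "f I (?g I y) = y" "?g I y \<in> carrier (obj n I)" if "finite I" "y \<in> carrier (obj m I)" for I y
    using that bij[OF that(1)] by (auto simp: bij_betw_def f_inv_into_f intro: inv_into_into)
  note spD = linear_mapsD[OF L.M.spmap_linear]
  interpret n: species F n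
  proof (intro species.intro species_axioms.intro)
    show "field F" by (rule L.K.field_axioms)
  next
    fix I :: "'a set" assume I: "finite I"
    show "Module.module F (obj n I)" by (rule mod_n[OF I])
    show "finite_dimensional F (obj n I)"
      using finite_dimensional_image[OF g(1)[OF I] mm[OF I] mod_n[OF I] _ L.M.obj_finite_dimensional[OF I]]
        g(2)[OF I] by (simp add: bij_betw_def)
    fix \<sigma> :: "'a \<Rightarrow> 'a" assume s: "inj_on \<sigma> I"
    have fs: "finite (\<sigma> ` I)" using I by simp
    note c = nadd[OF I] nsm[OF I] nadd[OF fs] nsm[OF fs]
    show "spmap n I \<sigma> \<in> linear_maps F (obj n I) (obj n (\<sigma> ` I))"
    proof (rule linear_mapsI)
      fix x y assume "x \<in> carrier (obj n I)" "y \<in> carrier (obj n I)"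
      then show "spmap n I \<sigma> (x \<oplus>\<^bsub>obj n I\<^esub> y) = spmap n I \<sigma> x \<oplus>\<^bsub>obj n (\<sigma> ` I)\<^esub> spmap n I \<sigma> y"
        using I s by (intro eqI[OF fs]) (simp_all add: c sp_closed sp fD spD)
    next
      fix e x assume "e \<in> carrier F" "x \<in> carrier (obj n I)"
      then show "spmap n I \<sigma> (e \<odot>\<^bsub>obj n I\<^esub> x) = e \<odot>\<^bsub>obj n (\<sigma> ` I)\<^esub> spmap n I \<sigma> x"
        using I s by (intro eqI[OF fs]) (simp_all add: c sp_closed sp fD spD)
    qed (use I s sp_closed in auto)
  next
    fix I :: "'a set" and \<sigma> \<tau> :: "'a \<Rightarrow> 'a" and x
    assume h: "finite I" "inj_on \<sigma> I" "\<And>i. i \<in> I \<Longrightarrow> \<sigma> i = \<tau> i" "x \<in> carrier (obj n I)"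
    have im: "\<tau> ` I = \<sigma> ` I" "inj_on \<tau> I" using h by (auto simp: inj_on_def image_def)
    show "spmap n I \<sigma> x = spmap n I \<tau> x"
      using h(1,2,4) im sp_closed[of I \<tau> x] sp[of I \<tau> x] L.M.spmap_cong[OF h(1-3), of "f I x"]
      by (intro eqI[of "\<sigma> ` I"]) (simp_all add: sp_closed sp fD)
  next
    fix I :: "'a set" and x assume h: "finite I" "x \<in> carrier (obj n I)"
    then show "spmap n I id x = x"
      using sp_closed[of I id x] sp[of I id x] by (intro eqI[of I]) (simp_all add: L.M.spmap_id fD)
  next
    fix I :: "'a set" and \<sigma> \<tau> :: "'a \<Rightarrow> 'a" and x
    assume h: "finite I" "inj_on \<sigma> I" "inj_on \<tau> (\<sigma> ` I)" "x \<in> carrier (obj n I)"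
    then have i: "inj_on (\<tau> \<circ> \<sigma>) I" by (simp add: comp_inj_on)
    show "spmap n I (\<tau> \<circ> \<sigma>) x = spmap n (\<sigma> ` I) \<tau> (spmap n I \<sigma> x)"
      using h sp_closed[OF h(1) i h(4)] sp[OF h(1) i h(4)]
      unfolding image_comp[symmetric]
      by (intro eqI[of "\<tau> ` \<sigma> ` I"])
        (simp_all add: sp_closed sp fD L.M.spmap_comp del: image_image)
  qed
  have "left_module F k n b"
  proof (intro left_module.intro left_module_axioms.intro L.K.species_monoid_axioms n.species_axioms)
    fix S T :: "'a set" assume h: "finite S" "finite T" "S \<inter> T = {}"
    have fU: "finite (S \<union> T)" using h by simp
    note c = nadd[OF h(2)] nsm[OF h(2)] nadd[OF fU] nsm[OF fU] kadd[OF h(1)] ksm[OF h(1)]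
      b_closed[OF h] fD[OF fU] fD[OF h(2)] ab[OF h]
      linear_mapsD[OF bilinear_maps_right[OF L.act_bilinear[OF h]]]
      linear_mapsD[OF bilinear_maps_left[OF L.act_bilinear[OF h]]]
    show "b S T \<in> bilinear_maps F (obj k S) (obj n T) (obj n (S \<union> T))"
      by (intro bilinear_mapsI linear_mapsI; (rule eqI[OF fU])?) (simp_all add: c)
  next
    fix S T :: "'a set" and \<sigma> :: "'a \<Rightarrow> 'a" and x u
    assume h: "finite S" "finite T" "S \<inter> T = {}" "inj_on \<sigma> (S \<union> T)"
        "x \<in> carrier (obj k S)" "u \<in> carrier (obj n T)"
    have i: "inj_on \<sigma> S" "inj_on \<sigma> T" using h(4) by (auto simp: inj_on_def)
    have d: "\<sigma> ` S \<inter> \<sigma> ` T = {}" using h(3,4) by (auto simp: inj_on_def)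
    note k = linear_maps_closed[OF L.K.spmap_linear[OF h(1) i(1)] h(5)]
    have "b (\<sigma> ` S) (\<sigma> ` T) (spmap k S \<sigma> x) (spmap n T \<sigma> u) \<in> carrier (obj n (\<sigma> ` (S \<union> T)))"
      using b_closed[of "\<sigma> ` S" "\<sigma> ` T"] h d k i by (simp add: image_Un sp_closed)
    moreover have "f (\<sigma> ` (S \<union> T)) (b (\<sigma> ` S) (\<sigma> ` T) (spmap k S \<sigma> x) (spmap n T \<sigma> u)) =
        a (\<sigma> ` S) (\<sigma> ` T) (spmap k S \<sigma> x) (spmap m T \<sigma> (f T u))"
      using ab[of "\<sigma> ` S" "\<sigma> ` T"] h d k i by (simp add: image_Un sp_closed sp)
    ultimately show "spmap n (S \<union> T) \<sigma> (b S T x u) = b (\<sigma> ` S) (\<sigma> ` T) (spmap k S \<sigma> x) (spmap n T \<sigma> u)"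
      using h b_closed ab by (intro eqI[of "\<sigma> ` (S \<union> T)"]) (simp_all add: sp_closed sp fD L.act_natural)
  next
    fix R S T :: "'a set" and x y u
    assume h: "finite R" "finite S" "finite T" "R \<inter> S = {}" "R \<inter> T = {}" "S \<inter> T = {}"
        "x \<in> carrier (obj k R)" "y \<in> carrier (obj k S)" "u \<in> carrier (obj n T)"
    have d: "(R \<union> S) \<inter> T = {}" "R \<inter> (S \<union> T) = {}" using h by auto
    note mu = bilinear_maps_closed[OF L.K.mu_bilinear[OF h(1,2,4)] h(7,8)]
    have fin: "finite (R \<union> S)" "finite (S \<union> T)" "finite (R \<union> (S \<union> T))" using h by auto
    have fu: "f T u \<in> carrier (obj m T)" using fD h by auto
    note b2 = b_closed[OF h(2,3,6,8,9)]
    show "b (R \<union> S) T (mu k R S x y) u = b R (S \<union> T) x (b S T y u)"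
    proof (rule eqI[OF fin(3)])
      show "b (R \<union> S) T (mu k R S x y) u \<in> carrier (obj n (R \<union> (S \<union> T)))"
        using b_closed[OF fin(1) h(3) d(1) mu h(9)] by (simp add: Un_assoc)
      show "b R (S \<union> T) x (b S T y u) \<in> carrier (obj n (R \<union> (S \<union> T)))"
        by (rule b_closed[OF h(1) fin(2) d(2) h(7) b2])
      show "f (R \<union> (S \<union> T)) (b (R \<union> S) T (mu k R S x y) u) = f (R \<union> (S \<union> T)) (b R (S \<union> T) x (b S T y u))"
        using ab[OF fin(1) h(3) d(1) mu h(9)] ab[OF h(1) fin(2) d(2) h(7) b2] ab[OF h(2,3,6,8,9)]
          L.act_assoc[OF h(1-8) fu] by (simp add: Un_assoc)
    qed
  next
    fix I :: "'a set" and u assume h: "finite I" "u \<in> carrier (obj n I)"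
    show "b {} I (unit_elt k) u = u"
      using b_closed[of "{}" I "unit_elt k" u] ab[of "{}" I "unit_elt k" u] h L.K.unit_closed
      by (intro eqI[OF h(1)]) (simp_all add: L.act_unit fD)
  qed
  moreover have "species_iso F m n ?g"
    unfolding species_iso_def
  proof (intro conjI allI impI ballI)
    fix I :: "'a set" and \<sigma> :: "'a \<Rightarrow> 'a" and x assume h: "finite I \<and> inj_on \<sigma> I" "x \<in> carrier (obj m I)"
    then have fs: "finite (\<sigma> ` I)" by simp
    show "?g (\<sigma> ` I) (spmap m I \<sigma> x) = spmap n I \<sigma> (?g I x)"
      using h fs by (intro eqI[OF fs]) (simp_all add: fg spD sp sp_closed)
  qed (use g in auto)
  moreover have "?g (S \<union> T) (a S T x y) = b S T x (?g T y)"
    if h: "finite S" "finite T" "S \<inter> T = {}" and x: "x \<in> carrier (obj k S)" and y: "y \<in> carrier (obj m T)" for S T x y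
  proof -
    have fU: "finite (S \<union> T)" using h by simp
    note c = bilinear_maps_closed[OF L.act_bilinear[OF h] x y] fg[OF h(2) y]
    show ?thesis
      using fg[OF fU c(1)] b_closed[OF h x c(3)] ab[OF h x c(3)] c(2) by (intro eqI[OF fU]) simp_all
  qed
  ultimately show ?thesis
    unfolding left_modules_isomorphic_def using assms(1)
    by (intro conjI exI[of _ ?g] allI impI ballI) auto
qed

section \<open>Equivariant projections\<close>

text \<open>The last hypothesis makes \<open>c\<close> the reciprocal of \<open>card A\<close> in
  \<open>F\<close>, and the sum is \<open>card A\<close> times \<open>y\<close>. It is applied in a
  quotient module, where the averaged terms become equal.\<close>

lemma average_const:
  assumes "Module.module F V" and "finite A" and "y \<in> carrier V" and "c \<in> carrier F"
    and "c \<otimes>\<^bsub>F\<^esub> ([card A] \<cdot>\<^bsub>F\<^esub> \<one>\<^bsub>F\<^esub>) = \<one>\<^bsub>F\<^esub>"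
  shows "c \<odot>\<^bsub>V\<^esub> (\<Oplus>\<^bsub>V\<^esub>i\<in>A. y) = y"
proof -
  interpret V: Module.module F V by fact
  have "(\<Oplus>\<^bsub>V\<^esub>i\<in>A. y) = ([card A] \<cdot>\<^bsub>F\<^esub> \<one>\<^bsub>F\<^esub>) \<odot>\<^bsub>V\<^esub> y"
    using assms(2)
  proof (induction A)
    case (insert a A)
    then show ?case using assms(3)
      by (simp add: V.smult_l_distr V.R.add.nat_pow_Suc V.a_comm)
  qed (use assms(3) in simp)
  then show ?thesis
    using assms(3-5) V.smult_assoc1[of c "[card A] \<cdot>\<^bsub>F\<^esub> \<one>\<^bsub>F\<^esub>" y] by simp
qed

text \<open>Maschke's argument for the groupoid of finite sets and bijections. Averaging over the
  automorphisms of each \<open>I\<close> would still leave compatibility between different sets to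
  arrange. Averaging over all bijections from a model set of the same cardinality settles both at
  once, since composition with \<open>\<sigma>\<close> carries one index set of the average onto the
  other. The conditions on \<open>N\<close> say that \<open>e I\<close> is a projection with kernel
  \<open>N I\<close>.\<close>

lemma (in species) subspecies_projection_exists:
  assumes "char_zero_field F" and "subspecies F q N"
  shows "\<exists>e. \<forall>I. finite I \<longrightarrow>
    e I \<in> linear_maps F (obj q I) (obj q I) \<and>
    (\<forall>x\<in>carrier (obj q I). x \<ominus>\<^bsub>obj q I\<^esub> e I x \<in> N I) \<and>
    (\<forall>x\<in>N I. e I x = \<zero>\<^bsub>obj q I\<^esub>) \<and>
    (\<forall>\<sigma>. inj_on \<sigma> I \<longrightarrow> (\<forall>x\<in>carrier (obj q I). e (\<sigma> ` I) (spmap q I \<sigma> x) = spmap q I \<sigma> (e I x)))"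
proof -
  have N: "submodule (N I) F (obj q I)" if "finite I" for I
    using assms(2) that by (simp add: subspecies_def)
  have Ns: "spmap q I \<sigma> x \<in> N (\<sigma> ` I)" if "finite I" "inj_on \<sigma> I" "x \<in> N I" for I \<sigma> x
    using assms(2) that unfolding subspecies_def by blast
  note m = obj_module
  have NV: "x \<in> carrier (obj q I)" if "finite I" "x \<in> N I" for I x
    using submodule_subset[OF N m] that by auto
  have "\<exists>e. e \<in> linear_maps F (obj q I) (obj q I) \<and>
      (\<forall>x\<in>carrier (obj q I). x \<ominus>\<^bsub>obj q I\<^esub> e x \<in> N I) \<and> (\<forall>x\<in>N I. e x = \<zero>\<^bsub>obj q I\<^esub>)"
    if I: "finite I" for I
  proof -
    interpret V: Module.module F "obj q I" by (rule m[OF I])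
    obtain r where r: "r \<in> linear_maps F (obj q I) (obj q I)"
      "\<And>x. x \<in> carrier (obj q I) \<Longrightarrow> r x \<in> N I" "\<And>x. x \<in> N I \<Longrightarrow> r x = x"
      using retraction_exists[OF field_axioms m[OF I] N[OF I] obj_finite_dimensional[OF I]] by blast
    \<comment> \<open>\<open>r\<close> projects onto \<open>N I\<close>; the map wanted has to kill
      \<open>N I\<close>, so it is the complementary projection.\<close>
    let ?e = "\<lambda>x. x \<ominus>\<^bsub>obj q I\<^esub> r x"
    have "x \<ominus>\<^bsub>obj q I\<^esub> ?e x = r x" if "x \<in> carrier (obj q I)" for x
      using that linear_maps_closed[OF r(1) that] by (simp add: a_minus_def V.minus_add V.r_neg2)
    moreover have "?e x = \<zero>\<^bsub>obj q I\<^esub>" if "x \<in> N I" for x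
      using r(3)[OF that] NV[OF I that] V.minus_eq_zero_iff by simp
    ultimately show ?thesis
      using linear_maps_diff[OF m[OF I] m[OF I] linear_maps_id r(1)] r(2) by (intro exI[of _ ?e]) simp
  qed
  then have "\<forall>I. \<exists>e. finite I \<longrightarrow> e \<in> linear_maps F (obj q I) (obj q I) \<and>
      (\<forall>x\<in>carrier (obj q I). x \<ominus>\<^bsub>obj q I\<^esub> e x \<in> N I) \<and> (\<forall>x\<in>N I. e x = \<zero>\<^bsub>obj q I\<^esub>)"
    by blast
  from choice[OF this] obtain e0 where "\<forall>I. finite I \<longrightarrow> e0 I \<in> linear_maps F (obj q I) (obj q I) \<and>
      (\<forall>x\<in>carrier (obj q I). x \<ominus>\<^bsub>obj q I\<^esub> e0 I x \<in> N I) \<and> (\<forall>x\<in>N I. e0 I x = \<zero>\<^bsub>obj q I\<^esub>)" ..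
  then have e0: "e0 I \<in> linear_maps F (obj q I) (obj q I)"
      "\<And>x. x \<in> carrier (obj q I) \<Longrightarrow> x \<ominus>\<^bsub>obj q I\<^esub> e0 I x \<in> N I" "\<And>x. x \<in> N I \<Longrightarrow> e0 I x = \<zero>\<^bsub>obj q I\<^esub>"
    if "finite I" for I using that by blast+
  \<comment> \<open>The model set depends on \<open>card I\<close> only, so that \<open>I\<close>
    and its bijective images share the same one; \<open>I\<close> itself shows that the choice is
    possible.\<close>
  define J where "J I = (SOME J::'a set. finite J \<and> card J = card I)" for I :: "'a set"
  have J: "finite (J I)" "card (J I) = card I" if "finite I" for I
    using someI[of "\<lambda>J. finite J \<and> card J = card I" I] that by (simp_all add: J_def)
  \<comment> \<open>Extensional functions make \<open>T I\<close> a finite set with exactly one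
    element for each bijection.\<close>
  define T where "T I = {\<tau> \<in> J I \<rightarrow>\<^sub>E I. bij_betw \<tau> (J I) I}" for I
  have T_fin: "finite (T I)" if "finite I" for I
    unfolding T_def by (rule finite_subset[OF _ finite_PiE[OF J(1)[OF that]]]) (use that in auto)
  have T_restrict: "restrict g (J I) \<in> T I" if "bij_betw g (J I) I" for g I
    using that by (auto simp: T_def bij_betw_def inj_on_def)
  have T_ne: "T I \<noteq> {}" if I: "finite I" for I
  proof -
    obtain g where g: "bij_betw g (J I) I" using J[OF I] I finite_same_card_bij by blast
    from T_restrict[OF this] show ?thesis by auto
  qed
  have TD: "inj_on \<tau> (J I)" "\<tau> ` J I = I" "inj_on (inv_into (J I) \<tau>) I" "inv_into (J I) \<tau> ` I = J I"
    if "\<tau> \<in> T I" for \<tau> I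
  proof -
    have b: "bij_betw \<tau> (J I) I" using that by (simp add: T_def)
    then show "inj_on \<tau> (J I)" "\<tau> ` J I = I" by (simp_all add: bij_betw_def)
    from bij_betw_inv_into[OF b] show "inj_on (inv_into (J I) \<tau>) I" "inv_into (J I) \<tau> ` I = J I"
      by (simp_all add: bij_betw_def)
  qed
  \<comment> \<open>Only the values of \<open>e0\<close> on model sets are used: each
    \<open>\<tau>\<close> brings \<open>x\<close> to the model set, where it is projected, and takes
    the result back.\<close>
  define t where "t I \<tau> x = spmap q (J I) \<tau> (e0 (J I) (spmap q I (inv_into (J I) \<tau>) x))" for I \<tau> x
  have sp1: "spmap q (J I) \<tau> \<in> linear_maps F (obj q (J I)) (obj q I)"
    and sp2: "spmap q I (inv_into (J I) \<tau>) \<in> linear_maps F (obj q I) (obj q (J I))"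
    if "finite I" "\<tau> \<in> T I" for I \<tau>
    using spmap_linear[OF J(1)[OF that(1)] TD(1)[OF that(2)]] spmap_linear[OF that(1) TD(3)[OF that(2)]]
      TD(2,4)[OF that(2)] by simp_all
  have sp12: "spmap q (J I) \<tau> (spmap q I (inv_into (J I) \<tau>) x) = x"
    if "finite I" "\<tau> \<in> T I" "x \<in> carrier (obj q I)" for I \<tau> x
  proof -
    have "spmap q I (\<tau> \<circ> inv_into (J I) \<tau>) x = spmap q (J I) \<tau> (spmap q I (inv_into (J I) \<tau>) x)"
      using spmap_comp[OF that(1) TD(3)[OF that(2)] _ that(3), of \<tau>] TD(1,4)[OF that(2)] by simp
    moreover have "spmap q I (\<tau> \<circ> inv_into (J I) \<tau>) x = spmap q I id x"
      using that(1,3) TD[OF that(2)]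
      by (intro spmap_cong) (auto intro!: comp_inj_on f_inv_into_f)
    ultimately show ?thesis using spmap_id that by simp
  qed
  have t_lin: "t I \<tau> \<in> linear_maps F (obj q I) (obj q I)" if "finite I" "\<tau> \<in> T I" for I \<tau>
    using linear_maps_compose[OF linear_maps_compose[OF sp2[OF that] e0(1)[OF J(1)[OF that(1)]]] sp1[OF that]]
    by (simp add: t_def[abs_def])
  have t_N: "t I \<tau> x = \<zero>\<^bsub>obj q I\<^esub>" if "finite I" "\<tau> \<in> T I" "x \<in> N I" for I \<tau> x
  proof -
    have "spmap q I (inv_into (J I) \<tau>) x \<in> N (J I)"
      using Ns[OF that(1) TD(3)[OF that(2)] that(3)] TD(4)[OF that(2)] by simp
    then show ?thesis
      using e0(3)[OF J(1)[OF that(1)]] linear_maps_zero[OF sp1[OF that(1,2)] m[OF J(1)[OF that(1)]] m[OF that(1)]]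
      by (simp add: t_def)
  qed
  \<comment> \<open>The defect of \<open>e0\<close> on the model set lies in \<open>N\<close> there,
    and is carried back into \<open>N I\<close> because \<open>N\<close> is stable under
    bijections.\<close>
  have t_diff: "x \<ominus>\<^bsub>obj q I\<^esub> t I \<tau> x \<in> N I" if "finite I" "\<tau> \<in> T I" "x \<in> carrier (obj q I)" for I \<tau> x
  proof -
    let ?y = "spmap q I (inv_into (J I) \<tau>) x"
    note fJ = J(1)[OF that(1)]
    have y: "?y \<in> carrier (obj q (J I))" using sp2[OF that(1,2)] that(3) by (rule linear_maps_closed)
    have "spmap q (J I) \<tau> (?y \<ominus>\<^bsub>obj q (J I)\<^esub> e0 (J I) ?y) \<in> N I"
      using Ns[OF fJ TD(1)[OF that(2)] e0(2)[OF fJ y]] TD(2)[OF that(2)] by simp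
    then show ?thesis
      using linear_maps_minus[OF sp1[OF that(1,2)] m[OF fJ] m[OF that(1)] y linear_maps_closed[OF e0(1)[OF fJ] y]]
        sp12[OF that] by (simp add: t_def)
  qed
  define c where "c I = inv ([card (T I)] \<cdot> \<one>)" for I
  \<comment> \<open>The point where characteristic 0 is used: the number of bijections is positive,
    hence invertible in the field.\<close>
  have c: "c I \<in> carrier F" "c I \<otimes> ([card (T I)] \<cdot> \<one>) = \<one>" if "finite I" for I
  proof -
    have "card (T I) > 0" using T_fin T_ne that by (simp add: card_gt_0_iff)
    then have "[card (T I)] \<cdot> \<one> \<noteq> \<zero>" using char_zero_field.char_zero[OF assms(1)] by simp
    then have "[card (T I)] \<cdot> \<one> \<in> Units F" by (simp add: field_Units)
    then show "c I \<in> carrier F" "c I \<otimes> ([card (T I)] \<cdot> \<one>) = \<one>" by (simp_all add: c_def)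
  qed
  define e where "e I x = c I \<odot>\<^bsub>obj q I\<^esub> (\<Oplus>\<^bsub>obj q I\<^esub>\<tau>\<in>T I. t I \<tau> x)" for I x
  have e1: "e I \<in> linear_maps F (obj q I) (obj q I)" if "finite I" for I
    using linear_maps_scaled[OF m m linear_maps_sum[OF m m t_lin] c(1)] that
    by (simp add: e_def[abs_def])
  \<comment> \<open>Modulo \<open>N I\<close> each conjugate \<open>t I \<tau> x\<close> equals
    \<open>x\<close>, so the average does too; the computation takes place in the quotient
    module.\<close>
  have e2: "x \<ominus>\<^bsub>obj q I\<^esub> e I x \<in> N I" if I: "finite I" and x: "x \<in> carrier (obj q I)" for I x
  proof -
    interpret V: Module.module F "obj q I" by (rule m[OF I])
    note tc = linear_maps_closed[OF t_lin[OF I] x]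
    note Q = quot_module[OF m[OF I] N[OF I]]
    let ?p = "\<lambda>x. N I +>\<^bsub>obj q I\<^esub> x" and ?Q = "quot_module (obj q I) (N I)"
    interpret Q: Module.module F ?Q by (rule Q)
    have px: "?p x \<in> carrier ?Q" using Q(2) x by (rule linear_maps_closed)
    have "?p (e I x) = c I \<odot>\<^bsub>?Q\<^esub> (\<Oplus>\<^bsub>?Q\<^esub>\<tau>\<in>T I. ?p (t I \<tau> x))"
      unfolding e_def using tc c(1)[OF I]
      by (simp add: linear_maps_smult[OF Q(2)] linear_maps_finsum[OF Q(2) m[OF I] Q(1)] V.finsum_closed)
    also have "(\<Oplus>\<^bsub>?Q\<^esub>\<tau>\<in>T I. ?p (t I \<tau> x)) = (\<Oplus>\<^bsub>?Q\<^esub>\<tau>\<in>T I. ?p x)"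
    proof (rule Q.finsum_cong')
      show "?p (t I \<tau> x) = ?p x" if "\<tau> \<in> T I" for \<tau>
        using Q(4)[OF x tc[OF that]] t_diff[OF I that x] by simp
    qed (use px in auto)
    also have "c I \<odot>\<^bsub>?Q\<^esub> \<dots> = ?p x"
      by (rule average_const[OF Q(1) T_fin[OF I] px c[OF I]])
    finally have "?p x = ?p (e I x)" ..
    moreover have "e I x \<in> carrier (obj q I)" unfolding e_def using c(1)[OF I] tc by (simp add: V.finsum_closed)
    ultimately show ?thesis using Q(4)[OF x] by simp
  qed
  have e3: "e I x = \<zero>\<^bsub>obj q I\<^esub>" if I: "finite I" and x: "x \<in> N I" for I x
  proof -
    interpret V: Module.module F "obj q I" by (rule m[OF I])
    have "(\<Oplus>\<^bsub>obj q I\<^esub>\<tau>\<in>T I. t I \<tau> x) = \<zero>\<^bsub>obj q I\<^esub>"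
      by (rule V.add.finprod_one_eqI) (use t_N[OF I _ x] in simp)
    then show ?thesis using c(1)[OF I] by (simp add: e_def)
  qed
  have e4: "e (\<sigma> ` I) (spmap q I \<sigma> x) = spmap q I \<sigma> (e I x)"
    if I: "finite I" and s: "inj_on \<sigma> I" and x: "x \<in> carrier (obj q I)" for I \<sigma> x
  proof -
    let ?I = "\<sigma> ` I"
    have fI: "finite ?I" using I by simp
    have JI: "J ?I = J I" using card_image[OF s] by (simp add: J_def)
    \<comment> \<open>Composition with \<open>\<sigma>\<close> identifies the bijections onto
      \<open>I\<close> with those onto its image, since both start from the same model set; the
      restriction keeps them extensional.\<close>
    let ?r = "\<lambda>\<tau>. restrict (\<sigma> \<circ> \<tau>) (J I)"
    interpret V: Module.module F "obj q I" by (rule m[OF I])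
    interpret W: Module.module F "obj q ?I" by (rule m[OF fI])
    have rT: "?r \<tau> \<in> T ?I" if "\<tau> \<in> T I" for \<tau>
    proof -
      have "bij_betw \<tau> (J I) I" using that by (simp add: T_def)
      then have "bij_betw (\<sigma> \<circ> \<tau>) (J ?I) ?I"
        unfolding JI by (rule bij_betw_trans) (use s in \<open>simp add: bij_betw_def\<close>)
      then show ?thesis using T_restrict[of "\<sigma> \<circ> \<tau>" ?I] by (simp only: JI)
    qed
    have inj: "inj_on ?r (T I)"
    proof (rule inj_onI)
      fix \<tau> \<tau>' assume a: "\<tau> \<in> T I" "\<tau>' \<in> T I" "?r \<tau> = ?r \<tau>'"
      show "\<tau> = \<tau>'"
      proof (rule extensionalityI[of _ "J I"])
        show "\<tau> \<in> extensional (J I)" "\<tau>' \<in> extensional (J I)" using a(1,2) by (auto simp: T_def PiE_iff)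
        fix j assume j: "j \<in> J I"
        then have "\<sigma> (\<tau> j) = \<sigma> (\<tau>' j)" using fun_cong[OF a(3), of j] by simp
        moreover have "\<tau> j \<in> I" "\<tau>' j \<in> I" using a(1,2) j by (auto simp: T_def)
        ultimately show "\<tau> j = \<tau>' j" using s by (auto dest: inj_onD)
      qed
    qed
    have surj: "?r ` T I = T ?I"
    proof
      show "?r ` T I \<subseteq> T ?I" using rT by auto
      show "T ?I \<subseteq> ?r ` T I"
      proof
        fix \<rho> assume r: "\<rho> \<in> T ?I"
        let ?\<tau> = "restrict (inv_into I \<sigma> \<circ> \<rho>) (J I)"
        have \<rho>: "\<rho> j \<in> ?I" if "j \<in> J I" for j using r that JI by (auto simp: T_def)
        have bi: "bij_betw (inv_into I \<sigma>) ?I I" using s by (simp add: bij_betw_def inj_on_inv_into)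
        have b\<rho>: "bij_betw \<rho> (J I) ?I" using r JI by (simp add: T_def)
        have "bij_betw (inv_into I \<sigma> \<circ> \<rho>) (J I) I" by (rule bij_betw_trans[OF b\<rho> bi])
        then have "?\<tau> \<in> T I" by (rule T_restrict)
        moreover have "?r ?\<tau> = \<rho>"
        proof (rule extensionalityI[of _ "J I"])
          show "\<rho> \<in> extensional (J I)" using r JI by (auto simp: T_def PiE_iff)
          show "?r ?\<tau> j = \<rho> j" if "j \<in> J I" for j using \<rho>[OF that] that by (simp add: f_inv_into_f)
        qed simp
        ultimately show "\<rho> \<in> ?r ` T I" by (metis image_eqI)
      qed
    qed
    have cI: "c ?I = c I" using card_image[OF inj] surj by (simp add: c_def)
    \<comment> \<open>The averages agree term by term, as the inverse of
      \<open>\<sigma> \<circ> \<tau>\<close> undoes \<open>\<sigma>\<close> and then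
      \<open>\<tau>\<close>.\<close>
    have tt: "t ?I (?r \<tau>) (spmap q I \<sigma> x) = spmap q I \<sigma> (t I \<tau> x)" if \<tau>: "\<tau> \<in> T I" for \<tau>
    proof -
      let ?j = "inv_into (J I) (?r \<tau>)"
      have \<tau>I: "\<tau> j \<in> I" if "j \<in> J I" for j using \<tau> that by (auto simp: T_def)
      have j: "inj_on ?j ?I" using TD(3)[OF rT[OF \<tau>]] JI by simp
      have jJ: "?j (\<sigma> i) = inv_into (J I) \<tau> i" if i: "i \<in> I" for i
      proof -
        obtain a where a: "a \<in> J I" "i = \<tau> a" using TD(2)[OF \<tau>] i by auto
        then have "\<sigma> i = ?r \<tau> a" by simp
        moreover have "inj_on (?r \<tau>) (J I)" using TD(1)[OF rT[OF \<tau>]] by (simp only: JI)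
        ultimately have "?j (\<sigma> i) = a" using inv_into_f_f a(1) by metis
        then show ?thesis using a inv_into_f_f[OF TD(1)[OF \<tau>] a(1)] by simp
      qed
      have 1: "spmap q ?I ?j (spmap q I \<sigma> x) = spmap q I (inv_into (J I) \<tau>) x"
        unfolding spmap_comp[OF I s j x, symmetric]
        by (rule spmap_cong[OF I comp_inj_on[OF s j] _ x]) (simp only: comp_apply jJ)
      let ?y = "e0 (J I) (spmap q I (inv_into (J I) \<tau>) x)"
      have y: "?y \<in> carrier (obj q (J I))"
        using linear_maps_closed[OF e0(1)[OF J(1)[OF I]] linear_maps_closed[OF sp2[OF I \<tau>] x]] .
      have "spmap q (J I) (?r \<tau>) ?y = spmap q (J I) (\<sigma> \<circ> \<tau>) ?y"
        by (rule spmap_cong[OF J(1)[OF I] _ _ y]) (use TD(1)[OF rT[OF \<tau>]] in \<open>simp_all add: JI del: o_apply\<close>)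
      also have "\<dots> = spmap q I \<sigma> (spmap q (J I) \<tau> ?y)"
        using spmap_comp[OF J(1)[OF I] TD(1)[OF \<tau>] _ y, of \<sigma>] TD(2)[OF \<tau>] s by simp
      finally show ?thesis by (simp add: t_def JI 1)
    qed
    note sD = linear_mapsD[OF spmap_linear[OF I s]]
    note tc = linear_maps_closed[OF t_lin[OF I] x]
    have "(\<Oplus>\<^bsub>obj q ?I\<^esub>\<rho>\<in>T ?I. t ?I \<rho> (spmap q I \<sigma> x)) =
        (\<Oplus>\<^bsub>obj q ?I\<^esub>\<tau>\<in>T I. t ?I (?r \<tau>) (spmap q I \<sigma> x))"
      unfolding surj[symmetric]
      by (rule W.finsum_reindex[OF _ inj]) (use tt sD(1) tc in auto)
    also have "\<dots> = (\<Oplus>\<^bsub>obj q ?I\<^esub>\<tau>\<in>T I. spmap q I \<sigma> (t I \<tau> x))"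
      by (rule W.finsum_cong') (use tt sD(1) tc in auto)
    also have "\<dots> = spmap q I \<sigma> (\<Oplus>\<^bsub>obj q I\<^esub>\<tau>\<in>T I. t I \<tau> x)"
      by (rule linear_maps_finsum[OF spmap_linear[OF I s] m[OF I] m[OF fI], symmetric]) (use tc in auto)
    finally show ?thesis
      unfolding e_def cI using c(1)[OF I] tc by (simp add: sD V.finsum_closed)
  qed
  show ?thesis
    by (intro exI[of _ e] allI impI conjI ballI) (rule e1 e2 e3 e4; assumption)+
qed

section \<open>Hopf submonoids\<close>

locale hopf_submonoid_pair = hopf_monoid F h
  for F :: "('f, 'r) ring_scheme" (structure) and h :: "('a::infinite, 'f, 'v) hopf_species" +
  fixes k :: "'a set \<Rightarrow> 'v set"
  assumes characteristic_zero: "char_zero_field F"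
    and connected: "connected_species F h"
    and hopf_submonoid: "hopf_submonoid F h k"
begin

abbreviation K :: "'a set \<Rightarrow> ('f, 'v) module"
  where "K I \<equiv> (obj h I)\<lparr>carrier := k I\<rparr>"

abbreviation N :: "'a set \<Rightarrow> 'v set"
  where "N \<equiv> plus_ideal F h k"

lemma sub_monoid_simps [simp]:
  "obj (sub_monoid h k) I = K I" "spmap (sub_monoid h k) = spmap h"
  "mu (sub_monoid h k) = mu h" "unit_elt (sub_monoid h k) = unit_elt h"
  by (simp_all add: sub_monoid_def)

section \<open>\<open>k\<close> as a monoid, and \<open>h\<close> as a left module over it\<close>

lemma k_submodule: "finite I \<Longrightarrow> submodule (k I) F (obj h I)"
  and k_spmap: "\<lbrakk>finite I; inj_on \<sigma> I; x \<in> k I\<rbrakk> \<Longrightarrow> spmap h I \<sigma> x \<in> k (\<sigma> ` I)"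
  and k_unit: "unit_elt h \<in> k {}"
  and k_mu: "\<lbrakk>finite S; finite T; S \<inter> T = {}; x \<in> k S; y \<in> k T\<rbrakk> \<Longrightarrow> mu h S T x y \<in> k (S \<union> T)"
  and k_Delta: "\<lbrakk>finite S; finite T; S \<inter> T = {}; x \<in> k (S \<union> T)\<rbrakk> \<Longrightarrow>
    Delta h S T x \<in> mod_span F (tensor_module F (obj h S) (obj h T))
      {pure_tensor F (obj h S) (obj h T) y z | y z. y \<in> k S \<and> z \<in> k T}"
proof -
  note c = hopf_submonoid[unfolded hopf_submonoid_def]
  note 1 = conjunct1[OF c] and 2 = conjunct1[OF conjunct2[OF c]]
    and 3 = conjunct1[OF conjunct2[OF conjunct2[OF c]]]
  show "unit_elt h \<in> k {}" by (rule 2)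
  show "submodule (k I) F (obj h I)" if "finite I"
    using 1 that unfolding subspecies_def by simp
  show "spmap h I \<sigma> x \<in> k (\<sigma> ` I)" if "finite I" "inj_on \<sigma> I" "x \<in> k I"
    using 1 that unfolding subspecies_def by (meson image_subset_iff)
  show "mu h S T x y \<in> k (S \<union> T)" if "finite S" "finite T" "S \<inter> T = {}" "x \<in> k S" "y \<in> k T"
    using 3[rule_format, of S T] that by simp
  show "Delta h S T x \<in> mod_span F (tensor_module F (obj h S) (obj h T))
      {pure_tensor F (obj h S) (obj h T) y z | y z. y \<in> k S \<and> z \<in> k T}"
    if "finite S" "finite T" "S \<inter> T = {}" "x \<in> k (S \<union> T)"
    using conjunct2[OF 3[rule_format, of S T]] that by blast
qed

lemma k_subset: "finite I \<Longrightarrow> k I \<subseteq> carrier (obj h I)"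
  by (rule submodule_subset[OF k_submodule obj_module])

lemma k_carrier: "\<lbrakk>finite I; x \<in> k I\<rbrakk> \<Longrightarrow> x \<in> carrier (obj h I)"
  using k_subset by blast

lemma k_module: "finite I \<Longrightarrow> Module.module F (K I)"
  by (rule submodule.submodule_is_module[OF k_submodule obj_module])

lemma k_incl_linear: "finite I \<Longrightarrow> (\<lambda>x. x) \<in> linear_maps F (K I) (obj h I)"
  by (rule linear_maps_subspace[OF linear_maps_id k_subset])

text \<open>Used in two ways: as a surjection \<open>h[I] \<rightarrow> k[I]\<close> it shows that
  \<open>k[I]\<close> is finite-dimensional, and as a left inverse of the inclusion it keeps that
  inclusion injective after tensoring.\<close>

lemma k_retraction:
  assumes "finite I"
  shows "\<exists>r \<in> linear_maps F (obj h I) (K I). \<forall>x\<in>k I. r x = x"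
proof -
  obtain r where r: "r \<in> linear_maps F (obj h I) (obj h I)"
      "\<And>x. x \<in> carrier (obj h I) \<Longrightarrow> r x \<in> k I" "\<forall>x\<in>k I. r x = x"
    using retraction_exists[OF field_axioms obj_module[OF assms] k_submodule[OF assms]
        obj_finite_dimensional[OF assms]] by blast
  show ?thesis using linear_maps_into_subspace[OF r(1,2)] r(3) by blast
qed

lemma k_species: "species F (sub_monoid h k)"
proof (intro species.intro species_axioms.intro field_axioms)
  fix I :: "'a set" assume I: "finite I"
  show "Module.module F (obj (sub_monoid h k) I)" using k_module[OF I] by simp
  obtain r where r: "r \<in> linear_maps F (obj h I) (K I)" "\<forall>x\<in>k I. r x = x"
    using k_retraction[OF I] by blast
  have "r ` carrier (obj h I) = carrier (K I)"
  proof
    show "r ` carrier (obj h I) \<subseteq> carrier (K I)" using linear_maps_closed[OF r(1)] by auto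
    show "carrier (K I) \<subseteq> r ` carrier (obj h I)"
    proof
      fix x assume "x \<in> carrier (K I)"
      then have "x = r x" "x \<in> carrier (obj h I)" using r(2) k_carrier[OF I] by auto
      then show "x \<in> r ` carrier (obj h I)" by (rule image_eqI)
    qed
  qed
  then show "finite_dimensional F (obj (sub_monoid h k) I)"
    using finite_dimensional_image[OF r(1) obj_module[OF I] k_module[OF I] _ obj_finite_dimensional[OF I]]
    by simp
  fix \<sigma> :: "'a \<Rightarrow> 'a" assume s: "inj_on \<sigma> I"
  show "spmap (sub_monoid h k) I \<sigma> \<in> linear_maps F (obj (sub_monoid h k) I) (obj (sub_monoid h k) (\<sigma> ` I))"
    using linear_maps_into_subspace[OF linear_maps_subspace[OF spmap_linear[OF I s] k_subset[OF I]]]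
      k_spmap[OF I s] by simp
next
  fix I :: "'a set" and \<sigma> \<tau> :: "'a \<Rightarrow> 'a" and x
  assume "finite I" "inj_on \<sigma> I" "\<And>i. i \<in> I \<Longrightarrow> \<sigma> i = \<tau> i" "x \<in> carrier (obj (sub_monoid h k) I)"
  then show "spmap (sub_monoid h k) I \<sigma> x = spmap (sub_monoid h k) I \<tau> x"
    unfolding sub_monoid_simps by (intro spmap_cong) (simp_all add: k_carrier)
qed (simp_all add: spmap_id spmap_comp k_carrier)

lemma k_monoid: "species_monoid F (sub_monoid h k)"
proof (intro species_monoid.intro species_monoid_axioms.intro k_species)
  fix S T :: "'a set" assume h: "finite S" "finite T" "S \<inter> T = {}"
  note b = mu_bilinear[OF h]
  show "mu (sub_monoid h k) S T \<in>
      bilinear_maps F (obj (sub_monoid h k) S) (obj (sub_monoid h k) T) (obj (sub_monoid h k) (S \<union> T))"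
    unfolding sub_monoid_simps
    by (intro bilinear_mapsI linear_maps_into_subspace linear_maps_subspace[OF _ k_subset[OF h(1)]]
        linear_maps_subspace[OF _ k_subset[OF h(2)]] bilinear_maps_right[OF b] bilinear_maps_left[OF b])
      (simp_all add: k_carrier h k_mu)
qed (simp_all add: mu_natural mu_assoc mu_unit_left mu_unit_right k_carrier k_unit)

lemma h_left_module: "left_module F (sub_monoid h k) h (mu h)"
proof (intro left_module.intro left_module_axioms.intro k_monoid species_axioms)
  fix S T :: "'a set" assume h: "finite S" "finite T" "S \<inter> T = {}"
  note b = mu_bilinear[OF h]
  show "mu h S T \<in> bilinear_maps F (obj (sub_monoid h k) S) (obj h T) (obj h (S \<union> T))"
    unfolding sub_monoid_simps
    by (intro bilinear_mapsI linear_maps_subspace[OF _ k_subset[OF h(1)]]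
        bilinear_maps_right[OF b] bilinear_maps_left[OF b]) (simp_all add: k_carrier h)
qed (simp_all add: mu_natural mu_assoc mu_unit_left k_carrier)

section \<open>The right ideal \<open>k\<^sub>+h\<close> as a subspecies\<close>

lemma plus_ideal_generators_subset:
  assumes "finite I"
  shows "{mu h S T x y | S T x y. (S, T) \<in> decomps I \<and> S \<noteq> {} \<and> x \<in> k S \<and> y \<in> carrier (obj h T)}
    \<subseteq> carrier (obj h I)"
proof clarify
  fix S T x y assume "(S, T) \<in> decomps I" "x \<in> k S" "y \<in> carrier (obj h T)"
  moreover from this have "S \<union> T = I" "S \<inter> T = {}" "finite S" "finite T"
    using assms by (auto simp: decomps_def)
  ultimately show "mu h S T x y \<in> carrier (obj h I)"
    using bilinear_maps_closed[OF mu_bilinear, of S T x y] k_carrier by simp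
qed

lemma plus_ideal_submodule: "finite I \<Longrightarrow> submodule (N I) F (obj h I)"
  unfolding plus_ideal_def by (rule submodule_mod_span[OF obj_module plus_ideal_generators_subset])

lemma plus_ideal_mu:
  assumes "finite S" and "finite T" and "S \<inter> T = {}" and "S \<noteq> {}"
    and "x \<in> k S" and "y \<in> carrier (obj h T)"
  shows "mu h S T x y \<in> N (S \<union> T)"
proof -
  have "(S, T) \<in> decomps (S \<union> T)" using assms(3) by (simp add: decomps_def)
  then show ?thesis
    unfolding plus_ideal_def using assms(4-6) by (intro subsetD[OF mod_span_incl]) blast
qed

text \<open>Naturality of the product sends a generator on \<open>(S, T)\<close> to a generator on
  the image decomposition, whose first block is again nonempty and whose first factor stays in
  \<open>k\<close>.\<close>

lemma plus_ideal_subspecies: "subspecies F h N"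
  unfolding subspecies_def
proof (intro conjI allI impI plus_ideal_submodule)
  fix I :: "'a set" and \<sigma> :: "'a \<Rightarrow> 'a" assume a: "finite I \<and> inj_on \<sigma> I"
  then have I: "finite I" and s: "inj_on \<sigma> I" and sI: "finite (\<sigma> ` I)" by auto
  have "N I \<subseteq> {x \<in> carrier (obj h I). spmap h I \<sigma> x \<in> N (\<sigma> ` I)}"
    unfolding plus_ideal_def[of F h k I]
  proof (rule mod_span_minimal[OF submodule_vimage[OF spmap_linear[OF I s] obj_module[OF I] obj_module[OF sI]
          plus_ideal_submodule[OF sI]]], clarify)
    fix S T x y assume d: "(S, T) \<in> decomps I" "S \<noteq> {}" and x: "x \<in> k S" and y: "y \<in> carrier (obj h T)"
    then have ST: "S \<union> T = I" "S \<inter> T = {}" and f: "finite S" "finite T"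
      using I by (auto simp: decomps_def)
    have i: "inj_on \<sigma> S" "inj_on \<sigma> T" using s ST(1) by (auto simp: inj_on_def)
    have d': "\<sigma> ` S \<inter> \<sigma> ` T = {}" using s ST by (auto simp: inj_on_def)
    have xc: "x \<in> carrier (obj h S)" using k_carrier[OF f(1) x] .
    have "spmap h I \<sigma> (mu h S T x y) = mu h (\<sigma> ` S) (\<sigma> ` T) (spmap h S \<sigma> x) (spmap h T \<sigma> y)"
      using mu_natural[OF f ST(2) _ xc y] ST(1) s by simp
    moreover have "\<dots> \<in> N (\<sigma> ` S \<union> \<sigma> ` T)"
      using f d' d(2) k_spmap[OF f(1) i(1) x] linear_maps_closed[OF spmap_linear[OF f(2) i(2)] y]
      by (intro plus_ideal_mu) auto
    moreover have "\<sigma> ` S \<union> \<sigma> ` T = \<sigma> ` I" using ST(1) by auto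
    moreover have "mu h S T x y \<in> carrier (obj h I)"
      using bilinear_maps_closed[OF mu_bilinear[OF f ST(2)] xc y] ST(1) by simp
    ultimately show "mu h S T x y \<in> carrier (obj h I) \<and> spmap h I \<sigma> (mu h S T x y) \<in> N (\<sigma> ` I)" by simp
  qed
  then show "spmap h I \<sigma> ` N I \<subseteq> N (\<sigma> ` I)" by auto
qed

text \<open>Connectedness makes \<open>h[\<emptyset>]\<close> a line. The coefficients of
  \<open>u\<close> and of the unit with respect to one generator are compared by applying the
  counit, which is 1 on the unit.\<close>

lemma empty_eq_counit_unit:
  assumes u: "u \<in> carrier (obj h {})"
  shows "u = counit h u \<odot>\<^bsub>obj h {}\<^esub> unit_elt h"
proof -
  interpret E: Module.module F "obj h {}" by (rule obj_module) simp
  obtain f where f: "f \<in> linear_maps F (ground_module F) (obj h {})"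
    "bij_betw f (carrier F) (carrier (obj h {}))"
    using connected by (auto simp: connected_species_def)
  note fD = linear_mapsD[OF f(1)]
  have fs: "f c = c \<odot>\<^bsub>obj h {}\<^esub> f \<one>" if "c \<in> carrier F" for c
    using fD(3)[of c \<one>] that by (simp add: ground_module_def)
  have f1: "f \<one> \<in> carrier (obj h {})" using fD(1)[of \<one>] by (simp add: ground_module_def)
  obtain a where a: "a \<in> carrier F" "unit_elt h = a \<odot>\<^bsub>obj h {}\<^esub> f \<one>"
    using unit_closed f(2) fs by (metis bij_betw_def imageE)
  obtain b where b: "b \<in> carrier F" "u = b \<odot>\<^bsub>obj h {}\<^esub> f \<one>"
    using u f(2) fs by (metis bij_betw_def imageE)
  note cD = linear_mapsD[OF counit_linear]
  \<comment> \<open>So \<open>a\<close> is invertible, that is, the unit itself generates the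
    line.\<close>
  have "a \<otimes> counit h (f \<one>) = \<one>"
    using cD(3)[OF a(1) f1] counit_unit a(2) by (simp add: ground_module_def)
  moreover have cf: "counit h (f \<one>) \<in> carrier F" using cD(1)[OF f1] by (simp add: ground_module_def)
  moreover have "counit h u = b \<otimes> counit h (f \<one>)"
    using cD(3)[OF b(1) f1] b(2) by (simp add: ground_module_def)
  ultimately have "counit h u \<otimes> a = b"
    using a(1) b(1) by (metis m_assoc m_comm r_one)
  moreover have "counit h u \<in> carrier F" using cD(1)[OF u] by (simp add: ground_module_def)
  ultimately show ?thesis
    using E.smult_assoc1[of "counit h u" a "f \<one>"] a b f1 by simp
qed

text \<open>The counit axiom by itself controls only the image of the coproduct under
  \<open>id \<otimes> \<epsilon>\<close>, with \<open>\<epsilon>\<close> the counit. But on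
  \<open>h[I] \<otimes> h[\<emptyset>]\<close> applying \<open>id \<otimes> \<epsilon>\<close> and
  then tensoring with the unit is the identity, by \<open>empty_eq_counit_unit\<close>, so the axiom
  determines the coproduct itself. The left version is symmetric.\<close>

lemma Delta_empty:
  assumes I: "finite I" and x: "x \<in> carrier (obj h I)"
  shows Delta_empty_right: "Delta h I {} x = pure_tensor F (obj h I) (obj h {}) x (unit_elt h)"
    and Delta_empty_left: "Delta h {} I x = pure_tensor F (obj h {}) (obj h I) (unit_elt h) x"
proof -
  note m = obj_module[OF I] obj_module[OF finite.emptyI]
  interpret V: Module.module F "obj h I" by (rule m)
  note cD = linear_mapsD[OF counit_linear, unfolded ground_module_def, simplified]
  {
    note mt = module_tensor_module[OF m]
    have b: "(\<lambda>y u. counit h u \<odot>\<^bsub>obj h I\<^esub> y) \<in> bilinear_maps F (obj h I) (obj h {}) (obj h I)"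
      by (intro bilinear_mapsI linear_mapsI) (auto simp: cD V.smult_l_distr V.smult_r_distr
        V.smult_assoc1[symmetric] m_comm)
    note l = tensor_lift[OF m m(1) b]
    note p = pure_tensor_bilinear[OF m]
    note lp = linear_maps_compose[OF l(1) bilinear_maps_left[OF p unit_closed]]
    have "pure_tensor F (obj h I) (obj h {}) (tensor_lift F (obj h I) (\<lambda>y u. counit h u \<odot>\<^bsub>obj h I\<^esub> y) t)
        (unit_elt h) = t" if "t \<in> carrier (tensor_module F (obj h I) (obj h {}))" for t
    proof (rule tensor_ext[OF m mt lp linear_maps_id _ that])
      fix v w assume v: "v \<in> carrier (obj h I)" and w: "w \<in> carrier (obj h {})"
      \<comment> \<open>The scalar \<open>\<epsilon>(w)\<close> moves across the tensor sign, where
        it rebuilds \<open>w\<close> from the unit.\<close>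
      have "pure_tensor F (obj h I) (obj h {}) (counit h w \<odot>\<^bsub>obj h I\<^esub> v) (unit_elt h) =
          pure_tensor F (obj h I) (obj h {}) v (counit h w \<odot>\<^bsub>obj h {}\<^esub> unit_elt h)"
        using linear_maps_smult[OF bilinear_maps_left[OF p unit_closed] cD(1)[OF w] v]
          linear_maps_smult[OF bilinear_maps_right[OF p v] cD(1)[OF w] unit_closed] by simp
      then show "pure_tensor F (obj h I) (obj h {}) (tensor_lift F (obj h I)
          (\<lambda>y u. counit h u \<odot>\<^bsub>obj h I\<^esub> y) (pure_tensor F (obj h I) (obj h {}) v w)) (unit_elt h) =
          pure_tensor F (obj h I) (obj h {}) v w"
        using l(2)[OF v w] empty_eq_counit_unit[OF w] by simp
    qed
    moreover have "Delta h I {} x \<in> carrier (tensor_module F (obj h I) (obj h {}))"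
      using linear_maps_closed[OF Delta_linear[OF I finite.emptyI], of x] x by simp
    ultimately show "Delta h I {} x = pure_tensor F (obj h I) (obj h {}) x (unit_elt h)"
      using Delta_counit_right[OF I x] by metis
  }
  {
    note mt = module_tensor_module[OF m(2,1)]
    have b: "(\<lambda>u y. counit h u \<odot>\<^bsub>obj h I\<^esub> y) \<in> bilinear_maps F (obj h {}) (obj h I) (obj h I)"
      by (intro bilinear_mapsI linear_mapsI) (auto simp: cD V.smult_l_distr V.smult_r_distr
        V.smult_assoc1[symmetric] m_comm)
    note l = tensor_lift[OF m(2,1) m(1) b]
    note p = pure_tensor_bilinear[OF m(2,1)]
    note lp = linear_maps_compose[OF l(1) bilinear_maps_right[OF p unit_closed]]
    have "pure_tensor F (obj h {}) (obj h I) (unit_elt h)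
        (tensor_lift F (obj h I) (\<lambda>u y. counit h u \<odot>\<^bsub>obj h I\<^esub> y) t) = t"
      if "t \<in> carrier (tensor_module F (obj h {}) (obj h I))" for t
    proof (rule tensor_ext[OF m(2,1) mt lp linear_maps_id _ that])
      fix w v assume v: "v \<in> carrier (obj h I)" and w: "w \<in> carrier (obj h {})"
      have "pure_tensor F (obj h {}) (obj h I) (unit_elt h) (counit h w \<odot>\<^bsub>obj h I\<^esub> v) =
          pure_tensor F (obj h {}) (obj h I) (counit h w \<odot>\<^bsub>obj h {}\<^esub> unit_elt h) v"
        using linear_maps_smult[OF bilinear_maps_left[OF p v] cD(1)[OF w] unit_closed]
          linear_maps_smult[OF bilinear_maps_right[OF p unit_closed] cD(1)[OF w] v] by simp
      then show "pure_tensor F (obj h {}) (obj h I) (unit_elt h) (tensor_lift F (obj h I)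
          (\<lambda>u y. counit h u \<odot>\<^bsub>obj h I\<^esub> y) (pure_tensor F (obj h {}) (obj h I) w v)) =
          pure_tensor F (obj h {}) (obj h I) w v"
        using l(2)[OF w v] empty_eq_counit_unit[OF w] by simp
    qed
    moreover have "Delta h {} I x \<in> carrier (tensor_module F (obj h {}) (obj h I))"
      using linear_maps_closed[OF Delta_linear[OF finite.emptyI I], of x] x by simp
    ultimately show "Delta h {} I x = pure_tensor F (obj h {}) (obj h I) (unit_elt h) x"
      using Delta_counit_left[OF I x] by metis
  }
qed

end

section \<open>A natural projection of \<open>h\<close> with kernel
  \<open>k\<^sub>+h\<close>\<close>

context hopf_submonoid_pair
begin

text \<open>Chosen before any model of the quotient is fixed, so that the sections for the different
  models all come from the same projection.\<close>

definition proj :: "'a set \<Rightarrow> 'v \<Rightarrow> 'v"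
  where "proj = (SOME e. \<forall>I. finite I \<longrightarrow>
    e I \<in> linear_maps F (obj h I) (obj h I) \<and>
    (\<forall>x\<in>carrier (obj h I). x \<ominus>\<^bsub>obj h I\<^esub> e I x \<in> N I) \<and>
    (\<forall>x\<in>N I. e I x = \<zero>\<^bsub>obj h I\<^esub>) \<and>
    (\<forall>\<sigma>. inj_on \<sigma> I \<longrightarrow> (\<forall>x\<in>carrier (obj h I). e (\<sigma> ` I) (spmap h I \<sigma> x) = spmap h I \<sigma> (e I x))))"

lemma proj_linear: "finite I \<Longrightarrow> proj I \<in> linear_maps F (obj h I) (obj h I)"
  and proj_diff: "\<lbrakk>finite I; x \<in> carrier (obj h I)\<rbrakk> \<Longrightarrow> x \<ominus>\<^bsub>obj h I\<^esub> proj I x \<in> N I"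
  and proj_plus_ideal: "\<lbrakk>finite I; x \<in> N I\<rbrakk> \<Longrightarrow> proj I x = \<zero>\<^bsub>obj h I\<^esub>"
  and proj_natural: "\<lbrakk>finite I; inj_on \<sigma> I; x \<in> carrier (obj h I)\<rbrakk> \<Longrightarrow>
    proj (\<sigma> ` I) (spmap h I \<sigma> x) = spmap h I \<sigma> (proj I x)"
proof -
  note p = someI_ex[OF subspecies_projection_exists[OF characteristic_zero plus_ideal_subspecies],
      folded proj_def, rule_format]
  show "proj I \<in> linear_maps F (obj h I) (obj h I)" if "finite I" using p[OF that] by (elim conjE)
  show "x \<ominus>\<^bsub>obj h I\<^esub> proj I x \<in> N I" if "finite I" "x \<in> carrier (obj h I)"
    using conjunct1[OF conjunct2[OF p[OF that(1)]]] that(2) by (rule bspec)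
  show "proj I x = \<zero>\<^bsub>obj h I\<^esub>" if "finite I" "x \<in> N I"
    using conjunct1[OF conjunct2[OF conjunct2[OF p[OF that(1)]]]] that(2) by (rule bspec)
  show "proj (\<sigma> ` I) (spmap h I \<sigma> x) = spmap h I \<sigma> (proj I x)"
    if "finite I" "inj_on \<sigma> I" "x \<in> carrier (obj h I)"
    using conjunct2[OF conjunct2[OF conjunct2[OF p[OF that(1)]]], rule_format, OF that(2,3)] .
qed

text \<open>Lets \<open>proj\<close> act as a quotient map in the sense of \<open>pr_kernel\<close>,
  with its own image as the target.\<close>

lemma proj_eq_zero_iff:
  assumes I: "finite I" and x: "x \<in> carrier (obj h I)"
  shows "proj I x = \<zero>\<^bsub>obj h I\<^esub> \<longleftrightarrow> x \<in> N I"
proof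
  interpret V: Module.module F "obj h I" by (rule obj_module[OF I])
  assume p: "proj I x = \<zero>\<^bsub>obj h I\<^esub>"
  note N = submoduleD[OF plus_ideal_submodule[OF I] obj_module[OF I]]
  have "(x \<ominus>\<^bsub>obj h I\<^esub> proj I x) \<oplus>\<^bsub>obj h I\<^esub> proj I x = x"
    using x linear_maps_closed[OF proj_linear[OF I] x] by (simp add: a_minus_def V.a_assoc V.l_neg)
  moreover have "(x \<ominus>\<^bsub>obj h I\<^esub> proj I x) \<oplus>\<^bsub>obj h I\<^esub> proj I x \<in> N I"
    using N(3)[OF proj_diff[OF I x], of "proj I x"] N(2) p by simp
  ultimately show "x \<in> N I" by simp
qed (rule proj_plus_ideal[OF I])

end

text \<open>Common ground for the cosets of the ideal and for the image of \<open>proj\<close>: what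
  matters is a natural linear surjection whose kernel is the ideal. Linearity of
  \<open>spmap q\<close> is a consequence, because \<open>pr\<close> is onto and natural.\<close>

locale hopf_quotient = hopf_submonoid_pair F h k
  for F :: "('f, 'r) ring_scheme" (structure) and h :: "('a::infinite, 'f, 'v) hopf_species" and k +
  fixes q :: "('a, 'f, 'w) species" and pr :: "'a set \<Rightarrow> 'v \<Rightarrow> 'w"
  assumes q_module: "finite I \<Longrightarrow> Module.module F (obj q I)"
    and pr_linear: "finite I \<Longrightarrow> pr I \<in> linear_maps F (obj h I) (obj q I)"
    and pr_surj: "finite I \<Longrightarrow> pr I ` carrier (obj h I) = carrier (obj q I)"
    and pr_natural: "\<lbrakk>finite I; inj_on \<sigma> I; x \<in> carrier (obj h I)\<rbrakk> \<Longrightarrow>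
      pr (\<sigma> ` I) (spmap h I \<sigma> x) = spmap q I \<sigma> (pr I x)"
    and pr_kernel: "\<lbrakk>finite I; x \<in> carrier (obj h I)\<rbrakk> \<Longrightarrow> pr I x = \<zero>\<^bsub>obj q I\<^esub> \<longleftrightarrow> x \<in> N I"
begin

lemma q_cases:
  assumes "finite I" and "y \<in> carrier (obj q I)"
  obtains x where "x \<in> carrier (obj h I)" and "y = pr I x"
  using pr_surj[OF assms(1)] assms(2) by auto

lemma q_spmap_linear:
  assumes I: "finite I" and s: "inj_on \<sigma> I"
  shows "spmap q I \<sigma> \<in> linear_maps F (obj q I) (obj q (\<sigma> ` I))"
proof (rule linear_mapsI)
  interpret V: Module.module F "obj h I" by (rule obj_module[OF I])
  have fs: "finite (\<sigma> ` I)" using I by simp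
  note P = linear_mapsD[OF pr_linear[OF I]] linear_mapsD[OF pr_linear[OF fs]]
    linear_mapsD[OF spmap_linear[OF I s]]
  note nat = pr_natural[OF I s, symmetric]
  fix x assume x: "x \<in> carrier (obj q I)"
  then obtain u where u: "u \<in> carrier (obj h I)" "x = pr I u" by (rule q_cases[OF I])
  then show "spmap q I \<sigma> x \<in> carrier (obj q (\<sigma> ` I))" by (simp add: nat P)
  { fix y assume "y \<in> carrier (obj q I)"
    then obtain v where "v \<in> carrier (obj h I)" "y = pr I v" by (rule q_cases[OF I])
    then show "spmap q I \<sigma> (x \<oplus>\<^bsub>obj q I\<^esub> y) = spmap q I \<sigma> x \<oplus>\<^bsub>obj q (\<sigma> ` I)\<^esub> spmap q I \<sigma> y"
      using u by (simp add: nat P P(2)[symmetric] del: P(2)) }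
  { fix c assume "c \<in> carrier F"
    then show "spmap q I \<sigma> (c \<odot>\<^bsub>obj q I\<^esub> x) = c \<odot>\<^bsub>obj q (\<sigma> ` I)\<^esub> spmap q I \<sigma> x"
      using u by (simp add: nat P P(3)[symmetric] del: P(3)) }
qed

text \<open>The picked preimage does not affect the value: two of them differ by an element of the
  ideal, which \<open>proj\<close> kills. Linearity and naturality of the section are inherited from
  \<open>proj\<close> in this way.\<close>

definition sec :: "'a set \<Rightarrow> 'w \<Rightarrow> 'v"
  where "sec I y = proj I (SOME x. x \<in> carrier (obj h I) \<and> pr I x = y)"

lemma sec_pr:
  assumes I: "finite I" and x: "x \<in> carrier (obj h I)"
  shows "sec I (pr I x) = proj I x"
proof -
  interpret V: Module.module F "obj h I" by (rule obj_module[OF I])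
  interpret Q: Module.module F "obj q I" by (rule q_module[OF I])
  define u where "u = (SOME u. u \<in> carrier (obj h I) \<and> pr I u = pr I x)"
  have u: "u \<in> carrier (obj h I)" "pr I u = pr I x"
    using someI[of "\<lambda>u. u \<in> carrier (obj h I) \<and> pr I u = pr I x" x] x by (auto simp: u_def)
  have "pr I (u \<ominus>\<^bsub>obj h I\<^esub> x) = pr I u \<ominus>\<^bsub>obj q I\<^esub> pr I x"
    by (rule linear_maps_minus[OF pr_linear[OF I] obj_module[OF I] q_module[OF I] u(1) x])
  also have "\<dots> = \<zero>\<^bsub>obj q I\<^esub>"
    using Q.minus_eq_zero_iff linear_maps_closed[OF pr_linear[OF I] x] u(2) by simp
  finally have "u \<ominus>\<^bsub>obj h I\<^esub> x \<in> N I" using pr_kernel[OF I] u(1) x by simp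
  then have "proj I u \<ominus>\<^bsub>obj h I\<^esub> proj I x = \<zero>\<^bsub>obj h I\<^esub>"
    using proj_plus_ideal[OF I] linear_maps_minus[OF proj_linear[OF I] obj_module[OF I] obj_module[OF I] u(1) x]
    by simp
  then have "proj I u = proj I x"
    using V.minus_eq_zero_iff linear_maps_closed[OF proj_linear[OF I]] u(1) x by simp
  then show ?thesis by (simp add: sec_def u_def)
qed

lemma pr_proj:
  assumes I: "finite I" and x: "x \<in> carrier (obj h I)"
  shows "pr I (proj I x) = pr I x"
proof -
  interpret Q: Module.module F "obj q I" by (rule q_module[OF I])
  interpret V: Module.module F "obj h I" by (rule obj_module[OF I])
  note px = linear_maps_closed[OF proj_linear[OF I] x]
  have "pr I (x \<ominus>\<^bsub>obj h I\<^esub> proj I x) = \<zero>\<^bsub>obj q I\<^esub>"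
    using pr_kernel[OF I] proj_diff[OF I x] x px by simp
  then have "pr I x \<ominus>\<^bsub>obj q I\<^esub> pr I (proj I x) = \<zero>\<^bsub>obj q I\<^esub>"
    using linear_maps_minus[OF pr_linear[OF I] obj_module[OF I] q_module[OF I] x px] by simp
  then show ?thesis using Q.minus_eq_zero_iff linear_maps_closed[OF pr_linear[OF I]] x px by simp
qed

lemma pr_sec: "\<lbrakk>finite I; y \<in> carrier (obj q I)\<rbrakk> \<Longrightarrow> pr I (sec I y) = y"
  by (rule q_cases) (auto simp: sec_pr pr_proj)

lemma sec_linear:
  assumes I: "finite I"
  shows "sec I \<in> linear_maps F (obj q I) (obj h I)"
proof (rule linear_mapsI)
  interpret V: Module.module F "obj h I" by (rule obj_module[OF I])
  note P = linear_mapsD[OF pr_linear[OF I]] and E = linear_mapsD[OF proj_linear[OF I]]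
  fix x assume x: "x \<in> carrier (obj q I)"
  then obtain u where u: "u \<in> carrier (obj h I)" "x = pr I u" by (rule q_cases[OF I])
  then show "sec I x \<in> carrier (obj h I)" by (simp add: sec_pr[OF I] E)
  { fix y assume "y \<in> carrier (obj q I)"
    then obtain v where "v \<in> carrier (obj h I)" "y = pr I v" by (rule q_cases[OF I])
    then show "sec I (x \<oplus>\<^bsub>obj q I\<^esub> y) = sec I x \<oplus>\<^bsub>obj h I\<^esub> sec I y"
      using u by (simp add: P(2)[symmetric] sec_pr[OF I] E) }
  { fix c assume "c \<in> carrier F"
    then show "sec I (c \<odot>\<^bsub>obj q I\<^esub> x) = c \<odot>\<^bsub>obj h I\<^esub> sec I x"
      using u by (simp add: P(3)[symmetric] sec_pr[OF I] E) }
qed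

lemma sec_natural:
  assumes I: "finite I" and s: "inj_on \<sigma> I" and y: "y \<in> carrier (obj q I)"
  shows "sec (\<sigma> ` I) (spmap q I \<sigma> y) = spmap h I \<sigma> (sec I y)"
proof -
  from y obtain x where x: "x \<in> carrier (obj h I)" "y = pr I x" by (rule q_cases[OF I])
  have "finite (\<sigma> ` I)" using I by simp
  then show ?thesis
    using x sec_pr[OF I x(1)] sec_pr[of "\<sigma> ` I" "spmap h I \<sigma> x"] pr_natural[OF I s x(1)]
      linear_maps_closed[OF spmap_linear[OF I s] x(1)] proj_natural[OF I s x(1)] by simp
qed

section \<open>Triangularity of \<open>\<psi>\<close> on products\<close>

definition psi :: "'a set \<Rightarrow> 'a set \<Rightarrow> 'v \<Rightarrow> ('f, 'v, 'w) tensor"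
  where "psi A B x = tensor_map F (obj h A) (obj q B) (\<lambda>x. x) (pr B) (Delta h A B x)"

lemma psi_linear:
  assumes "finite A" and "finite B" and "A \<inter> B = {}"
  shows "psi A B \<in> linear_maps F (obj h (A \<union> B)) (tensor_module F (obj h A) (obj q B))"
  using linear_maps_compose[OF Delta_linear[OF assms] tensor_map_linear[OF obj_module[OF assms(1)]
      obj_module[OF assms(2)] obj_module[OF assms(1)] q_module[OF assms(2)] linear_maps_id pr_linear[OF assms(2)]]]
  by (simp add: psi_def[abs_def])

text \<open>Splitting the product \<open>x y\<close> along its own factors puts the middle terms of
  the compatibility axiom \<open>Delta_mu\<close> on the empty set. There \<open>Delta_empty\<close>
  turns them into units, and the interchange leaves \<open>x \<otimes> y\<close>.\<close>

lemma psi_mu_same: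
  assumes A: "finite A" and B: "finite B" and d: "A \<inter> B = {}"
    and x: "x \<in> carrier (obj h A)" and y: "y \<in> carrier (obj h B)"
  shows "psi A B (mu h A B x y) = pure_tensor F (obj h A) (obj q B) x (pr B y)"
proof -
  have s: "A \<inter> A = A" "B \<inter> A = {}" "A \<inter> B = {}" "B \<inter> B = B" using d by auto
  note m = obj_module[OF A] obj_module[OF finite.emptyI] obj_module[OF B]
  have b: "mu h A {} \<in> bilinear_maps F (obj h A) (obj h {}) (obj h A)"
    "mu h {} B \<in> bilinear_maps F (obj h {}) (obj h B) (obj h B)"
    using mu_bilinear[OF A finite.emptyI] mu_bilinear[OF finite.emptyI B] by simp_all
  have "Delta h A B (mu h A B x y) = tensor_interchange F (obj h A) (obj h B) (mu h A {}) (mu h {} B)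
      (Delta h A {} x) (Delta h {} B y)"
    using Delta_mu[OF A B d d refl x y] by (simp add: s)
  also have "\<dots> = pure_tensor F (obj h A) (obj h B) x y"
    using tensor_interchange_pure[OF m(1,2,2,3) m(1,3) b x unit_closed unit_closed y]
    by (simp add: Delta_empty_right[OF A x] Delta_empty_left[OF B y] mu_unit_right[OF A x] mu_unit_left[OF B y])
  finally show ?thesis
    using tensor_map_pure[OF m(1,3,1) q_module[OF B] linear_maps_id pr_linear[OF B] x y]
    by (simp add: psi_def)
qed

text \<open>If \<open>S\<close> meets \<open>B\<close>, the second tensor factor of the coproduct lies in the ideal, because \<open>k\<close> is
  closed under the coproduct.\<close>

lemma psi_mu_zero:
  assumes fin: "finite S" "finite T" "finite A" "finite B" and ST: "S \<inter> T = {}" and AB: "A \<inter> B = {}"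
    and eq: "A \<union> B = S \<union> T" and SB: "S \<inter> B \<noteq> {}"
    and x: "x \<in> k S" and y: "y \<in> carrier (obj h T)"
  shows "psi A B (mu h S T x y) = \<zero>\<^bsub>tensor_module F (obj h A) (obj q B)\<^esub>"
proof -
  have f: "finite (S \<inter> A)" "finite (S \<inter> B)" "finite (T \<inter> A)" "finite (T \<inter> B)" using fin by auto
  note m = obj_module[OF f(1)] obj_module[OF f(2)] obj_module[OF f(3)] obj_module[OF f(4)]
    obj_module[OF fin(3)] obj_module[OF fin(4)] and mq = q_module[OF fin(4)]
  have dA: "S \<inter> A \<inter> (T \<inter> A) = {}" "S \<inter> A \<union> T \<inter> A = A" and dB: "S \<inter> B \<inter> (T \<inter> B) = {}" "S \<inter> B \<union> T \<inter> B = B"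
    and dS: "S \<inter> A \<inter> (S \<inter> B) = {}" "S \<inter> A \<union> S \<inter> B = S" and dT: "T \<inter> A \<inter> (T \<inter> B) = {}" "T \<inter> A \<union> T \<inter> B = T"
    using ST AB eq by auto
  note b1 = mu_bilinear[OF f(1,3) dA(1), unfolded dA(2)] and b2 = mu_bilinear[OF f(2,4) dB(1), unfolded dB(2)]
  let ?U = "tensor_module F (obj h (S \<inter> A)) (obj h (S \<inter> B))"
  let ?V = "tensor_module F (obj h (T \<inter> A)) (obj h (T \<inter> B))"
  let ?W = "tensor_module F (obj h A) (obj h B)" and ?Q = "tensor_module F (obj h A) (obj q B)"
  let ?i = "tensor_interchange F (obj h A) (obj h B) (mu h (S \<inter> A) (T \<inter> A)) (mu h (S \<inter> B) (T \<inter> B))"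
  let ?p = "tensor_map F (obj h A) (obj q B) (\<lambda>x. x) (pr B)"
  note mU = module_tensor_module[OF m(1,2)] and mQ = module_tensor_module[OF m(5) mq]
  note i = tensor_interchange[OF m b1 b2]
  note p = tensor_map[OF m(5,6,5) mq linear_maps_id pr_linear[OF fin(4)]]
  let ?t = "Delta h (T \<inter> A) (T \<inter> B) y"
  have t: "?t \<in> carrier ?V"
    using linear_maps_closed[OF Delta_linear[OF f(3,4) dT(1)]] y dT(2) by simp
  note lin = linear_maps_compose[OF bilinear_maps_left[OF i(1) t] p(1)]
  \<comment> \<open>A pure tensor \<open>u \<otimes> v\<close> stands in for the coproduct of
    \<open>x\<close>, while \<open>?t\<close> stays arbitrary and is tested on pure tensors
    \<open>a \<otimes> b\<close>. The product \<open>v b\<close> lies in the ideal as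
    \<open>S \<inter> B\<close> is nonempty, so \<open>pr B\<close> kills it.\<close>
  have gen: "?p (?i (pure_tensor F (obj h (S \<inter> A)) (obj h (S \<inter> B)) u v) ?t) = \<zero>\<^bsub>?Q\<^esub>"
    if u: "u \<in> k (S \<inter> A)" and v: "v \<in> k (S \<inter> B)" for u v
  proof -
    note uc = k_carrier[OF f(1) u] and vc = k_carrier[OF f(2) v]
    note uv = pure_tensor_closed[OF m(1,2) uc vc]
    show ?thesis
    proof (rule tensor_ext[OF m(3,4) mQ linear_maps_compose[OF bilinear_maps_right[OF i(1) uv] p(1)]
          linear_maps_zero_map[OF mQ] _ t])
      fix a b assume a: "a \<in> carrier (obj h (T \<inter> A))" and b: "b \<in> carrier (obj h (T \<inter> B))"
      let ?a = "mu h (S \<inter> A) (T \<inter> A) u a" and ?b = "mu h (S \<inter> B) (T \<inter> B) v b"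
      have c: "?a \<in> carrier (obj h A)" "?b \<in> carrier (obj h B)"
        using bilinear_maps_closed[OF b1 uc a] bilinear_maps_closed[OF b2 vc b] .
      have "?b \<in> N B" using plus_ideal_mu[OF f(2,4) dB(1) SB v b] dB(2) by simp
      then have "pr B ?b = \<zero>\<^bsub>obj q B\<^esub>" using pr_kernel[OF fin(4) c(2)] by simp
      then have "?p (pure_tensor F (obj h A) (obj h B) ?a ?b) = pure_tensor F (obj h A) (obj q B) ?a \<zero>\<^bsub>obj q B\<^esub>"
        using p(2)[OF c] by simp
      also have "\<dots> = \<zero>\<^bsub>?Q\<^esub>"
        by (rule linear_maps_zero[OF bilinear_maps_right[OF pure_tensor_bilinear[OF m(5) mq] c(1)] mq mQ])
      finally show "?p (?i (pure_tensor F (obj h (S \<inter> A)) (obj h (S \<inter> B)) u v)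
          (pure_tensor F (obj h (T \<inter> A)) (obj h (T \<inter> B)) a b)) = \<zero>\<^bsub>?Q\<^esub>"
        using i(2)[OF uc vc a b] by simp
    qed
  qed
  have "mod_span F ?U {pure_tensor F (obj h (S \<inter> A)) (obj h (S \<inter> B)) u v | u v. u \<in> k (S \<inter> A) \<and> v \<in> k (S \<inter> B)}
      \<subseteq> {s \<in> carrier ?U. ?p (?i s ?t) = \<zero>\<^bsub>?Q\<^esub>}"
    by (rule mod_span_minimal[OF submodule_kernel[OF lin mU mQ]])
      (use gen pure_tensor_closed[OF m(1,2) k_carrier[OF f(1)] k_carrier[OF f(2)]] in blast)
  moreover have "Delta h (S \<inter> A) (S \<inter> B) x \<in>
      mod_span F ?U {pure_tensor F (obj h (S \<inter> A)) (obj h (S \<inter> B)) u v | u v. u \<in> k (S \<inter> A) \<and> v \<in> k (S \<inter> B)}"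
    using k_Delta[OF f(1,2) dS(1)] x dS(2) by simp
  ultimately have "?p (?i (Delta h (S \<inter> A) (S \<inter> B) x) ?t) = \<zero>\<^bsub>?Q\<^esub>" by blast
  then show ?thesis
    using Delta_mu[OF fin(1,2) ST AB eq k_carrier[OF fin(1) x] y] by (simp add: psi_def)
qed

text \<open>The summand of \<open>phi\<close> at \<open>(S, T)\<close>. Its source is
  \<open>k[S] \<otimes> q[T]\<close>, which the body does not mention since
  \<open>tensor_lift\<close> records only the target.\<close>

definition mu_sec :: "'a set \<Rightarrow> 'a set \<Rightarrow> ('f, 'v, 'w) tensor \<Rightarrow> 'v"
  where "mu_sec S T = tensor_lift F (obj h (S \<union> T)) (\<lambda>x y. mu h S T x (sec T y))"

lemma mu_sec_linear:
    "\<lbrakk>finite S; finite T; S \<inter> T = {}\<rbrakk> \<Longrightarrow>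
      mu_sec S T \<in> linear_maps F (tensor_module F (K S) (obj q T)) (obj h (S \<union> T))"
  and mu_sec_pure: "\<lbrakk>finite S; finite T; S \<inter> T = {}; x \<in> k S; y \<in> carrier (obj q T)\<rbrakk> \<Longrightarrow>
      mu_sec S T (pure_tensor F (K S) (obj q T) x y) = mu h S T x (sec T y)"
proof -
  assume h: "finite S" "finite T" "S \<inter> T = {}"
  have fU: "finite (S \<union> T)" using h by simp
  note l = tensor_lift[OF k_module[OF h(1)] q_module[OF h(2)] obj_module[OF fU]
      linear_bilinear_compose[OF mu_bilinear[OF h] k_incl_linear[OF h(1)] sec_linear[OF h(2)] linear_maps_id]]
  show "mu_sec S T \<in> linear_maps F (tensor_module F (K S) (obj q T)) (obj h (S \<union> T))"
    using l(1) by (simp add: mu_sec_def)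
  show "mu_sec S T (pure_tensor F (K S) (obj q T) x y) = mu h S T x (sec T y)"
    if "x \<in> k S" "y \<in> carrier (obj q T)"
    using l(2)[of x y] that by (simp add: mu_sec_def)
qed

text \<open>In the second factor \<open>pr\<close> undoes \<open>sec\<close>. The right-hand side is
  not simply \<open>t\<close>: it is the inclusion of \<open>k[A] \<otimes> q[B]\<close> into
  \<open>h[A] \<otimes> q[B]\<close>, whose elements are classes in two different free
  modules.\<close>

lemma psi_mu_sec_same:
  assumes A: "finite A" and B: "finite B" and d: "A \<inter> B = {}" and t: "t \<in> carrier (tensor_module F (K A) (obj q B))"
  shows "psi A B (mu_sec A B t) = tensor_map F (obj h A) (obj q B) (\<lambda>x. x) (\<lambda>y. y) t"
proof -
  note m = k_module[OF A] q_module[OF B] obj_module[OF A]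
  note tm = tensor_map[OF m(1,2,3,2) k_incl_linear[OF A] linear_maps_id]
  show ?thesis
  proof (rule tensor_ext[OF m(1,2) module_tensor_module[OF m(3,2)]
        linear_maps_compose[OF mu_sec_linear[OF A B d] psi_linear[OF A B d]] tm(1) _ t])
    fix x y assume x: "x \<in> carrier (K A)" and y: "y \<in> carrier (obj q B)"
    then show "psi A B (mu_sec A B (pure_tensor F (K A) (obj q B) x y)) =
        tensor_map F (obj h A) (obj q B) (\<lambda>x. x) (\<lambda>y. y) (pure_tensor F (K A) (obj q B) x y)"
      using mu_sec_pure[OF A B d _ y, of x] tm(2)[OF x y] psi_mu_same[OF A B d _ linear_maps_closed[OF sec_linear[OF B] y], of x]
        k_carrier[OF A, of x] pr_sec[OF B y] by simp
  qed
qed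

text \<open>The off-diagonal half of triangularity. Since \<open>A\<close> and \<open>B\<close>
  partition \<open>S \<union> T\<close>, the condition that \<open>S\<close> meets \<open>B\<close>
  says that \<open>S\<close> is not contained in \<open>A\<close>.\<close>

lemma psi_mu_sec_zero:
  assumes fin: "finite S" "finite T" "finite A" "finite B" and ST: "S \<inter> T = {}" and AB: "A \<inter> B = {}"
    and eq: "A \<union> B = S \<union> T" and SB: "S \<inter> B \<noteq> {}"
    and t: "t \<in> carrier (tensor_module F (K S) (obj q T))"
  shows "psi A B (mu_sec S T t) = \<zero>\<^bsub>tensor_module F (obj h A) (obj q B)\<^esub>"
proof -
  note m = k_module[OF fin(1)] q_module[OF fin(2)]
  note mQ = module_tensor_module[OF obj_module[OF fin(3)] q_module[OF fin(4)]]
  show ?thesis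
  proof (rule tensor_ext[OF m mQ linear_maps_compose[OF mu_sec_linear[OF fin(1,2) ST]
        psi_linear[OF fin(3,4) AB, unfolded eq]] linear_maps_zero_map[OF mQ] _ t])
    fix x y assume "x \<in> carrier (K S)" "y \<in> carrier (obj q T)"
    then show "psi A B (mu_sec S T (pure_tensor F (K S) (obj q T) x y)) = \<zero>\<^bsub>tensor_module F (obj h A) (obj q B)\<^esub>"
      using mu_sec_pure[OF fin(1,2) ST, of x y] psi_mu_zero[OF fin ST AB eq SB, of x "sec T y"]
        linear_maps_closed[OF sec_linear[OF fin(2)], of y] by simp
  qed
qed

end

section \<open>Decompositions of a finite set\<close>

lemma finite_decomps:
  assumes "finite I"
  shows "finite (decomps I)"
  by (rule finite_subset[of _ "Pow I \<times> Pow I"]) (use assms in \<open>auto simp: decomps_def\<close>)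

lemma decompsD:
  assumes "(S, T) \<in> decomps I"
  shows "S \<union> T = I" and "S \<inter> T = {}" and "finite I \<Longrightarrow> finite S" and "finite I \<Longrightarrow> finite T"
  using assms by (auto simp: decomps_def)

text \<open>\<open>cauchy\<close> indexes the image of a family by decompositions of the target and
  looks up preimages of the blocks. These facts let sums over decompositions of the image be
  reindexed from \<open>I\<close>, with the preimages evaluated.\<close>

lemma decomps_image:
  assumes "inj_on \<sigma> I"
  shows "decomps (\<sigma> ` I) = (\<lambda>(S, T). (\<sigma> ` S, \<sigma> ` T)) ` decomps I"
    and "inj_on (\<lambda>(S, T). (\<sigma> ` S, \<sigma> ` T)) (decomps I)"
    and "(S, T) \<in> decomps I \<Longrightarrow> I \<inter> \<sigma> -` \<sigma> ` S = S"
    and "(S, T) \<in> decomps I \<Longrightarrow> I \<inter> \<sigma> -` \<sigma> ` T = T"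
proof -
  have vim: "I \<inter> \<sigma> -` \<sigma> ` S = S" if "S \<subseteq> I" for S
    using assms that by (auto simp: inj_on_def)
  show 1: "I \<inter> \<sigma> -` \<sigma> ` S = S" "I \<inter> \<sigma> -` \<sigma> ` T = T" if "(S, T) \<in> decomps I" for S T
    using vim that by (auto simp: decomps_def)
  show "inj_on (\<lambda>(S, T). (\<sigma> ` S, \<sigma> ` T)) (decomps I)"
  proof (rule inj_onI, clarify)
    fix S T S' T' assume a: "(S, T) \<in> decomps I" "(S', T') \<in> decomps I" "\<sigma> ` S = \<sigma> ` S'" "\<sigma> ` T = \<sigma> ` T'"
    show "S = S' \<and> T = T'" using 1[OF a(1)] 1[OF a(2)] a(3,4) by metis
  qed
  show "decomps (\<sigma> ` I) = (\<lambda>(S, T). (\<sigma> ` S, \<sigma> ` T)) ` decomps I"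
  proof (intro equalityI subsetI)
    fix d assume d: "d \<in> decomps (\<sigma> ` I)"
    obtain S' T' where st: "d = (S', T')" by (cases d)
    have "S' \<subseteq> \<sigma> ` I" "T' \<subseteq> \<sigma> ` I" "S' \<union> T' = \<sigma> ` I" "S' \<inter> T' = {}" using d st by (auto simp: decomps_def)
    then have "S' = \<sigma> ` (I \<inter> \<sigma> -` S')" "T' = \<sigma> ` (I \<inter> \<sigma> -` T')"
      "(I \<inter> \<sigma> -` S', I \<inter> \<sigma> -` T') \<in> decomps I" by (auto simp: decomps_def)
    then show "d \<in> (\<lambda>(S, T). (\<sigma> ` S, \<sigma> ` T)) ` decomps I"
      unfolding st by (intro image_eqI[of _ _ "(I \<inter> \<sigma> -` S', I \<inter> \<sigma> -` T')"]) simp_all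
  next
    fix d assume "d \<in> (\<lambda>(S, T). (\<sigma> ` S, \<sigma> ` T)) ` decomps I"
    then obtain S T where st: "(S, T) \<in> decomps I" "d = (\<sigma> ` S, \<sigma> ` T)" by auto
    then show "d \<in> decomps (\<sigma> ` I)" using assms by (auto simp: decomps_def inj_on_def)
  qed
qed

section \<open>The isomorphism \<open>\<phi> : k \<cdot> q \<rightarrow> h\<close>\<close>

context hopf_quotient
begin

abbreviation C :: "'a set \<Rightarrow> ('f, 'a set \<times> 'a set \<Rightarrow> ('f, 'v, 'w) tensor) module"
  where "C I \<equiv> direct_sum (decomps I) (\<lambda>(S, T). tensor_module F (K S) (obj q T))"

lemma tensor_kq_module:
  "\<lbrakk>finite I; (S, T) \<in> decomps I\<rbrakk> \<Longrightarrow> Module.module F (tensor_module F (K S) (obj q T))"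
  by (intro module_tensor_module k_module q_module) (rule decompsD; assumption)+

lemma C_module:
  assumes "finite I"
  shows "Module.module F (C I)"
proof (rule module_direct_sum[OF is_cring])
  fix d assume "d \<in> decomps I"
  then show "Module.module F (case d of (S, T) \<Rightarrow> tensor_module F (K S) (obj q T))"
    by (cases d) (simp add: tensor_kq_module[OF assms])
qed

lemma C_component: "\<lbrakk>z \<in> carrier (C I); (S, T) \<in> decomps I\<rbrakk> \<Longrightarrow> z (S, T) \<in> carrier (tensor_module F (K S) (obj q T))"
  by (auto simp: direct_sum_def PiE_iff)

definition phi :: "'a set \<Rightarrow> ('a set \<times> 'a set \<Rightarrow> ('f, 'v, 'w) tensor) \<Rightarrow> 'v"
  where "phi I z = (\<Oplus>\<^bsub>obj h I\<^esub>d\<in>decomps I. case d of (S, T) \<Rightarrow> mu_sec S T (z (S, T)))"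

lemma mu_sec_linear_decomps:
  "\<lbrakk>finite I; (S, T) \<in> decomps I\<rbrakk> \<Longrightarrow> mu_sec S T \<in> linear_maps F (tensor_module F (K S) (obj q T)) (obj h I)"
  using mu_sec_linear[of S T] decompsD[of S T I] by simp

lemma phi_linear:
  assumes I: "finite I"
  shows "phi I \<in> linear_maps F (C I) (obj h I)"
proof -
  have "(\<lambda>z. case d of (S, T) \<Rightarrow> mu_sec S T (z (S, T))) \<in> linear_maps F (C I) (obj h I)"
    if d: "d \<in> decomps I" for d
  proof -
    obtain S T where st: "d = (S, T)" by (cases d)
    have "(\<lambda>z. z (S, T)) \<in> linear_maps F (C I) (tensor_module F (K S) (obj q T))"
      using direct_sum_component_linear[of "(S, T)" "decomps I" F "\<lambda>(S, T). tensor_module F (K S) (obj q T)"] d st by simp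
    from linear_maps_compose[OF this mu_sec_linear_decomps[OF I]] d st show ?thesis by simp
  qed
  from linear_maps_sum[OF C_module[OF I] obj_module[OF I] this, where A = "decomps I"] show ?thesis
    by (simp add: phi_def[abs_def])
qed

lemma phi_terms_closed:
  assumes "finite I" and "z \<in> carrier (C I)"
  shows "(\<lambda>(S, T). mu_sec S T (z (S, T))) \<in> decomps I \<rightarrow> carrier (obj h I)"
  using linear_maps_closed[OF mu_sec_linear_decomps[OF assms(1)] C_component[OF assms(2)]] by auto

text \<open>Applying \<open>\<psi>\<close> at \<open>(A, B)\<close> isolates the component there.
  Summands with \<open>S\<close> meeting \<open>B\<close> vanish by triangularity; the others have
  \<open>S \<subseteq> A\<close>, and those with \<open>S \<noteq> A\<close> vanish by induction on
  \<open>card A\<close>. What survives is the inclusion applied to \<open>z (A, B)\<close>, and a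
  retraction onto \<open>k[A]\<close> makes that injective.\<close>

lemma phi_kernel:
  assumes I: "finite I" and z: "z \<in> carrier (C I)" and phi: "phi I z = \<zero>\<^bsub>obj h I\<^esub>"
  shows "(A, B) \<in> decomps I \<Longrightarrow> z (A, B) = \<zero>\<^bsub>tensor_module F (K A) (obj q B)\<^esub>"
proof (induction "card A" arbitrary: A B rule: less_induct)
  case less
  note AB = decompsD[OF less.prems]
  note fin = AB(3)[OF I] AB(4)[OF I]
  let ?Q = "tensor_module F (obj h A) (obj q B)"
  note mQ = module_tensor_module[OF obj_module[OF fin(1)] q_module[OF fin(2)]]
  interpret Q: Module.module F ?Q by (rule mQ)
  note l = psi_linear[OF fin AB(2), unfolded AB(1)]
  let ?t = "\<lambda>d. psi A B (case d of (S, T) \<Rightarrow> mu_sec S T (z (S, T)))"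
  have tc: "?t \<in> decomps I \<rightarrow> carrier ?Q"
    using phi_terms_closed[OF I z] linear_maps_closed[OF l] by (auto simp: Pi_iff)
  have zero: "?t d = \<zero>\<^bsub>?Q\<^esub>" if d: "d \<in> decomps I" "d \<noteq> (A, B)" for d
  proof -
    obtain S T where st: "d = (S, T)" by (cases d)
    note ST = decompsD[OF d(1)[unfolded st]]
    note finST = ST(3)[OF I] ST(4)[OF I]
    note zc = C_component[OF z d(1)[unfolded st]]
    show ?thesis
    proof (cases "S \<inter> B = {}")
      case False
      then show ?thesis
        using psi_mu_sec_zero[OF finST fin ST(2) AB(2) _ False zc] ST(1) AB(1) st by simp
    next
      case True
      then have "S \<subseteq> A" using ST(1) AB(1) by blast
      moreover have "S \<noteq> A"
      proof
        assume "S = A"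
        moreover then have "T = B" using ST(1,2) AB(1,2) by blast
        ultimately show False using d(2) st by simp
      qed
      ultimately have "card S < card A" using fin(1) by (simp add: psubset_card_mono psubset_eq)
      then have "z (S, T) = \<zero>\<^bsub>tensor_module F (K S) (obj q T)\<^esub>" using less.hyps d(1) st by simp
      then have "mu_sec S T (z (S, T)) = \<zero>\<^bsub>obj h I\<^esub>"
        using linear_maps_zero[OF mu_sec_linear_decomps[OF I] tensor_kq_module[OF I] obj_module[OF I]] d(1) st by simp
      then show ?thesis using st linear_maps_zero[OF l obj_module[OF I] mQ] by simp
    qed
  qed
  have "psi A B (phi I z) = (\<Oplus>\<^bsub>?Q\<^esub>d\<in>decomps I. ?t d)"
    unfolding phi_def by (rule linear_maps_finsum[OF l obj_module[OF I] mQ phi_terms_closed[OF I z]])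
  also have "\<dots> = (\<Oplus>\<^bsub>?Q\<^esub>d\<in>decomps I. if (A, B) = d then ?t d else \<zero>\<^bsub>?Q\<^esub>)"
    by (rule Q.finsum_cong') (use zero Pi_mem[OF tc less.prems] in auto)
  also have "\<dots> = ?t (A, B)"
    by (rule Q.finsum_singleton[OF less.prems finite_decomps[OF I] tc])
  finally have "psi A B (mu_sec A B (z (A, B))) = \<zero>\<^bsub>?Q\<^esub>"
    using phi linear_maps_zero[OF l obj_module[OF I] mQ] by simp
  then have "tensor_map F (obj h A) (obj q B) (\<lambda>x. x) (\<lambda>y. y) (z (A, B)) = \<zero>\<^bsub>?Q\<^esub>"
    using psi_mu_sec_same[OF fin AB(2) C_component[OF z less.prems]] by simp
  moreover obtain r where "r \<in> linear_maps F (obj h A) (K A)" "\<forall>x\<in>k A. r x = x"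
    using k_retraction[OF fin(1)] by blast
  ultimately show ?case
    using tensor_map_inj_left[OF k_module[OF fin(1)] q_module[OF fin(2)] obj_module[OF fin(1)]
        k_incl_linear[OF fin(1)] _ _ C_component[OF z less.prems]] by simp
qed

lemma phi_inj:
  assumes I: "finite I"
  shows "inj_on (phi I) (carrier (C I))"
proof (rule inj_onI)
  interpret C: Module.module F "C I" by (rule C_module[OF I])
  interpret V: Module.module F "obj h I" by (rule obj_module[OF I])
  fix z w assume z: "z \<in> carrier (C I)" and w: "w \<in> carrier (C I)" and e: "phi I z = phi I w"
  have zw: "z \<ominus>\<^bsub>C I\<^esub> w \<in> carrier (C I)" using z w by simp
  have "phi I (z \<ominus>\<^bsub>C I\<^esub> w) = \<zero>\<^bsub>obj h I\<^esub>"
    using linear_maps_minus[OF phi_linear[OF I] C_module[OF I] obj_module[OF I] z w] e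
      V.minus_eq_zero_iff linear_maps_closed[OF phi_linear[OF I]] z w by simp
  note k = phi_kernel[OF I zw this]
  have "z \<ominus>\<^bsub>C I\<^esub> w = \<zero>\<^bsub>C I\<^esub>"
  proof (rule extensionalityI[of _ "decomps I"])
    show "z \<ominus>\<^bsub>C I\<^esub> w \<in> extensional (decomps I)" using zw by (simp add: direct_sum_def PiE_iff)
    show "\<zero>\<^bsub>C I\<^esub> \<in> extensional (decomps I)" by (simp add: direct_sum_def)
    show "(z \<ominus>\<^bsub>C I\<^esub> w) d = \<zero>\<^bsub>C I\<^esub> d" if "d \<in> decomps I" for d
      using k that by (cases d) (simp add: direct_sum_def[of "decomps I"] del: k)
  qed
  then show "z = w" using C.minus_eq_zero_iff z w by simp
qed

lemma cauchy_simps [simp]: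
  "obj (cauchy F (sub_monoid h k) q) I = C I"
  "spmap (cauchy F (sub_monoid h k) q) I \<sigma> z = (\<lambda>(S', T')\<in>decomps (\<sigma> ` I).
     let S = I \<inter> \<sigma> -` S'; T = I \<inter> \<sigma> -` T' in
     tensor_map F (K S') (obj q T') (spmap h S \<sigma>) (spmap q T \<sigma>) (z (S, T)))"
  by (simp_all add: cauchy_def sub_monoid_def)

lemma k_spmap_linear:
  assumes "finite I" and "inj_on \<sigma> I"
  shows "spmap h I \<sigma> \<in> linear_maps F (K I) (K (\<sigma> ` I))"
  using species.spmap_linear[OF k_species assms] by simp

text \<open>The place where naturality of the section is needed: together with naturality of the
  product it moves \<open>\<sigma>\<close> through \<open>x sec(y)\<close>.\<close>

lemma mu_sec_spmap:
  assumes h: "finite S" "finite T" "S \<inter> T = {}" and s: "inj_on \<sigma> (S \<union> T)"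
    and t: "t \<in> carrier (tensor_module F (K S) (obj q T))"
  shows "mu_sec (\<sigma> ` S) (\<sigma> ` T) (tensor_map F (K (\<sigma> ` S)) (obj q (\<sigma> ` T)) (spmap h S \<sigma>) (spmap q T \<sigma>) t) =
    spmap h (S \<union> T) \<sigma> (mu_sec S T t)"
proof -
  have i: "inj_on \<sigma> S" "inj_on \<sigma> T" using s by (auto simp: inj_on_def)
  have h': "finite (\<sigma> ` S)" "finite (\<sigma> ` T)" "\<sigma> ` S \<inter> \<sigma> ` T = {}" and fU: "finite (S \<union> T)"
    using h s by (auto simp: inj_on_def)
  have U: "\<sigma> ` S \<union> \<sigma> ` T = \<sigma> ` (S \<union> T)" by auto
  have fU': "finite (\<sigma> ` (S \<union> T))" using fU by simp
  note m = k_module[OF h(1)] q_module[OF h(2)] k_module[OF h'(1)] q_module[OF h'(2)]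
  note tm = tensor_map[OF m k_spmap_linear[OF h(1) i(1)] q_spmap_linear[OF h(2) i(2)]]
  show ?thesis
  proof (rule tensor_ext[OF m(1,2) obj_module[OF fU'] linear_maps_compose[OF tm(1) mu_sec_linear[OF h', unfolded U]]
        linear_maps_compose[OF mu_sec_linear[OF h] spmap_linear[OF fU s]] _ t])
    fix x y assume x: "x \<in> carrier (K S)" and y: "y \<in> carrier (obj q T)"
    have xk: "x \<in> k S" using x by simp
    show "mu_sec (\<sigma> ` S) (\<sigma> ` T) (tensor_map F (K (\<sigma> ` S)) (obj q (\<sigma> ` T)) (spmap h S \<sigma>) (spmap q T \<sigma>)
        (pure_tensor F (K S) (obj q T) x y)) = spmap h (S \<union> T) \<sigma> (mu_sec S T (pure_tensor F (K S) (obj q T) x y))"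
      unfolding tm(2)[OF x y] mu_sec_pure[OF h xk y]
        mu_sec_pure[OF h' k_spmap[OF h(1) i(1) xk] linear_maps_closed[OF q_spmap_linear[OF h(2) i(2)] y]]
        sec_natural[OF h(2) i(2) y]
      by (rule mu_natural[OF h s k_carrier[OF h(1) xk] linear_maps_closed[OF sec_linear[OF h(2)] y], symmetric])
  qed
qed

lemma cauchy_spmap_component:
  assumes I: "finite I" and s: "inj_on \<sigma> I" and d: "(S, T) \<in> decomps I"
  shows "spmap (cauchy F (sub_monoid h k) q) I \<sigma> z (\<sigma> ` S, \<sigma> ` T) =
    tensor_map F (K (\<sigma> ` S)) (obj q (\<sigma> ` T)) (spmap h S \<sigma>) (spmap q T \<sigma>) (z (S, T))"
proof -
  have "(\<sigma> ` S, \<sigma> ` T) \<in> decomps (\<sigma> ` I)" unfolding decomps_image(1)[OF s] using d by force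
  then show ?thesis using decomps_image(3,4)[OF s d] by simp
qed

lemma cauchy_spmap_closed:
  assumes I: "finite I" and s: "inj_on \<sigma> I" and z: "z \<in> carrier (C I)"
  shows "spmap (cauchy F (sub_monoid h k) q) I \<sigma> z \<in> carrier (C (\<sigma> ` I))"
proof -
  let ?w = "spmap (cauchy F (sub_monoid h k) q) I \<sigma> z"
  have "?w d \<in> carrier (case d of (S, T) \<Rightarrow> tensor_module F (K S) (obj q T))" if d: "d \<in> decomps (\<sigma> ` I)" for d
  proof -
    obtain S T where st: "(S, T) \<in> decomps I" "d = (\<sigma> ` S, \<sigma> ` T)"
      using d unfolding decomps_image(1)[OF s] by auto
    note D = decompsD[OF st(1)]
    have i: "inj_on \<sigma> S" "inj_on \<sigma> T" using s D(1) by (auto simp: inj_on_def)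
    note f = D(3)[OF I] D(4)[OF I]
    have f': "finite (\<sigma> ` S)" "finite (\<sigma> ` T)" using f by auto
    show ?thesis
      unfolding st(2) cauchy_spmap_component[OF I s st(1)]
      using linear_maps_closed[OF tensor_map_linear[OF k_module[OF f(1)] q_module[OF f(2)] k_module[OF f'(1)]
            q_module[OF f'(2)] k_spmap_linear[OF f(1) i(1)] q_spmap_linear[OF f(2) i(2)]] C_component[OF z st(1)]]
      by simp
  qed
  moreover have "?w \<in> extensional (decomps (\<sigma> ` I))" by simp
  ultimately show ?thesis by (simp add: direct_sum_def PiE_iff del: cauchy_simps(2))
qed

text \<open>Reindexing by the decompositions of \<open>I\<close> matches the summands one to one,
  and matching summands agree by \<open>mu_sec_spmap\<close>.\<close>

lemma phi_natural:
  assumes I: "finite I" and s: "inj_on \<sigma> I" and z: "z \<in> carrier (C I)"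
  shows "phi (\<sigma> ` I) (spmap (cauchy F (sub_monoid h k) q) I \<sigma> z) = spmap h I \<sigma> (phi I z)"
proof -
  let ?w = "spmap (cauchy F (sub_monoid h k) q) I \<sigma> z"
  let ?g = "\<lambda>(S, T). (\<sigma> ` S, \<sigma> ` T)"
  have fI: "finite (\<sigma> ` I)" using I by simp
  interpret W: Module.module F "obj h (\<sigma> ` I)" by (rule obj_module[OF fI])
  note wc = phi_terms_closed[OF fI cauchy_spmap_closed[OF I s z]]
  have eq: "(case ?g d of (S, T) \<Rightarrow> mu_sec S T (?w (S, T))) = spmap h I \<sigma> (case d of (S, T) \<Rightarrow> mu_sec S T (z (S, T)))"
    if d: "d \<in> decomps I" for d
  proof -
    obtain S T where st: "d = (S, T)" by (cases d)
    note D = decompsD[OF d[unfolded st]]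
    show ?thesis
      using mu_sec_spmap[OF D(3)[OF I] D(4)[OF I] D(2) _ C_component[OF z d[unfolded st]], of \<sigma>]
        cauchy_spmap_component[OF I s d[unfolded st], of z] s st D(1) by (simp del: cauchy_simps(2))
  qed
  have "phi (\<sigma> ` I) ?w = (\<Oplus>\<^bsub>obj h (\<sigma> ` I)\<^esub>d\<in>decomps I. case ?g d of (S, T) \<Rightarrow> mu_sec S T (?w (S, T)))"
    unfolding phi_def using wc unfolding decomps_image(1)[OF s]
    by (rule W.finsum_reindex[OF _ decomps_image(2)[OF s]])
  also have "\<dots> = (\<Oplus>\<^bsub>obj h (\<sigma> ` I)\<^esub>d\<in>decomps I. spmap h I \<sigma> (case d of (S, T) \<Rightarrow> mu_sec S T (z (S, T))))"
    by (rule W.finsum_cong'[OF refl _ eq])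
      (use phi_terms_closed[OF I z] linear_maps_closed[OF spmap_linear[OF I s]] in \<open>auto simp: Pi_iff\<close>)
  also have "\<dots> = spmap h I \<sigma> (phi I z)"
    unfolding phi_def
    by (rule linear_maps_finsum[OF spmap_linear[OF I s] obj_module[OF I] obj_module[OF fI] phi_terms_closed[OF I z], symmetric])
  finally show ?thesis .
qed

text \<open>On pure tensors this is associativity, \<open>(x v) sec(y) = x (v sec(y))\<close>. The
  closure statement rests on \<open>k\<close> being closed under products.\<close>

lemma mu_sec_act:
  assumes fin: "finite A" "finite S" "finite T" and d: "A \<inter> S = {}" "A \<inter> T = {}" "S \<inter> T = {}"
    and x: "x \<in> k A" and t: "t \<in> carrier (tensor_module F (K S) (obj q T))"
  shows "mu_sec (A \<union> S) T (tensor_map F (K (A \<union> S)) (obj q T) (mu h A S x) id t) = mu h A (S \<union> T) x (mu_sec S T t)"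
    and "tensor_map F (K (A \<union> S)) (obj q T) (mu h A S x) id t \<in> carrier (tensor_module F (K (A \<union> S)) (obj q T))"
proof -
  have d': "(A \<union> S) \<inter> T = {}" "A \<inter> (S \<union> T) = {}" and f: "finite (A \<union> S)" "finite (S \<union> T)" "finite (A \<union> (S \<union> T))"
    using d fin by auto
  note m = k_module[OF fin(2)] q_module[OF fin(3)] k_module[OF f(1)]
  have kmu: "mu h A S x \<in> linear_maps F (K S) (K (A \<union> S))"
    using bilinear_maps_right[OF species_monoid.mu_bilinear[OF k_monoid fin(1,2) d(1)]] x by simp
  have "id \<in> linear_maps F (obj q T) (obj q T)" using linear_maps_id by (simp add: id_def)
  note tm = tensor_map[OF m(1,2,3,2) kmu this]
  note xc = k_carrier[OF fin(1) x]
  show "tensor_map F (K (A \<union> S)) (obj q T) (mu h A S x) id t \<in> carrier (tensor_module F (K (A \<union> S)) (obj q T))"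
    by (rule linear_maps_closed[OF tm(1) t])
  show "mu_sec (A \<union> S) T (tensor_map F (K (A \<union> S)) (obj q T) (mu h A S x) id t) = mu h A (S \<union> T) x (mu_sec S T t)"
  proof (rule tensor_ext[OF m(1,2) obj_module[OF f(3)] linear_maps_compose[OF tm(1) mu_sec_linear[OF f(1) fin(3) d'(1), unfolded Un_assoc]]
        linear_maps_compose[OF mu_sec_linear[OF fin(2,3) d(3)] bilinear_maps_right[OF mu_bilinear[OF fin(1) f(2) d'(2)] xc]] _ t])
    fix v y assume v: "v \<in> carrier (K S)" and y: "y \<in> carrier (obj q T)"
    have vk: "v \<in> k S" using v by simp
    note sy = linear_maps_closed[OF sec_linear[OF fin(3)] y]
    show "mu_sec (A \<union> S) T (tensor_map F (K (A \<union> S)) (obj q T) (mu h A S x) id (pure_tensor F (K S) (obj q T) v y)) =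
        mu h A (S \<union> T) x (mu_sec S T (pure_tensor F (K S) (obj q T) v y))"
      using tm(2)[OF v y] mu_sec_pure[OF fin(2,3) d(3) vk y] mu_sec_pure[OF f(1) fin(3) d'(1) k_mu[OF fin(1,2) d(1) x vk] y]
        mu_assoc[OF fin d xc k_carrier[OF fin(2) vk] sy] by simp
  qed
qed

lemma cauchy_act_closed:
  assumes A: "finite A" and B: "finite B" and d: "A \<inter> B = {}" and x: "x \<in> k A" and z: "z \<in> carrier (C B)"
  shows "cauchy_act F (sub_monoid h k) q A B x z \<in> carrier (C (A \<union> B))"
proof -
  have "cauchy_act F (sub_monoid h k) q A B x z (S, T) \<in> carrier (tensor_module F (K S) (obj q T))"
    if st: "(S, T) \<in> decomps (A \<union> B)" for S T
  proof -
    have f: "finite (A \<union> B)" using A B by simp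
    note D = decompsD[OF st]
    interpret W: Module.module F "tensor_module F (K S) (obj q T)" by (rule tensor_kq_module[OF f st])
    show ?thesis
    proof (cases "A \<subseteq> S")
      case True
      then have e: "A \<union> (S - A) = S" by auto
      have st': "(S - A, T) \<in> decomps B" using st d True by (auto simp: decomps_def)
      have dd: "A \<inter> (S - A) = {}" "A \<inter> T = {}" "(S - A) \<inter> T = {}" using True D(2) by auto
      have ff: "finite (S - A)" using D(3)[OF f] by simp
      show ?thesis
        using mu_sec_act(2)[OF A ff D(4)[OF f] dd x C_component[OF z st']] st True
        unfolding e by (simp add: cauchy_act_def)
    next
      case False
      then show ?thesis using st by (simp add: cauchy_act_def)
    qed
  qed
  moreover have "cauchy_act F (sub_monoid h k) q A B x z \<in> extensional (decomps (A \<union> B))"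
    by (simp add: cauchy_act_def)
  ultimately show ?thesis by (auto simp: direct_sum_def PiE_iff)
qed

text \<open>Acting by \<open>x\<close> carries the summand at \<open>(S, T)\<close> to the one at
  \<open>(A \<union> S, T)\<close> and leaves zero wherever the first block fails to contain
  \<open>A\<close>. So the sum over the decompositions of \<open>A \<union> B\<close> collapses to
  one over those of \<open>B\<close>.\<close>

lemma phi_act:
  assumes A: "finite A" and B: "finite B" and d: "A \<inter> B = {}" and x: "x \<in> k A" and z: "z \<in> carrier (C B)"
  shows "phi (A \<union> B) (cauchy_act F (sub_monoid h k) q A B x z) = mu h A B x (phi B z)"
proof -
  let ?w = "cauchy_act F (sub_monoid h k) q A B x z"
  let ?g = "\<lambda>(S, T). (A \<union> S, T)"
  have f: "finite (A \<union> B)" using A B by simp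
  interpret W: Module.module F "obj h (A \<union> B)" by (rule obj_module[OF f])
  note wc = phi_terms_closed[OF f cauchy_act_closed[OF A B d x z]]
  note l = bilinear_maps_right[OF mu_bilinear[OF A B d] k_carrier[OF A x]]
  have g: "?g ` decomps B \<subseteq> decomps (A \<union> B)" "inj_on ?g (decomps B)"
    using d by (auto simp: decomps_def inj_on_def)
  have eq: "(case ?g e of (S, T) \<Rightarrow> mu_sec S T (?w (S, T))) = mu h A B x (case e of (S, T) \<Rightarrow> mu_sec S T (z (S, T)))"
    if e: "e \<in> decomps B" for e
  proof -
    obtain S T where st: "e = (S, T)" by (cases e)
    note D = decompsD[OF e[unfolded st]]
    have dd: "A \<inter> S = {}" "A \<inter> T = {}" "S \<inter> T = {}" "A \<union> S - A = S" using D(1,2) d by auto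
    have "(A \<union> S, T) \<in> decomps (A \<union> B)" using g(1) e st by auto
    then have "?w (A \<union> S, T) = tensor_map F (K (A \<union> S)) (obj q T) (mu h A S x) id (z (S, T))"
      by (simp add: cauchy_act_def dd(4))
    then show ?thesis
      using mu_sec_act(1)[OF A D(3)[OF B] D(4)[OF B] dd(1-3) x C_component[OF z e[unfolded st]]] st D(1) by simp
  qed
  have zero: "(case e of (S, T) \<Rightarrow> mu_sec S T (?w (S, T))) = \<zero>\<^bsub>obj h (A \<union> B)\<^esub>"
    if e: "e \<in> decomps (A \<union> B) - ?g ` decomps B" for e
  proof -
    obtain S T where st: "e = (S, T)" by (cases e)
    have e1: "(S, T) \<in> decomps (A \<union> B)" using e st by simp
    have "\<not> A \<subseteq> S"
    proof
      assume "A \<subseteq> S"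
      then have "(S - A, T) \<in> decomps B" "e = ?g (S - A, T)" using e1 st d by (auto simp: decomps_def)
      then show False using e by blast
    qed
    then have "?w (S, T) = \<zero>\<^bsub>tensor_module F (K S) (obj q T)\<^esub>" using e1 by (simp add: cauchy_act_def)
    then show ?thesis
      using st linear_maps_zero[OF mu_sec_linear_decomps[OF f e1] tensor_kq_module[OF f e1] obj_module[OF f]] by simp
  qed
  have "phi (A \<union> B) ?w = (\<Oplus>\<^bsub>obj h (A \<union> B)\<^esub>e\<in>?g ` decomps B. case e of (S, T) \<Rightarrow> mu_sec S T (?w (S, T)))"
    unfolding phi_def
    by (rule W.add.finprod_mono_neutral_cong_right[OF finite_decomps[OF f] g(1) zero refl wc])
  also have "\<dots> = (\<Oplus>\<^bsub>obj h (A \<union> B)\<^esub>e\<in>decomps B. case ?g e of (S, T) \<Rightarrow> mu_sec S T (?w (S, T)))"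
    by (rule W.finsum_reindex[OF _ g(2)]) (use wc g(1) in blast)
  also have "\<dots> = (\<Oplus>\<^bsub>obj h (A \<union> B)\<^esub>e\<in>decomps B. mu h A B x (case e of (S, T) \<Rightarrow> mu_sec S T (z (S, T))))"
    by (rule W.finsum_cong'[OF refl _ eq])
      (use phi_terms_closed[OF B z] linear_maps_closed[OF l] in \<open>auto simp: Pi_iff\<close>)
  also have "\<dots> = mu h A B x (phi B z)"
    unfolding phi_def
    by (rule linear_maps_finsum[OF l obj_module[OF B] obj_module[OF f] phi_terms_closed[OF B z], symmetric])
  finally show ?thesis .
qed

lemma sec_in_phi_image:
  assumes I: "finite I" and y: "y \<in> carrier (obj q I)"
  shows "sec I y \<in> phi I ` carrier (C I)"
proof -
  interpret V: Module.module F "obj h I" by (rule obj_module[OF I])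
  have e: "({}, I) \<in> decomps I" by (simp add: decomps_def)
  have fe: "finite ({}::'a set)" by simp
  \<comment> \<open>The witness is \<open>1 \<otimes> y\<close> placed at
    \<open>(\<emptyset>, I)\<close>, with zero elsewhere; the unit law turns it into
    \<open>sec I y\<close>.\<close>
  define z where "z = (\<lambda>(S, T)\<in>decomps I. if S = {} then pure_tensor F (K {}) (obj q I) (unit_elt h) y
    else \<zero>\<^bsub>tensor_module F (K S) (obj q T)\<^esub>)"
  have z: "z (S, T) = (if S = {} then pure_tensor F (K {}) (obj q I) (unit_elt h) y
    else \<zero>\<^bsub>tensor_module F (K S) (obj q T)\<^esub>)" if "(S, T) \<in> decomps I" for S T
    using that by (simp add: z_def)
  have p: "pure_tensor F (K {}) (obj q I) (unit_elt h) y \<in> carrier (tensor_module F (K {}) (obj q I))"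
    using k_unit by (intro pure_tensor_closed[OF k_module[OF fe] q_module[OF I] _ y]) simp
  have zc: "z \<in> carrier (C I)"
  proof -
    have "z (S, T) \<in> carrier (tensor_module F (K S) (obj q T))" if st: "(S, T) \<in> decomps I" for S T
    proof -
      interpret W: Module.module F "tensor_module F (K S) (obj q T)" by (rule tensor_kq_module[OF I st])
      have "S = {} \<Longrightarrow> T = I" using st by (simp add: decomps_def)
      then show ?thesis using z[OF st] p by auto
    qed
    moreover have "z \<in> extensional (decomps I)" by (simp add: z_def)
    ultimately show ?thesis by (auto simp: direct_sum_def PiE_iff)
  qed
  note tc = phi_terms_closed[OF I zc]
  have "phi I z = (\<Oplus>\<^bsub>obj h I\<^esub>d\<in>decomps I. if ({}, I) = d then (case d of (S, T) \<Rightarrow> mu_sec S T (z (S, T))) else \<zero>\<^bsub>obj h I\<^esub>)"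
    unfolding phi_def
  proof (rule V.finsum_cong'[OF refl])
    show "(\<lambda>d. if ({}, I) = d then (case d of (S, T) \<Rightarrow> mu_sec S T (z (S, T))) else \<zero>\<^bsub>obj h I\<^esub>) \<in> decomps I \<rightarrow> carrier (obj h I)"
      using tc by (auto simp: Pi_iff)
    fix d assume d: "d \<in> decomps I"
    obtain S T where st: "d = (S, T)" by (cases d)
    show "(case d of (S, T) \<Rightarrow> mu_sec S T (z (S, T))) =
        (if ({}, I) = d then (case d of (S, T) \<Rightarrow> mu_sec S T (z (S, T))) else \<zero>\<^bsub>obj h I\<^esub>)"
    proof (cases "S = {}")
      case True
      then show ?thesis using d st by (simp add: decomps_def)
    next
      case False
      then show ?thesis
        using st z[of S T] d
          linear_maps_zero[OF mu_sec_linear_decomps[OF I] tensor_kq_module[OF I] obj_module[OF I], of S T] by simp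
    qed
  qed
  also have "\<dots> = mu_sec {} I (z ({}, I))"
    using V.finsum_singleton[OF e finite_decomps[OF I] tc] by simp
  also have "\<dots> = sec I y"
    using mu_sec_pure[OF fe I _ k_unit y] z[OF e] mu_unit_left[OF I linear_maps_closed[OF sec_linear[OF I] y]] by simp
  finally have "phi I z = sec I y" .
  then show ?thesis using imageI[OF zc, of "phi I"] by simp
qed

text \<open>Compatibility with the action drives the induction: in a generator \<open>x y\<close> of
  the ideal, \<open>y\<close> lives on a strictly smaller set because the block of \<open>x\<close>
  is nonempty, so \<open>y = phi T z\<close>, and \<open>x y\<close> is the image of
  \<open>z\<close> acted on by \<open>x\<close>.\<close>

lemma phi_surj: "finite I \<Longrightarrow> phi I ` carrier (C I) = carrier (obj h I)"
proof (induction "card I" arbitrary: I rule: less_induct)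
  case less
  note I = less.prems
  interpret V: Module.module F "obj h I" by (rule obj_module[OF I])
  note im = submodule_image[OF phi_linear[OF I] C_module[OF I] obj_module[OF I]]
  note imD = submoduleD[OF im obj_module[OF I]]
  have N: "N I \<subseteq> phi I ` carrier (C I)"
    unfolding plus_ideal_def
  proof (rule mod_span_minimal[OF im], clarify)
    fix S T x y assume st: "(S, T) \<in> decomps I" and S: "S \<noteq> {}" and x: "x \<in> k S" and y: "y \<in> carrier (obj h T)"
    note D = decompsD[OF st]
    have "T \<subset> I" using S D(1,2) by auto
    then have "card T < card I" using I by (simp add: psubset_card_mono)
    then have "y \<in> phi T ` carrier (C T)" using less.hyps D(4)[OF I] y by simp
    then obtain z where z: "z \<in> carrier (C T)" "y = phi T z" by auto
    have "mu h S T x y = phi I (cauchy_act F (sub_monoid h k) q S T x z)"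
      using phi_act[OF D(3)[OF I] D(4)[OF I] D(2) x z(1)] z(2) D(1) by simp
    moreover have "cauchy_act F (sub_monoid h k) q S T x z \<in> carrier (C I)"
      using cauchy_act_closed[OF D(3)[OF I] D(4)[OF I] D(2) x z(1)] D(1) by simp
    ultimately show "mu h S T x y \<in> phi I ` carrier (C I)" by (rule image_eqI)
  qed
  show ?case
  proof (intro equalityI imD(1) subsetI)
    fix x assume x: "x \<in> carrier (obj h I)"
    note px = linear_maps_closed[OF proj_linear[OF I] x]
    \<comment> \<open>\<open>proj I x\<close> is the section at the class of \<open>x\<close>, hence
      reached from the summand at \<open>(\<emptyset>, I)\<close>.\<close>
    have "proj I x \<in> phi I ` carrier (C I)"
      using sec_in_phi_image[OF I linear_maps_closed[OF pr_linear[OF I] x]] sec_pr[OF I x] by simp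
    moreover have "x \<ominus>\<^bsub>obj h I\<^esub> proj I x \<in> phi I ` carrier (C I)" using N proj_diff[OF I x] by blast
    ultimately have "(x \<ominus>\<^bsub>obj h I\<^esub> proj I x) \<oplus>\<^bsub>obj h I\<^esub> proj I x \<in> phi I ` carrier (C I)"
      by (intro imD(3))
    then show "x \<in> phi I ` carrier (C I)" using x px by (simp add: a_minus_def V.a_assoc V.l_neg)
  qed
qed

text \<open>That \<open>k \<cdot> q\<close> is a species and a left module is part of the claim;
  both come from \<open>h\<close> by transport along the bijection \<open>phi\<close>.\<close>

theorem isomorphic_cauchy:
  "left_modules_isomorphic F (sub_monoid h k) h (mu h)
    (cauchy F (sub_monoid h k) q) (cauchy_act F (sub_monoid h k) q)"
proof (rule left_modules_isomorphic_transport[OF h_left_module, where f = phi])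
  fix I :: "'a set" assume I: "finite I"
  show "Module.module F (obj (cauchy F (sub_monoid h k) q) I)" using C_module[OF I] by simp
  show "phi I \<in> linear_maps F (obj (cauchy F (sub_monoid h k) q) I) (obj h I)" using phi_linear[OF I] by simp
  show "bij_betw (phi I) (carrier (obj (cauchy F (sub_monoid h k) q) I)) (carrier (obj h I))"
    using phi_inj[OF I] phi_surj[OF I] by (simp add: bij_betw_def)
next
  fix S T :: "'a set" and x z
  assume "finite S" "finite T" "S \<inter> T = {}" "x \<in> carrier (obj (sub_monoid h k) S)"
    "z \<in> carrier (obj (cauchy F (sub_monoid h k) q) T)"
  moreover from this have "x \<in> k S" by simp
  ultimately show "cauchy_act F (sub_monoid h k) q S T x z \<in> carrier (obj (cauchy F (sub_monoid h k) q) (S \<union> T))"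
    "phi (S \<union> T) (cauchy_act F (sub_monoid h k) q S T x z) = mu h S T x (phi T z)"
    by (simp_all only: cauchy_simps(1) cauchy_act_closed phi_act)
qed (simp_all only: cauchy_simps(1) cauchy_spmap_closed phi_natural)

end

section \<open>Two models of the quotient \<open>h/k\<^sub>+h\<close>\<close>

context hopf_submonoid_pair
begin

text \<open>The image of \<open>proj\<close> is a natural complement of the ideal, hence a copy of
  the quotient with elements in the type of \<open>h\<close>.\<close>

abbreviation complement_species :: "('a, 'f, 'v) species"
  where "complement_species \<equiv>
    \<lparr>obj = \<lambda>I. (obj h I)\<lparr>carrier := proj I ` carrier (obj h I)\<rparr>, spmap = spmap h\<rparr>"

lemma complement_quotient: "hopf_quotient F h k complement_species proj"
proof (intro hopf_quotient.intro hopf_quotient_axioms.intro hopf_submonoid_pair_axioms)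
  fix I :: "'a set" assume I: "finite I"
  show "Module.module F (obj complement_species I)"
    using submodule.submodule_is_module[OF submodule_image[OF proj_linear[OF I] obj_module[OF I] obj_module[OF I]]
        obj_module[OF I]] by simp
  show "proj I \<in> linear_maps F (obj h I) (obj complement_species I)"
    using linear_maps_into_subspace[OF proj_linear[OF I]] by simp
qed (simp_all add: proj_natural proj_eq_zero_iff)

text \<open>Freeness asks that \<open>q\<close> itself be a species, which goes beyond
  \<open>hopf_quotient\<close>. The functorial identities restrict from \<open>h\<close>; that the
  maps stay inside the complement is naturality of \<open>proj\<close>, and finite dimension comes
  from its being an image of \<open>h\<close>.\<close>

lemma complement_species: "species F complement_species"
proof -
  interpret Q: hopf_quotient F h k complement_species proj by (rule complement_quotient)
  show ?thesis
  proof (intro species.intro species_axioms.intro field_axioms)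
    fix I :: "'a set" assume I: "finite I"
    have car: "x \<in> carrier (obj h I)" if "x \<in> carrier (obj complement_species I)" for x
      using that linear_maps_closed[OF proj_linear[OF I]] by auto
    show "Module.module F (obj complement_species I)" by (rule Q.q_module[OF I])
    show "finite_dimensional F (obj complement_species I)"
      by (rule finite_dimensional_image[OF Q.pr_linear[OF I] obj_module[OF I] Q.q_module[OF I] Q.pr_surj[OF I]
            obj_finite_dimensional[OF I]])
    { fix \<sigma> :: "'a \<Rightarrow> 'a" assume s: "inj_on \<sigma> I"
      show "spmap complement_species I \<sigma> \<in> linear_maps F (obj complement_species I) (obj complement_species (\<sigma> ` I))"
        by (rule Q.q_spmap_linear[OF I s])
      { fix \<tau> :: "'a \<Rightarrow> 'a" and x assume "\<And>i. i \<in> I \<Longrightarrow> \<sigma> i = \<tau> i" "x \<in> carrier (obj complement_species I)"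
        then show "spmap complement_species I \<sigma> x = spmap complement_species I \<tau> x"
          using spmap_cong[OF I s, of \<tau> x] car[of x] by simp }
      { fix \<tau> :: "'a \<Rightarrow> 'a" and x assume "inj_on \<tau> (\<sigma> ` I)" "x \<in> carrier (obj complement_species I)"
        then show "spmap complement_species I (\<tau> \<circ> \<sigma>) x =
            spmap complement_species (\<sigma> ` I) \<tau> (spmap complement_species I \<sigma> x)"
          using spmap_comp[OF I s, of \<tau> x] car[of x] by simp } }
    { fix x assume "x \<in> carrier (obj complement_species I)"
      then show "spmap complement_species I id x = x" using spmap_id[OF I, of x] car[of x] by simp }
  qed
qed

text \<open>The preimage is found by moving back along the inverse bijection, which also preserves
  the ideal. Surjectivity is what makes the image of a coset a whole coset instead of a part of
  one.\<close>

lemma plus_ideal_spmap_surj: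
  assumes I: "finite I" and s: "inj_on \<sigma> I" and y: "y \<in> N (\<sigma> ` I)"
  shows "\<exists>x\<in>N I. y = spmap h I \<sigma> x"
proof
  let ?i = "inv_into I \<sigma>" and ?I = "\<sigma> ` I"
  have f: "finite ?I" and i: "inj_on ?i ?I" and im: "?i ` ?I = I"
    using I s by (auto simp: inj_on_inv_into)
  have yc: "y \<in> carrier (obj h ?I)" using submodule_subset[OF plus_ideal_submodule[OF f] obj_module[OF f]] y by blast
  show "spmap h ?I ?i y \<in> N I"
    using plus_ideal_subspecies f i y im unfolding subspecies_def by (metis image_subset_iff)
  have "spmap h I \<sigma> (spmap h ?I ?i y) = spmap h ?I (\<sigma> \<circ> ?i) y"
    using spmap_comp[OF f i _ yc, of \<sigma>] s im by simp
  also have "\<dots> = spmap h ?I id y"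
    using s im i by (intro spmap_cong f yc comp_inj_on) (auto simp: f_inv_into_f)
  finally show "y = spmap h I \<sigma> (spmap h ?I ?i y)" using spmap_id[OF f yc] by simp
qed

lemma quot_species_quotient:
  "hopf_quotient F h k (quot_species h N) (\<lambda>I x. N I +>\<^bsub>obj h I\<^esub> x)"
proof (intro hopf_quotient.intro hopf_quotient_axioms.intro hopf_submonoid_pair_axioms)
  fix I :: "'a set" assume I: "finite I"
  interpret V: Module.module F "obj h I" by (rule obj_module[OF I])
  note Q = quot_module[OF obj_module[OF I] plus_ideal_submodule[OF I]]
  show "Module.module F (obj (quot_species h N) I)"
    "(\<lambda>x. N I +>\<^bsub>obj h I\<^esub> x) \<in> linear_maps F (obj h I) (obj (quot_species h N) I)"
    "(\<lambda>x. N I +>\<^bsub>obj h I\<^esub> x) ` carrier (obj h I) = carrier (obj (quot_species h N) I)"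
    using Q(1-3) by (simp_all add: quot_species_def)
  { fix x assume x: "x \<in> carrier (obj h I)"
    have "N I +>\<^bsub>obj h I\<^esub> \<zero>\<^bsub>obj h I\<^esub> = \<zero>\<^bsub>quot_module (obj h I) (N I)\<^esub>"
      by (rule linear_maps_zero[OF Q(2) obj_module[OF I] Q(1)])
    then show "N I +>\<^bsub>obj h I\<^esub> x = \<zero>\<^bsub>obj (quot_species h N) I\<^esub> \<longleftrightarrow> x \<in> N I"
      using Q(4)[OF x V.zero_closed] V.minus_zero_right[OF x] by (simp add: quot_species_def)
    fix \<sigma> :: "'a \<Rightarrow> 'a" assume s: "inj_on \<sigma> I"
    have f: "finite (\<sigma> ` I)" using I by simp
    note sD = linear_mapsD[OF spmap_linear[OF I s]]
    have NV: "n \<in> carrier (obj h I)" if "n \<in> N I" for n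
      using submodule_subset[OF plus_ideal_submodule[OF I] obj_module[OF I]] that by blast
    have Ns: "spmap h I \<sigma> n \<in> N (\<sigma> ` I)" if "n \<in> N I" for n
      using plus_ideal_subspecies I s that unfolding subspecies_def by (meson image_subset_iff)
    have "N (\<sigma> ` I) +>\<^bsub>obj h (\<sigma> ` I)\<^esub> spmap h I \<sigma> x = spmap h I \<sigma> ` (N I +>\<^bsub>obj h I\<^esub> x)"
    proof (intro equalityI subsetI)
      fix y assume "y \<in> N (\<sigma> ` I) +>\<^bsub>obj h (\<sigma> ` I)\<^esub> spmap h I \<sigma> x"
      then obtain n' where "n' \<in> N (\<sigma> ` I)" "y = n' \<oplus>\<^bsub>obj h (\<sigma> ` I)\<^esub> spmap h I \<sigma> x"
        by (auto simp: a_r_coset_def')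
      moreover from this(1) obtain n where "n \<in> N I" "n' = spmap h I \<sigma> n"
        using plus_ideal_spmap_surj[OF I s] by blast
      ultimately have "y = spmap h I \<sigma> (n \<oplus>\<^bsub>obj h I\<^esub> x)" "n \<oplus>\<^bsub>obj h I\<^esub> x \<in> N I +>\<^bsub>obj h I\<^esub> x"
        using x NV by (auto simp: sD a_r_coset_def')
      then show "y \<in> spmap h I \<sigma> ` (N I +>\<^bsub>obj h I\<^esub> x)" by (rule image_eqI)
    next
      fix y assume "y \<in> spmap h I \<sigma> ` (N I +>\<^bsub>obj h I\<^esub> x)"
      then obtain n where "n \<in> N I" "y = spmap h I \<sigma> (n \<oplus>\<^bsub>obj h I\<^esub> x)" by (auto simp: a_r_coset_def')
      then have "y = spmap h I \<sigma> n \<oplus>\<^bsub>obj h (\<sigma> ` I)\<^esub> spmap h I \<sigma> x" "spmap h I \<sigma> n \<in> N (\<sigma> ` I)"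
        using x NV Ns by (auto simp: sD)
      then show "y \<in> N (\<sigma> ` I) +>\<^bsub>obj h (\<sigma> ` I)\<^esub> spmap h I \<sigma> x" by (auto simp: a_r_coset_def')
    qed
    then show "N (\<sigma> ` I) +>\<^bsub>obj h (\<sigma> ` I)\<^esub> spmap h I \<sigma> x = spmap (quot_species h N) I \<sigma> (N I +>\<^bsub>obj h I\<^esub> x)"
      by (simp add: quot_species_def) }
qed

end

theorem theorem2p2:
  fixes F :: "('f, 'r) ring_scheme"
    and h :: "('a::infinite, 'f, 'v) hopf_species"
    and k :: "'a set \<Rightarrow> 'v set"
  assumes "char_zero_field F"
    and "hopf_monoid F h"
    and "connected_species F h"
    and "hopf_submonoid F h k"
  shows "free_left_module F (sub_monoid h k) h (mu h) \<and>
    left_modules_isomorphic F (sub_monoid h k)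
      h (mu h)
      (cauchy F (sub_monoid h k) (quot_species h (plus_ideal F h k)))
      (cauchy_act F (sub_monoid h k) (quot_species h (plus_ideal F h k)))"
proof -
  interpret hopf_submonoid_pair F h k
    using assms by (intro hopf_submonoid_pair.intro hopf_submonoid_pair_axioms.intro)
  \<comment> \<open>Freeness is witnessed by the complement inside \<open>h\<close>, the explicit
    isomorphism by the cosets: one theorem applied to two models.\<close>
  show ?thesis
    unfolding free_left_module_def
    using complement_species hopf_quotient.isomorphic_cauchy[OF complement_quotient]
      hopf_quotient.isomorphic_cauchy[OF quot_species_quotient] by blast
qed

end
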